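(* Let $\mathcal{D}$ be a separable Hilbert space and let $B \in \mathcal{S}(\mathcal{D}, \mathbb{C})$ be such that $\log (1- BB^* ) \in L^1(\mathbb{T})$. Then the polynomials are dense in $\mathcal{H}(B)$.
   Context: $\mathbb{D}$ is the open unit disc and $\mathbb{T}$ the unit circle. For separable Hilbert spaces $\mathcal{D},\mathcal{E}$, $H^2(\mathcal{D})$ is the Hardy space of power series on $\mathbb{D}$ with square summable coefficients in $\mathcal{D}$, $H^2=H^2(\mathbb{C})$, and $\mathcal{S}(\mathcal{D},\mathcal{E})$ is the Schur class: analytic functions on $\mathbb{D}$ whose values are contractive operators from $\mathcal{D}$ to $\mathcal{E}$. For $B\in\mathcal{S}(\mathcal{D},\mathbb{C})$, $T_B:H^2(\mathcal{D})\to H^2$ is multiplication by $B$, and on $\mathbb{T}$, $B(z)$ denotes the boundary values, so that $BB^*$ is the scalar function $z\mapsto B(z)B(z)^*$ defined a.e. on $\mathbb{T}$. For a bounded operator $A$, $\mathcal{M}(A)$ is the range of $A$ with the Hilbert space norm making $A$ a coisometry onto $\mathcal{M}(A)$ (i.e. $\|Ax\|_{\mathcal{M}(A)}=\|x\|$ for $x\perp\ker A$). The de Branges-Rovnyak space is $\mathcal{H}(B)=\mathcal{M}((I-T_BT_B^* )^{1/2})$; it is contractively contained in $H^2$ and has reproducing kernel $K^B_w(z)=\frac{1-B(z)B(w)^*}{1-z\overline{w}}$. The assertion includes that the polynomials are contained in $\mathcal{H}(B)$; density is in the norm of $\mathcal{H}(B)$. *)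

theory Defs
  imports "HOL-Analysis.Analysis" "HOL-Computational_Algebra.Polynomial"
begin

section \<open>Complex Hilbert spaces\<close>

text \<open>The inner product is linear in the first argument and antilinear in the second.\<close>

class complex_hilbert = banach +
  fixes scaleC :: "complex \<Rightarrow> 'a \<Rightarrow> 'a"  (infixr "*\<^sub>C" 75)
    and cinner :: "'a \<Rightarrow> 'a \<Rightarrow> complex"
  assumes scaleC_add_right: "c *\<^sub>C (x + y) = c *\<^sub>C x + c *\<^sub>C y"
    and scaleC_add_left: "(c + d) *\<^sub>C x = c *\<^sub>C x + d *\<^sub>C x"
    and scaleC_scaleC: "c *\<^sub>C d *\<^sub>C x = (c * d) *\<^sub>C x"
    and scaleC_of_real: "complex_of_real r *\<^sub>C x = scaleR r x"
    and cinner_commute: "cinner y x = cnj (cinner x y)"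
    and cinner_add_left: "cinner (x + y) z = cinner x z + cinner y z"
    and cinner_scaleC_left: "cinner (c *\<^sub>C x) y = c * cinner x y"
    and cinner_self: "cinner x x = complex_of_real ((norm x)\<^sup>2)"

instantiation complex :: complex_hilbert
begin

definition scaleC_complex :: "complex \<Rightarrow> complex \<Rightarrow> complex"
  where "scaleC_complex c x = c * x"

definition cinner_complex :: "complex \<Rightarrow> complex \<Rightarrow> complex"
  where "cinner_complex x y = x * cnj y"

instance
proof
  show "cinner x x = complex_of_real ((norm x)\<^sup>2)" for x :: complex
    unfolding cinner_complex_def by (metis complex_norm_square)
qed (auto simp: scaleC_complex_def cinner_complex_def algebra_simps scaleR_conv_of_real)

end

lemma cinner_add_right: "cinner x (y + z) = cinner x y + cinner (x::'a::complex_hilbert) z"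
  by (metis cinner_add_left cinner_commute complex_cnj_add)

lemma cinner_scaleC_right: "cinner x (c *\<^sub>C y) = cnj c * cinner (x::'a::complex_hilbert) y"
  by (metis cinner_scaleC_left cinner_commute complex_cnj_mult)

lemma scaleC_zero_right [simp]: "c *\<^sub>C (0::'a::complex_hilbert) = 0"
  using scaleC_add_right[of c 0 "0::'a"] by simp

lemma norm_scaleC: "norm (c *\<^sub>C x) = cmod c * norm (x::'a::complex_hilbert)"
proof -
  have "complex_of_real ((norm (c *\<^sub>C x))\<^sup>2) = c * cnj c * complex_of_real ((norm x)\<^sup>2)"
    unfolding cinner_self[symmetric] by (simp add: cinner_scaleC_left cinner_scaleC_right)
  also have "\<dots> = complex_of_real ((cmod c * norm x)\<^sup>2)"
    by (simp add: complex_norm_square power_mult_distrib flip: of_real_power)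
  finally show ?thesis
    by (simp only: of_real_eq_iff) simp
qed

lemma Cauchy_Schwarz_cinner: "cmod (cinner x y) \<le> norm x * norm (y::'a::complex_hilbert)"
proof (cases "y = 0")
  case True
  have "cinner x (0::'a) = 0"
    using cinner_add_right[of x 0 "0::'a"] by simp
  with True show ?thesis by simp
next
  case False
  define n where "n = (norm y)\<^sup>2"
  have n: "n > 0" using False by (simp add: n_def)
  define a where "a = cinner x y"
  define z where "z = complex_of_real n *\<^sub>C x + (- a) *\<^sub>C y"
  have yx: "cinner y x = cnj a" by (simp add: a_def cinner_commute[of x y])
  have "complex_of_real ((norm z)\<^sup>2) = cinner z z" by (simp only: cinner_self)
  also have "\<dots> = n * n * complex_of_real ((norm x)\<^sup>2) - n * cnj a * a - a * n * cnj a
      + a * cnj a * complex_of_real ((norm y)\<^sup>2)"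
    unfolding z_def
    by (simp add: cinner_add_left cinner_add_right cinner_scaleC_left cinner_scaleC_right
        yx cinner_self[of x] cinner_self[of y] flip: a_def) (simp add: algebra_simps)
  also have "\<dots> = n * n * complex_of_real ((norm x)\<^sup>2) - n * (a * cnj a)"
    by (simp add: n_def algebra_simps)
  also have "\<dots> = complex_of_real (n * n * (norm x)\<^sup>2 - n * (cmod a)\<^sup>2)"
    by (simp add: complex_norm_square flip: of_real_power)
  finally have "(norm z)\<^sup>2 = n * n * (norm x)\<^sup>2 - n * (cmod a)\<^sup>2"
    by (simp only: of_real_eq_iff)
  then have "0 \<le> n * (n * (norm x)\<^sup>2 - (cmod a)\<^sup>2)"
    by (metis mult.assoc right_diff_distrib zero_le_power2)
  with n have "(cmod a)\<^sup>2 \<le> n * (norm x)\<^sup>2"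
    by (simp add: zero_le_mult_iff)
  then have "(cmod a)\<^sup>2 \<le> (norm x * norm y)\<^sup>2"
    by (simp add: n_def power_mult_distrib mult.commute)
  then show ?thesis
    unfolding a_def by (rule power2_le_imp_le) simp
qed


section \<open>The Hardy space of power series with square summable coefficients\<close>

typedef (overloaded) 'a hardy2 = "{a :: nat \<Rightarrow> 'a::complex_hilbert. summable (\<lambda>n. (norm (a n))\<^sup>2)}"
  morphisms h2_coeff Abs_hardy2
  by (rule exI[of _ "\<lambda>_. 0"]) simp

lemma summable_h2_coeff: "summable (\<lambda>n. (norm (h2_coeff f n))\<^sup>2)"
  using h2_coeff[of f] by simp

lemma hardy2_eqI: "(\<And>n. h2_coeff f n = h2_coeff g n) \<Longrightarrow> f = g"
  by (metis h2_coeff_inject ext)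

lemma L2_set_bounded_imp:
  fixes b :: "nat \<Rightarrow> real"
  assumes "\<And>N. L2_set b {..<N} \<le> C"
  shows "summable (\<lambda>n. (b n)\<^sup>2)" "sqrt (\<Sum>n. (b n)\<^sup>2) \<le> C"
proof -
  have C: "C \<ge> 0" using assms[of 0] by simp
  have le: "(\<Sum>n<N. (b n)\<^sup>2) \<le> C\<^sup>2" for N
    using assms[of N] C unfolding L2_set_def
    by (metis real_sqrt_le_iff real_sqrt_unique)
  show s: "summable (\<lambda>n. (b n)\<^sup>2)"
  proof (rule summableI_nonneg_bounded)
    show "(\<Sum>n<N. (b n)\<^sup>2) \<le> C\<^sup>2" for N by (rule le)
  qed simp
  have "(\<Sum>n. (b n)\<^sup>2) \<le> C\<^sup>2"
    using suminf_le_const[OF s] le by blast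
  then show "sqrt (\<Sum>n. (b n)\<^sup>2) \<le> C"
    using C by (metis real_sqrt_le_iff real_sqrt_unique)
qed

lemma L2_set_le_suminf:
  fixes b :: "nat \<Rightarrow> real"
  assumes "summable (\<lambda>n. (b n)\<^sup>2)"
  shows "L2_set b {..<N} \<le> sqrt (\<Sum>n. (b n)\<^sup>2)"
  unfolding L2_set_def using sum_le_suminf[OF assms, of "{..<N}"] by simp

lemma L2_set_norm_add:
  "L2_set (\<lambda>n. norm (a n + b n)) A \<le> L2_set (\<lambda>n. norm (a n)) A + L2_set (\<lambda>n. norm (b n)) A"
proof -
  have "L2_set (\<lambda>n. norm (a n + b n)) A \<le> L2_set (\<lambda>n. norm (a n) + norm (b n)) A"
    by (intro L2_set_mono norm_triangle_ineq norm_ge_zero)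
  also have "\<dots> \<le> L2_set (\<lambda>n. norm (a n)) A + L2_set (\<lambda>n. norm (b n)) A"
    by (rule L2_set_triangle_ineq)
  finally show ?thesis .
qed

lemma L2_set_h2_add:
  "L2_set (\<lambda>n. norm (h2_coeff f n + h2_coeff g n)) {..<N}
    \<le> sqrt (\<Sum>n. (norm (h2_coeff f n))\<^sup>2) + sqrt (\<Sum>n. (norm (h2_coeff g n))\<^sup>2)"
  using L2_set_norm_add[of "h2_coeff f" "h2_coeff g" "{..<N}"]
    L2_set_le_suminf[OF summable_h2_coeff, of f N] L2_set_le_suminf[OF summable_h2_coeff, of g N]
  by linarith

lemma summable_h2_scaleC: "summable (\<lambda>n. (norm (c *\<^sub>C h2_coeff f n))\<^sup>2)"
  by (simp add: norm_scaleC power_mult_distrib summable_mult summable_h2_coeff)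

lemma summable_h2_cinner: "summable (\<lambda>n. cinner (h2_coeff f n) (h2_coeff g n))"
proof (rule summable_comparison_test')
  show "summable (\<lambda>n. (norm (h2_coeff f n))\<^sup>2 + (norm (h2_coeff g n))\<^sup>2)"
    by (intro summable_add summable_h2_coeff)
next
  fix n :: nat
  have "cmod (cinner (h2_coeff f n) (h2_coeff g n)) \<le> norm (h2_coeff f n) * norm (h2_coeff g n)"
    by (rule Cauchy_Schwarz_cinner)
  also have "\<dots> \<le> (norm (h2_coeff f n))\<^sup>2 + (norm (h2_coeff g n))\<^sup>2"
    using sum_squares_bound[of "norm (h2_coeff f n)" "norm (h2_coeff g n)"]
      mult_nonneg_nonneg[OF norm_ge_zero[of "h2_coeff f n"] norm_ge_zero[of "h2_coeff g n"]]
    by linarith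
  finally show "norm (cinner (h2_coeff f n) (h2_coeff g n))
      \<le> (norm (h2_coeff f n))\<^sup>2 + (norm (h2_coeff g n))\<^sup>2" .
qed

instantiation hardy2 :: (complex_hilbert) real_normed_vector
begin

definition zero_hardy2 :: "'a hardy2"
  where "0 = Abs_hardy2 (\<lambda>_. 0)"

definition plus_hardy2 :: "'a hardy2 \<Rightarrow> 'a hardy2 \<Rightarrow> 'a hardy2"
  where "f + g = Abs_hardy2 (\<lambda>n. h2_coeff f n + h2_coeff g n)"

definition scaleR_hardy2 :: "real \<Rightarrow> 'a hardy2 \<Rightarrow> 'a hardy2"
  where "scaleR r f = Abs_hardy2 (\<lambda>n. scaleR r (h2_coeff f n))"

definition uminus_hardy2 :: "'a hardy2 \<Rightarrow> 'a hardy2"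
  where "- f = scaleR (- 1) (f :: 'a hardy2)"

definition minus_hardy2 :: "'a hardy2 \<Rightarrow> 'a hardy2 \<Rightarrow> 'a hardy2"
  where "f - g = f + - (g :: 'a hardy2)"

definition norm_hardy2 :: "'a hardy2 \<Rightarrow> real"
  where "norm f = sqrt (\<Sum>n. (norm (h2_coeff f n))\<^sup>2)"

definition dist_hardy2 :: "'a hardy2 \<Rightarrow> 'a hardy2 \<Rightarrow> real"
  where "dist f g = norm (f - (g :: 'a hardy2))"

definition sgn_hardy2 :: "'a hardy2 \<Rightarrow> 'a hardy2"
  where "sgn f = scaleR (inverse (norm f)) (f :: 'a hardy2)"

definition uniformity_hardy2 :: "('a hardy2 \<times> 'a hardy2) filter"
  where "uniformity_hardy2 = (INF e\<in>{0<..}. principal {(x, y). dist x y < e})"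

definition open_hardy2 :: "'a hardy2 set \<Rightarrow> bool"
  where "open_hardy2 S = (\<forall>x\<in>S. \<forall>\<^sub>F (x', y) in uniformity. x' = x \<longrightarrow> y \<in> S)"

lemma h2_coeff_zero: "h2_coeff (0::'a hardy2) n = 0"
  unfolding zero_hardy2_def by (subst Abs_hardy2_inverse) auto

lemma h2_coeff_add: "h2_coeff (f + g) n = h2_coeff f n + h2_coeff (g::'a hardy2) n"
  unfolding plus_hardy2_def
  by (subst Abs_hardy2_inverse) (use L2_set_bounded_imp(1)[OF L2_set_h2_add] in auto)

lemma h2_coeff_scaleR: "h2_coeff (scaleR r f) n = scaleR r (h2_coeff (f::'a hardy2) n)"
  unfolding scaleR_hardy2_def
  by (subst Abs_hardy2_inverse) (auto simp: power_mult_distrib summable_mult summable_h2_coeff)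

lemma h2_coeff_uminus: "h2_coeff (- f) n = - h2_coeff (f::'a hardy2) n"
  by (simp add: uminus_hardy2_def h2_coeff_scaleR)

lemma h2_coeff_diff: "h2_coeff (f - g) n = h2_coeff f n - h2_coeff (g::'a hardy2) n"
  by (simp add: minus_hardy2_def h2_coeff_add h2_coeff_uminus)

lemmas h2_coeff_simps = h2_coeff_zero h2_coeff_add h2_coeff_scaleR
  h2_coeff_uminus h2_coeff_diff

lemma norm_h2_coeff_le: "norm (h2_coeff f n) \<le> norm (f::'a hardy2)"
proof -
  have "norm (h2_coeff f n) \<le> L2_set (\<lambda>n. norm (h2_coeff f n)) {..<Suc n}"
    by (rule member_le_L2_set) auto
  also have "\<dots> \<le> norm f"
    unfolding norm_hardy2_def by (rule L2_set_le_suminf[OF summable_h2_coeff])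
  finally show ?thesis .
qed

instance
proof
  fix f g h :: "'a hardy2" and r s :: real
  show "f + g + h = f + (g + h)" "f + g = g + f" "0 + f = f" "- f + f = 0" "f - g = f + - g"
    by (rule hardy2_eqI; simp add: h2_coeff_simps)+
  show "scaleR r (f + g) = scaleR r f + scaleR r g"
    "scaleR (r + s) f = scaleR r f + scaleR s f"
    "scaleR r (scaleR s f) = scaleR (r * s) f" "scaleR 1 f = f"
    by (rule hardy2_eqI; simp add: h2_coeff_simps algebra_simps)+
  show "dist f g = norm (f - g)" by (rule dist_hardy2_def)
  show "sgn f = scaleR (inverse (norm f)) f" by (rule sgn_hardy2_def)
  show "(uniformity :: ('a hardy2 \<times> 'a hardy2) filter)
      = (INF e\<in>{0<..}. principal {(x, y). dist x y < e})"
    by (rule uniformity_hardy2_def)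
  show "open U = (\<forall>x\<in>U. \<forall>\<^sub>F (x', y) in uniformity. x' = x \<longrightarrow> y \<in> U)" for U :: "'a hardy2 set"
    by (rule open_hardy2_def)
  show "(norm f = 0) = (f = 0)"
  proof
    assume "norm f = 0"
    then have "h2_coeff f n = 0" for n using norm_h2_coeff_le[of f n] by simp
    then show "f = 0" by (intro hardy2_eqI) (simp add: h2_coeff_zero)
  qed (simp add: norm_hardy2_def h2_coeff_zero)
  show "norm (f + g) \<le> norm f + norm g"
    unfolding norm_hardy2_def h2_coeff_add
    by (rule L2_set_bounded_imp(2)) (rule L2_set_h2_add)
  show "norm (scaleR r f) = \<bar>r\<bar> * norm f"
    by (simp add: norm_hardy2_def h2_coeff_scaleR power_mult_distrib real_sqrt_mult
        suminf_mult summable_h2_coeff)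
qed

end

lemma hardy2_complete:
  fixes X :: "nat \<Rightarrow> 'a::complex_hilbert hardy2"
  assumes X: "\<And>e. e > 0 \<Longrightarrow> \<exists>M. \<forall>m\<ge>M. \<forall>n\<ge>M. norm (X m - X n) < e"
  shows "\<exists>L. \<forall>e>0. \<exists>M. \<forall>m\<ge>M. norm (X m - L) \<le> e"
proof -
  have "Cauchy (\<lambda>m. h2_coeff (X m) n)" for n
  proof (rule CauchyI)
    fix e :: real assume "e > 0"
    from X[OF this] obtain M where M: "\<forall>m\<ge>M. \<forall>n\<ge>M. norm (X m - X n) < e" by blast
    have "norm (h2_coeff (X k) n - h2_coeff (X m) n) < e" if "k \<ge> M" "m \<ge> M" for k m
      using M that norm_h2_coeff_le[of "X k - X m" n]
      by (metis h2_coeff_diff le_less_trans)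
    then show "\<exists>M. \<forall>m\<ge>M. \<forall>k\<ge>M. norm (h2_coeff (X m) n - h2_coeff (X k) n) < e"
      by blast
  qed
  then have "\<exists>l. (\<lambda>m. h2_coeff (X m) n) \<longlonglongrightarrow> l" for n
    using Cauchy_convergent convergent_def by blast
  then obtain a where a: "\<And>n. (\<lambda>m. h2_coeff (X m) n) \<longlonglongrightarrow> a n" by metis
  have key: "L2_set (\<lambda>n. norm (h2_coeff (X m) n - a n)) {..<N} \<le> e"
    if "\<forall>m\<ge>M. \<forall>n\<ge>M. norm (X m - X n) < e" "m \<ge> M" for m M N e
  proof (rule tendsto_upperbound)
    show "(\<lambda>k. L2_set (\<lambda>n. norm (h2_coeff (X m) n - h2_coeff (X k) n)) {..<N})
        \<longlonglongrightarrow> L2_set (\<lambda>n. norm (h2_coeff (X m) n - a n)) {..<N}"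
      unfolding L2_set_def by (intro tendsto_intros a)
    have "L2_set (\<lambda>n. norm (h2_coeff (X m) n - h2_coeff (X k) n)) {..<N} \<le> e" if "k \<ge> M" for k
    proof -
      have "L2_set (\<lambda>n. norm (h2_coeff (X m - X k) n)) {..<N} \<le> norm (X m - X k)"
        unfolding norm_hardy2_def by (rule L2_set_le_suminf[OF summable_h2_coeff])
      also have "\<dots> \<le> e" using that \<open>m \<ge> M\<close> \<open>\<forall>m\<ge>M. _ m\<close> by (simp add: less_imp_le)
      finally show ?thesis by (simp add: h2_coeff_diff)
    qed
    then show "\<forall>\<^sub>F k in sequentially.
        L2_set (\<lambda>n. norm (h2_coeff (X m) n - h2_coeff (X k) n)) {..<N} \<le> e"
      by (auto simp: eventually_sequentially)
  qed simp
  have a2: "summable (\<lambda>n. (norm (a n))\<^sup>2)"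
  proof -
    from X[of 1] obtain M where M: "\<forall>m\<ge>M. \<forall>n\<ge>M. norm (X m - X n) < 1" by auto
    have "L2_set (\<lambda>n. norm (a n)) {..<N} \<le> norm (X M) + 1" for N
    proof -
      have "L2_set (\<lambda>n. norm (a n)) {..<N}
          = L2_set (\<lambda>n. norm (h2_coeff (X M) n + (a n - h2_coeff (X M) n))) {..<N}"
        by simp
      also have "\<dots> \<le> L2_set (\<lambda>n. norm (h2_coeff (X M) n)) {..<N}
          + L2_set (\<lambda>n. norm (a n - h2_coeff (X M) n)) {..<N}"
        by (rule L2_set_norm_add)
      also have "\<dots> \<le> norm (X M) + 1"
        using key[OF M, of M N] L2_set_le_suminf[OF summable_h2_coeff, of "X M" N]
        by (simp add: norm_hardy2_def norm_minus_commute)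
      finally show ?thesis .
    qed
    then show ?thesis by (rule L2_set_bounded_imp)
  qed
  define L where "L = Abs_hardy2 a"
  have L: "h2_coeff L = a" unfolding L_def by (rule Abs_hardy2_inverse) (simp add: a2)
  have "\<exists>M. \<forall>m\<ge>M. norm (X m - L) \<le> e" if "e > 0" for e
  proof -
    from X[OF that] obtain M where M: "\<forall>m\<ge>M. \<forall>n\<ge>M. norm (X m - X n) < e" by blast
    have "norm (X m - L) \<le> e" if "m \<ge> M" for m
      unfolding norm_hardy2_def
      by (rule L2_set_bounded_imp(2)) (simp add: h2_coeff_diff L key[OF M that])
    then show ?thesis by blast
  qed
  then show ?thesis by blast
qed

instance hardy2 :: (complex_hilbert) banach
proof
  fix X :: "nat \<Rightarrow> 'a hardy2" assume "Cauchy X"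
  then have "\<exists>M. \<forall>m\<ge>M. \<forall>n\<ge>M. norm (X m - X n) < e" if "e > 0" for e
    using that by (auto simp: Cauchy_iff)
  from hardy2_complete[OF this] obtain L
    where L: "\<And>e. e > 0 \<Longrightarrow> \<exists>M. \<forall>m\<ge>M. norm (X m - L) \<le> e" by metis
  have "X \<longlonglongrightarrow> L"
  proof (rule LIMSEQ_I)
    fix e :: real assume "e > 0"
    then obtain M where "\<forall>m\<ge>M. norm (X m - L) \<le> e / 2" using L[of "e / 2"] by auto
    with \<open>e > 0\<close> show "\<exists>M. \<forall>m\<ge>M. norm (X m - L) < e"
      by (intro exI[of _ M]) fastforce
  qed
  then show "convergent X" by (rule convergentI)
qed

instantiation hardy2 :: (complex_hilbert) complex_hilbert
begin

definition scaleC_hardy2 :: "complex \<Rightarrow> 'a hardy2 \<Rightarrow> 'a hardy2"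
  where "c *\<^sub>C f = Abs_hardy2 (\<lambda>n. c *\<^sub>C h2_coeff f n)"

definition cinner_hardy2 :: "'a hardy2 \<Rightarrow> 'a hardy2 \<Rightarrow> complex"
  where "cinner f g = (\<Sum>n. cinner (h2_coeff f n) (h2_coeff g n))"

lemma h2_coeff_scaleC: "h2_coeff (c *\<^sub>C f) n = c *\<^sub>C h2_coeff (f::'a hardy2) n"
  unfolding scaleC_hardy2_def by (subst Abs_hardy2_inverse) (auto simp: summable_h2_scaleC)

instance
proof
  fix f g h :: "'a hardy2" and c d :: complex and r s :: real
  show "c *\<^sub>C (f + g) = c *\<^sub>C f + c *\<^sub>C g" "(c + d) *\<^sub>C f = c *\<^sub>C f + d *\<^sub>C f"
    "c *\<^sub>C d *\<^sub>C f = (c * d) *\<^sub>C f"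
    by (rule hardy2_eqI;
        simp add: h2_coeff_simps h2_coeff_scaleC scaleC_add_right scaleC_add_left scaleC_scaleC)+
  show "complex_of_real r *\<^sub>C f = scaleR r f" 
    by (rule hardy2_eqI) (simp add: h2_coeff_simps h2_coeff_scaleC scaleC_of_real)
  show "cinner g f = cnj (cinner f g)"
    unfolding cinner_hardy2_def
    using sums_cnj[of "\<lambda>n. cinner (h2_coeff f n) (h2_coeff g n)"] summable_h2_cinner
    by (metis (no_types, lifting) cinner_commute sums_cong summable_sums sums_unique)
  show "cinner (f + g) h = cinner f h + cinner g h"
    unfolding cinner_hardy2_def
    by (simp add: h2_coeff_add cinner_add_left suminf_add[OF summable_h2_cinner summable_h2_cinner])
  show "cinner (c *\<^sub>C f) g = c * cinner f g"
    unfolding cinner_hardy2_def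
    by (simp add: h2_coeff_scaleC cinner_scaleC_left suminf_mult[OF summable_h2_cinner])
  show "cinner f f = complex_of_real ((norm f)\<^sup>2)"
    unfolding cinner_hardy2_def norm_hardy2_def
    by (simp add: cinner_self suminf_nonneg summable_h2_coeff suminf_of_real
        flip: of_real_power)
qed

end

definition h2_eval :: "'a::complex_hilbert hardy2 \<Rightarrow> complex \<Rightarrow> 'a"
  where "h2_eval f z = (\<Sum>n. z ^ n *\<^sub>C h2_coeff f n)"

definition h2_polynomials :: "complex hardy2 set"
  where "h2_polynomials = {f. \<exists>p :: complex poly. \<forall>z\<in>ball 0 1. h2_eval f z = poly p z}"


section \<open>Operators\<close>

definition bounded_clinear :: "('a::complex_hilbert \<Rightarrow> 'b::complex_hilbert) \<Rightarrow> bool"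
  where "bounded_clinear A \<longleftrightarrow> bounded_linear A \<and> (\<forall>c x. A (c *\<^sub>C x) = c *\<^sub>C A x)"

definition cadjoint :: "('a::complex_hilbert \<Rightarrow> 'b::complex_hilbert) \<Rightarrow> 'b \<Rightarrow> 'a"
  where "cadjoint A = (THE A'. \<forall>x y. cinner (A x) y = cinner x (A' y))"

definition positive_op :: "('a::complex_hilbert \<Rightarrow> 'a) \<Rightarrow> bool"
  where "positive_op A \<longleftrightarrow>
    bounded_clinear A \<and> (\<forall>x. Im (cinner (A x) x) = 0 \<and> 0 \<le> Re (cinner (A x) x))"

definition op_sqrt :: "('a::complex_hilbert \<Rightarrow> 'a) \<Rightarrow> 'a \<Rightarrow> 'a"
  where "op_sqrt A = (THE S. positive_op S \<and> S \<circ> S = A)"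

text \<open>The norm of the range space of \<open>A\<close>: the preimage of \<open>y\<close> orthogonal to the kernel
  is unique, and its norm is the norm of \<open>y\<close>. Meaningful only for \<open>y \<in> range A\<close>.\<close>

definition range_norm :: "('a::complex_hilbert \<Rightarrow> 'b::complex_hilbert) \<Rightarrow> 'b \<Rightarrow> real"
  where "range_norm A y = norm (THE x. A x = y \<and> (\<forall>k. A k = 0 \<longrightarrow> cinner x k = 0))"


section \<open>The Schur class and de Branges-Rovnyak spaces\<close>

text \<open>Operator-valued functions on the disc are total functions on \<open>complex\<close>; only their values
  on the open disc matter. Analyticity is complex differentiability in the operator norm.\<close>

definition schur_class :: "(complex \<Rightarrow> 'd::complex_hilbert \<Rightarrow> 'e::complex_hilbert) set"
  where "schur_class = {B.
    (\<forall>z\<in>ball 0 1. bounded_clinear (B z) \<and> onorm (B z) \<le> 1) \<and>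
    (\<forall>z\<in>ball 0 1. \<exists>L. bounded_clinear L \<and>
      ((\<lambda>w. onorm (\<lambda>x. inverse (w - z) *\<^sub>C (B w x - B z x) - L x)) \<longlongrightarrow> 0) (at z))}"

definition mult_op :: "(complex \<Rightarrow> 'd::complex_hilbert \<Rightarrow> 'e::complex_hilbert) \<Rightarrow> 'd hardy2 \<Rightarrow> 'e hardy2"
  where "mult_op B f = (THE g. \<forall>z\<in>ball 0 1. h2_eval g z = B z (h2_eval f z))"

definition defect_op :: "(complex \<Rightarrow> 'd::complex_hilbert \<Rightarrow> 'e::complex_hilbert) \<Rightarrow> 'e hardy2 \<Rightarrow> 'e hardy2"
  where "defect_op B = op_sqrt (\<lambda>f. f - mult_op B (cadjoint (mult_op B) f))"

definition dBR_space :: "(complex \<Rightarrow> 'd::complex_hilbert \<Rightarrow> 'e::complex_hilbert) \<Rightarrow> 'e hardy2 set"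
  where "dBR_space B = range (defect_op B)"

definition dBR_norm :: "(complex \<Rightarrow> 'd::complex_hilbert \<Rightarrow> 'e::complex_hilbert) \<Rightarrow> 'e hardy2 \<Rightarrow> real"
  where "dBR_norm B = range_norm (defect_op B)"

text \<open>Boundary values are radial limits in the strong operator topology. For a Schur function on
  a separable space they exist at almost every point of the circle; elsewhere the value is
  arbitrary.\<close>

definition boundary_value ::
    "(complex \<Rightarrow> 'd::complex_hilbert \<Rightarrow> 'e::complex_hilbert) \<Rightarrow> complex \<Rightarrow> 'd \<Rightarrow> 'e"
  where "boundary_value B \<zeta> x = Lim (at_left (1::real)) (\<lambda>r. B (complex_of_real r * \<zeta>) x)"

text \<open>The operator \<open>B(\<zeta>) B(\<zeta>)\<^sup>*\<close> on \<open>complex\<close> is multiplication by its value at \<open>1\<close>, which is real.\<close>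

definition boundary_BBstar ::
    "(complex \<Rightarrow> 'd::complex_hilbert \<Rightarrow> complex) \<Rightarrow> complex \<Rightarrow> real"
  where "boundary_BBstar B \<zeta> = Re (boundary_value B \<zeta> (cadjoint (boundary_value B \<zeta>) 1))"

text \<open>Here \<open>log 0 = -\<infinity>\<close>, so integrability of \<open>log u\<close> forces \<open>u > 0\<close> almost everywhere; as
  \<open>ln 0 = 0\<close> in the library, this has to be stated. The completed measure makes the condition
  insensitive to the values of \<open>u\<close> on null sets.\<close>

definition log_integrable_on_circle :: "(complex \<Rightarrow> real) \<Rightarrow> bool"
  where "log_integrable_on_circle u \<longleftrightarrow>
    (AE t in lebesgue_on {0..2 * pi}. 0 < u (cis t)) \<and>
    integrable (lebesgue_on {0..2 * pi}) (\<lambda>t. ln (u (cis t)))"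

end

(*
Write B(z)x = sum_n z^n <x, b_n>. The row B is then determined by the vector valued H^2 function with
coefficients b_n, whose radial limits exist almost everywhere in norm (maximal inequality for the
Poisson kernel, by a T T^* argument). With S the shift, L = I - T_B T_B^* and the Hankel operator
Gamma x = P_- B^* x, the operator T = L - Gamma^* Gamma is the Toeplitz operator with symbol
w = 1 - BB^*, and Jensen's inequality applied to w |p|^2 gives <Tx, x> >= exp(mean of log w) |x(0)|^2.

This bound has two uses. It shows |x^(n)| <= C_n ||L^(1/2) x||, so that z^n lies in the range of
L^(1/2). It also makes the distance from T^(1/2) 1 to T^(1/2) z H^2 positive; the resulting wandering
vector yields an analytic multiplication operator Psi with dense range and Psi^* Psi <= T.

For density let u in the closure of the range of L^(1/2) be orthogonal to all L^(-1/2) z^n, and let x_k be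
polynomials with L^(1/2) x_k -> u. Then x_k^(n) -> 0 for every n, hence Psi x_k -> 0. Comparing Fourier
coefficients of B^* Psi x_k and of B^* x_k, density of the range of Psi forces Gamma x_k -> 0, and then
Psi L x_k -> 0. So Psi L^(1/2) u = 0, and u = 0 because Psi is injective.
*)
theory Submission
  imports Defs "HOL-Complex_Analysis.Complex_Analysis"
    "HOL-Computational_Algebra.Fundamental_Theorem_Algebra"
begin

subsection \<open>Hilbert space\<close>

text \<open>\<open>L\<close> has no simple behaviour under the shift, while Jensen's inequality
  speaks about symbols. Subtracting the Hankel square repairs this: replacing \<open>x\<close> by
  \<open>z x\<close> moves exactly one Fourier coefficient of B^* x from the Hankel part to the
  analytic part, so \<open>\<parallel>T^(1/2) x\<parallel>\<close> is shift invariant, and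
  \<open>T \<le> L\<close> carries lower bounds back to \<open>L\<close>. The radial limits are
  needed in norm: scalar limits of B would only give a weak limit \<open>y\<close> of the row
  vectors, whose norm may drop below the limit of their norms, and then
  \<open>1 - \<parallel>y\<parallel>^2\<close> need not be the limit of the weights inside the disc.
  The obstacle to density is that the \<open>x_k\<close> need not stay bounded in
  \<open>H^2\<close>; only their images under operators dominated by \<open>L^(1/2)\<close> are
  known to converge. \<Psi> is such an operator and an analytic multiplication at the same time.
  Hence the negative frequencies of B^* \<Psi> x involve \<Gamma> x alone, and \<Psi> commutes with
  T_B, so that each coefficient of \<Psi> T_B T_B^* x_k is a finite expression in quantities that
  tend to 0.\<close>

lemma cinner_zero_left [simp]: "cinner 0 (x::'a::complex_hilbert) = 0"
  using cinner_add_left[of 0 0 x] by simp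

lemma cinner_zero_right [simp]: "cinner (x::'a::complex_hilbert) 0 = 0"
  using cinner_add_right[of x 0 0] by simp

lemma cinner_minus_left: "cinner (- x) (y::'a::complex_hilbert) = - cinner x y"
  using cinner_add_left[of x "- x" y] by (simp add: add_eq_0_iff)

lemma cinner_minus_right: "cinner x (- y::'a::complex_hilbert) = - cinner x y"
  using cinner_add_right[of x y "- y"] by (simp add: add_eq_0_iff)

lemma cinner_diff_left: "cinner (x - y) (z::'a::complex_hilbert) = cinner x z - cinner y z"
  using cinner_add_left[of x "- y" z] by (simp add: cinner_minus_left)

lemma cinner_diff_right: "cinner x (y - z::'a::complex_hilbert) = cinner x y - cinner x z"
  using cinner_add_right[of x y "- z"] by (simp add: cinner_minus_right)

lemma cinner_scaleR_left: "cinner (r *\<^sub>R x) (y::'a::complex_hilbert) = r * cinner x y"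
  using cinner_scaleC_left[of "complex_of_real r" x y] by (simp add: scaleC_of_real)

lemma cinner_scaleR_right: "cinner x (r *\<^sub>R y::'a::complex_hilbert) = r * cinner x y"
  using cinner_scaleC_right[of x "complex_of_real r" y] by (simp add: scaleC_of_real)

lemma cinner_sum_left: "cinner (\<Sum>i\<in>I. f i) (y::'a::complex_hilbert) = (\<Sum>i\<in>I. cinner (f i) y)"
  by (induction I rule: infinite_finite_induct) (auto simp: cinner_add_left)

lemma cinner_sum_right: "cinner x (\<Sum>i\<in>I. f i::'a::complex_hilbert) = (\<Sum>i\<in>I. cinner x (f i))"
  by (induction I rule: infinite_finite_induct) (auto simp: cinner_add_right)

lemmas cinner_simps = cinner_add_left cinner_add_right cinner_diff_left cinner_diff_right
  cinner_minus_left cinner_minus_right cinner_scaleC_left cinner_scaleC_right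
  cinner_scaleR_left cinner_scaleR_right

lemma scaleC_zero_left [simp]: "0 *\<^sub>C (x::'a::complex_hilbert) = 0"
  using scaleC_of_real[of 0 x] by simp

lemma scaleC_one [simp]: "1 *\<^sub>C (x::'a::complex_hilbert) = x"
  using scaleC_of_real[of 1 x] by simp

lemma scaleC_minus_one: "(-1) *\<^sub>C (x::'a::complex_hilbert) = - x"
  using scaleC_of_real[of "-1" x] by simp

lemma scaleC_minus_right: "c *\<^sub>C (- x::'a::complex_hilbert) = - (c *\<^sub>C x)"
  using scaleC_add_right[of c x "- x"] by (simp add: add_eq_0_iff)

lemma scaleC_diff_right: "c *\<^sub>C (x - y::'a::complex_hilbert) = c *\<^sub>C x - c *\<^sub>C y"
  using scaleC_add_right[of c x "- y"] by (simp add: scaleC_minus_right)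

lemma scaleC_sum_right: "c *\<^sub>C (\<Sum>i\<in>I. f i::'a::complex_hilbert) = (\<Sum>i\<in>I. c *\<^sub>C f i)"
  by (induction I rule: infinite_finite_induct) (auto simp: scaleC_add_right)

lemma scaleC_scaleR: "c *\<^sub>C (r *\<^sub>R (x::'a::complex_hilbert)) = r *\<^sub>R (c *\<^sub>C x)"
  by (simp flip: scaleC_of_real add: scaleC_scaleC mult.commute)

lemma norm_sq_cinner: "(norm x)\<^sup>2 = Re (cinner x (x::'a::complex_hilbert))"
  by (simp add: cinner_self)

lemma norm_add_sq:
  "(norm (x + y))\<^sup>2 = (norm x)\<^sup>2 + 2 * Re (cinner x y) + (norm (y::'a::complex_hilbert))\<^sup>2"
proof -
  have "Re (cinner y x) = Re (cinner x y)" by (subst cinner_commute) simp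
  then show ?thesis by (simp add: norm_sq_cinner cinner_simps)
qed

lemma norm_diff_sq:
  "(norm (x - y))\<^sup>2 = (norm x)\<^sup>2 - 2 * Re (cinner x y) + (norm (y::'a::complex_hilbert))\<^sup>2"
  using norm_add_sq[of x "- y"] by (simp add: cinner_minus_right)

lemma bounded_bilinear_cinner: "bounded_bilinear (cinner :: 'a::complex_hilbert \<Rightarrow> 'a \<Rightarrow> complex)"
  by standard (auto simp: cinner_simps scaleR_conv_of_real intro!: exI[of _ 1] Cauchy_Schwarz_cinner)

lemma bounded_bilinear_scaleC: "bounded_bilinear (scaleC :: complex \<Rightarrow> 'a::complex_hilbert \<Rightarrow> 'a)"
proof
  show "\<exists>K. \<forall>a (b::'a). norm (a *\<^sub>C b) \<le> norm a * norm b * K"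
    by (auto simp: norm_scaleC intro!: exI[of _ 1])
  show "(r *\<^sub>R a) *\<^sub>C (b::'a) = r *\<^sub>R (a *\<^sub>C b)" for r a and b :: 'a
    by (simp add: scaleR_conv_of_real flip: scaleC_scaleC scaleC_of_real)
qed (auto simp: scaleC_add_left scaleC_add_right scaleC_scaleR)

lemmas tendsto_cinner [tendsto_intros] = bounded_bilinear.tendsto[OF bounded_bilinear_cinner]
lemmas tendsto_scaleC [tendsto_intros] = bounded_bilinear.tendsto[OF bounded_bilinear_scaleC]
lemmas continuous_on_scaleC [continuous_intros] =
  bounded_bilinear.continuous_on[OF bounded_bilinear_scaleC]
lemmas continuous_on_cinner [continuous_intros] =
  bounded_bilinear.continuous_on[OF bounded_bilinear_cinner]
lemmas bounded_linear_cinner_left = bounded_bilinear.bounded_linear_left[OF bounded_bilinear_cinner]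
lemmas bounded_linear_cinner_right = bounded_bilinear.bounded_linear_right[OF bounded_bilinear_cinner]
lemmas bounded_linear_scaleC_left = bounded_bilinear.bounded_linear_left[OF bounded_bilinear_scaleC]
lemmas bounded_linear_scaleC_right = bounded_bilinear.bounded_linear_right[OF bounded_bilinear_scaleC]

lemma cinner_eqI:
  assumes "\<And>x. cinner x y = cinner x (z::'a::complex_hilbert)" shows "y = z"
proof -
  have "cinner (y - z) (y - z) = 0" using assms[of "y - z"] by (simp add: cinner_diff_right)
  then show ?thesis by (simp add: cinner_self)
qed

section \<open>Subspaces, Riesz representation and orthogonal projection\<close>

definition csubspace :: "'a::complex_hilbert set \<Rightarrow> bool" where
  "csubspace V \<longleftrightarrow> 0 \<in> V \<and> (\<forall>x\<in>V. \<forall>y\<in>V. x + y \<in> V) \<and> (\<forall>c. \<forall>x\<in>V. c *\<^sub>C x \<in> V)"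

lemma csubspaceD:
  assumes "csubspace V"
  shows "0 \<in> V" "x \<in> V \<Longrightarrow> y \<in> V \<Longrightarrow> x + y \<in> V" "x \<in> V \<Longrightarrow> c *\<^sub>C x \<in> V"
    "x \<in> V \<Longrightarrow> y \<in> V \<Longrightarrow> x - y \<in> V" "x \<in> V \<Longrightarrow> r *\<^sub>R x \<in> V"
proof -
  show *: "0 \<in> V" "x \<in> V \<Longrightarrow> y \<in> V \<Longrightarrow> x + y \<in> V" "x \<in> V \<Longrightarrow> c *\<^sub>C x \<in> V" for x y c
    using assms by (auto simp: csubspace_def)
  show "x \<in> V \<Longrightarrow> y \<in> V \<Longrightarrow> x - y \<in> V" using *(2)[of x "(-1) *\<^sub>C y"] *(3)[of y "-1"]
    by (simp add: scaleC_minus_one)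
  show "x \<in> V \<Longrightarrow> r *\<^sub>R x \<in> V" using *(3)[of x "complex_of_real r"] by (simp add: scaleC_of_real)
qed

lemma csubspace_closure:
  assumes "csubspace (V::'a::complex_hilbert set)"
  shows "csubspace (closure V)"
  unfolding csubspace_def
proof (intro conjI ballI allI)
  note V = csubspaceD[OF assms]
  show "0 \<in> closure V" using V(1) closure_subset by blast
  fix x y c assume x: "x \<in> closure V"
  then obtain X where X: "\<And>n. X n \<in> V" "X \<longlonglongrightarrow> x" unfolding closure_sequential by metis
  show "c *\<^sub>C x \<in> closure V"
    unfolding closure_sequential using X V(3) by (intro exI[of _ "\<lambda>n. c *\<^sub>C X n"]) (auto intro: tendsto_intros)
  assume "y \<in> closure V"
  then obtain Y where Y: "\<And>n. Y n \<in> V" "Y \<longlonglongrightarrow> y" unfolding closure_sequential by metis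
  show "x + y \<in> closure V"
    unfolding closure_sequential using X Y V(2) by (intro exI[of _ "\<lambda>n. X n + Y n"]) (auto intro: tendsto_intros)
qed

text \<open>The Riesz vector is the limit of a sequence minimising \<open>\<parallel>v\<parallel>\<^sup>2 - 2 Re (f v)\<close>, which
  is Cauchy by the parallelogram law.\<close>

lemma riesz_csubspace:
  fixes f :: "'a::complex_hilbert \<Rightarrow> complex"
  assumes V: "csubspace V"
    and fa: "\<And>x y. x \<in> V \<Longrightarrow> y \<in> V \<Longrightarrow> f (x + y) = f x + f y"
    and fc: "\<And>c x. x \<in> V \<Longrightarrow> f (c *\<^sub>C x) = c * f x"
    and fb: "\<And>x. x \<in> V \<Longrightarrow> cmod (f x) \<le> C * norm x"
  obtains e where "e \<in> closure V" "\<And>x. x \<in> V \<Longrightarrow> f x = cinner x e"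
proof -
  note Vs = csubspaceD[OF V]
  have fR: "f (r *\<^sub>R x) = r * f x" if "x \<in> V" for r x
    using fc[OF that, of "complex_of_real r"] by (simp add: scaleC_of_real)
  define \<Phi> where "\<Phi> x = (norm x)\<^sup>2 - 2 * Re (f x)" for x
  have lb: "- C\<^sup>2 \<le> \<Phi> x" if "x \<in> V" for x
  proof -
    have "Re (f x) \<le> C * norm x" using fb[OF that] complex_Re_le_cmod[of "f x"] by linarith
    moreover have "0 \<le> (norm x - C)\<^sup>2" by simp
    ultimately show ?thesis by (simp add: \<Phi>_def power2_diff) (simp add: mult.commute)
  qed
  define m where "m = (INF x\<in>V. \<Phi> x)"
  have bdd: "bdd_below (\<Phi> ` V)" using lb by (auto intro!: bdd_belowI2[of _ "- C\<^sup>2"])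
  have mle: "m \<le> \<Phi> x" if "x \<in> V" for x unfolding m_def by (rule cINF_lower[OF bdd that])
  have "\<exists>x\<in>V. \<Phi> x < m + d" if "d > 0" for d
    using cINF_less_iff[OF _ bdd, of "m + d"] Vs(1) that by (auto simp: m_def)
  then have "\<exists>x\<in>V. \<Phi> x < m + 1 / Suc k" for k by (simp del: of_nat_Suc)
  then obtain X where X: "\<And>k. X k \<in> V" "\<And>k. \<Phi> (X k) < m + 1 / Suc k" by metis
  have par: "(norm (x - y))\<^sup>2 = 2 * \<Phi> x + 2 * \<Phi> y - 4 * \<Phi> ((1/2) *\<^sub>R (x + y))"
    if "x \<in> V" "y \<in> V" for x y
  proof -
    have "f ((1/2) *\<^sub>R (x + y)) = (f x + f y) / 2"
      using that fa[of x y] fR[of "x + y" "1/2"] Vs(2) by simp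
    then have "Re (f ((1/2) *\<^sub>R (x + y))) = (Re (f x) + Re (f y)) / 2" by (simp only: Re_divide_numeral plus_complex.sel)
    moreover have "(norm ((1/2) *\<^sub>R (x + y)))\<^sup>2 = (norm (x + y))\<^sup>2 / 4"
      by (simp add: power_divide)
    ultimately show ?thesis
      unfolding \<Phi>_def norm_add_sq norm_diff_sq by (simp add: field_simps)
  qed
  have close: "(norm (X i - X j))\<^sup>2 \<le> 2 / Suc i + 2 / Suc j" for i j
    using par[OF X(1) X(1), of i j] mle[OF Vs(5)[OF Vs(2)[OF X(1) X(1)]], of "1/2" i j] X(2)[of i] X(2)[of j]
    by simp
  have "Cauchy X"
  proof (rule CauchyI)
    fix e :: real assume e: "e > 0"
    obtain M where M: "4 / e\<^sup>2 < real M" using reals_Archimedean2 by blast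
    have "norm (X i - X j) < e" if "i \<ge> M" "j \<ge> M" for i j
    proof -
      have Mp: "real M > 0" using M e by (smt (verit) divide_pos_pos zero_less_power)
      have "2 / real (Suc i) \<le> 2 / M" "2 / real (Suc j) \<le> 2 / M"
        using that Mp by (auto intro!: divide_left_mono)
      then have "(norm (X i - X j))\<^sup>2 \<le> 4 / M" using close[of i j] by simp
      also have "4 / M < e\<^sup>2" using M e Mp by (simp add: field_simps)
      finally show ?thesis using e by (simp add: power2_less_imp_less)
    qed
    then show "\<exists>M. \<forall>m\<ge>M. \<forall>n\<ge>M. norm (X m - X n) < e" by blast
  qed
  then obtain e where e: "X \<longlonglongrightarrow> e" using Cauchy_convergent convergent_def by blast
  have "e \<in> closure V" using X(1) e closure_sequential by blast
  moreover have "f x = cinner x e" if "x \<in> V" for x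
  proof -
    have key: "Re (f x) = Re (cinner x e)" if x: "x \<in> V" for x
    proof (cases "x = 0")
      case True then show ?thesis using fR[OF x, of 0] by simp
    next
      case False
      define d where "d k = Re (cinner x (X k)) - Re (f x)" for k
      have dk: "(d k)\<^sup>2 \<le> (norm x)\<^sup>2 * (1 / Suc k)" for k
      proof -
        \<comment> \<open>This \<open>t\<close> minimises the quadratic
          \<open>t \<mapsto> \<Phi> (X k + t x)\<close>. Since \<open>X k\<close> is within
          \<open>1 / (k + 1)\<close> of the infimum, the decrease
          \<open>(d k)^2 / \<parallel>x\<parallel>^2\<close> is at most that.\<close>
        define t where "t = - d k / (norm x)\<^sup>2"
        have nx: "(norm x)\<^sup>2 > 0" using False by simp
        have "m \<le> \<Phi> (X k + t *\<^sub>R x)" by (intro mle Vs X x)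
        moreover have "\<Phi> (X k + t *\<^sub>R x) = \<Phi> (X k) + 2 * t * d k + t\<^sup>2 * (norm x)\<^sup>2"
          unfolding \<Phi>_def norm_add_sq using fa[OF X(1) Vs(5)[OF x]] fR[OF x]
            cinner_commute[of x "X k"]
          by (simp add: d_def cinner_scaleR_right power_mult_distrib algebra_simps)
        moreover have "2 * t * d k + t\<^sup>2 * (norm x)\<^sup>2 = - (d k)\<^sup>2 / (norm x)\<^sup>2"
          using nx by (simp add: t_def field_simps power2_eq_square)
        ultimately have "(d k)\<^sup>2 / (norm x)\<^sup>2 \<le> 1 / Suc k"
          using X(2)[of k] by simp
        then show ?thesis using nx by (simp add: field_simps)
      qed
      have "(\<lambda>k. (d k)\<^sup>2) \<longlonglongrightarrow> (norm x)\<^sup>2 * 0"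
      proof (rule tendsto_sandwich[where f = "\<lambda>_. 0"])
        show "(\<lambda>k. (norm x)\<^sup>2 * (1 / Suc k)) \<longlonglongrightarrow> (norm x)\<^sup>2 * 0"
          by (intro tendsto_intros LIMSEQ_inverse_real_of_nat[unfolded inverse_eq_divide])
        show "\<forall>\<^sub>F k in sequentially. (d k)\<^sup>2 \<le> (norm x)\<^sup>2 * (1 / Suc k)"
          using dk by simp
      qed auto
      moreover have "(\<lambda>k. (d k)\<^sup>2) \<longlonglongrightarrow> (Re (cinner x e) - Re (f x))\<^sup>2"
        unfolding d_def by (intro tendsto_intros e)
      ultimately show ?thesis using LIMSEQ_unique by fastforce
    qed
    \<comment> \<open>Up to sign, the imaginary part at \<open>x\<close> is the real part at
      \<open>\<i> x\<close>.\<close>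
    have "Im (f x) = Im (cinner x e)"
      using key[OF Vs(3)[OF that, of \<i>]] fc[OF that, of \<i>] by (simp add: cinner_scaleC_left)
    with key[OF that] show ?thesis by (simp add: complex_eq_iff)
  qed
  ultimately show ?thesis using that by blast
qed

text \<open>The projection is the Riesz vector of \<open>v \<mapsto> cinner v x\<close> restricted
  to \<open>V\<close>. As \<open>V\<close> is not assumed closed, it is found only in the
  closure.\<close>

lemma orthogonal_projection:
  assumes "csubspace (V::'a::complex_hilbert set)"
  obtains e where "e \<in> closure V" "\<And>v. v \<in> V \<Longrightarrow> cinner v (x - e) = 0"
proof (rule riesz_csubspace[OF assms, of "\<lambda>v. cinner v x" "norm x"])
  show "cmod (cinner v x) \<le> norm x * norm v" for v
    using Cauchy_Schwarz_cinner[of v x] by (simp add: mult.commute)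
qed (auto simp: cinner_simps that)

section \<open>Bounded complex linear maps and adjoints\<close>

lemma bounded_clinearD:
  assumes "bounded_clinear A"
  shows "bounded_linear A" "A (x + y) = A x + A y" "A (x - y) = A x - A y" "A 0 = 0"
    "A (c *\<^sub>C x) = c *\<^sub>C A x" "A (- x) = - A x" "A (r *\<^sub>R x) = r *\<^sub>R A x"
proof -
  show *: "bounded_linear A" using assms by (simp add: bounded_clinear_def)
  then have l: "linear A" by (rule bounded_linear.linear)
  show "A (x + y) = A x + A y" "A (x - y) = A x - A y" "A 0 = 0" "A (- x) = - A x"
    "A (r *\<^sub>R x) = r *\<^sub>R A x"
    using l by (simp_all add: linear_add linear_diff linear_0 linear_neg linear_cmul)
  show "A (c *\<^sub>C x) = c *\<^sub>C A x" using assms by (simp add: bounded_clinear_def)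
qed

lemma bounded_clinear_sum:
  "bounded_clinear A \<Longrightarrow> A (\<Sum>i\<in>I. f i) = (\<Sum>i\<in>I. A (f i))"
  using bounded_clinearD(1) bounded_linear.linear linear_sum by blast

lemma bounded_clinear_tendsto:
  "bounded_clinear A \<Longrightarrow> (f \<longlongrightarrow> l) F \<Longrightarrow> ((\<lambda>x. A (f x)) \<longlongrightarrow> A l) F"
  using bounded_clinearD(1) bounded_linear.tendsto by blast

lemma bounded_clinearI:
  assumes "\<And>x y. A (x + y) = A x + A y" "\<And>c x. A (c *\<^sub>C x) = c *\<^sub>C A x"
    "\<And>x. norm (A x) \<le> K * norm x"
  shows "bounded_clinear A"
  unfolding bounded_clinear_def
proof
  show "bounded_linear A"
    by (rule bounded_linear_intro[where K = K])
      (use assms(1,3) assms(2)[of "complex_of_real _"] in \<open>simp_all add: scaleC_of_real mult.commute\<close>)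
qed (use assms(2) in simp)

lemma bounded_clinear_compose:
  "bounded_clinear A \<Longrightarrow> bounded_clinear B \<Longrightarrow> bounded_clinear (\<lambda>x. A (B x))"
  unfolding bounded_clinear_def using bounded_linear_compose by auto

lemma bounded_clinear_diff:
  "bounded_clinear A \<Longrightarrow> bounded_clinear B \<Longrightarrow> bounded_clinear (\<lambda>x. A x - B x)"
  unfolding bounded_clinear_def using bounded_linear_sub by (auto simp: scaleC_diff_right)

lemma bounded_clinear_id: "bounded_clinear (\<lambda>x. x)"
  unfolding bounded_clinear_def by simp

lemma csubspace_range: "bounded_clinear A \<Longrightarrow> csubspace (range A)"
  unfolding csubspace_def
  by (auto simp flip: bounded_clinearD(2,5)) (metis bounded_clinearD(4) rangeI)

lemma csubspace_UNIV: "csubspace UNIV" by (simp add: csubspace_def)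

lemma adjoint_exists:
  assumes A: "bounded_clinear (A :: 'a::complex_hilbert \<Rightarrow> 'b::complex_hilbert)"
  shows "\<exists>A'. \<forall>x y. cinner (A x) y = cinner x (A' y)"
proof -
  obtain K where K: "\<And>x. norm (A x) \<le> norm x * K"
    using bounded_clinearD(1)[OF A] bounded_linear.bounded by blast
  have "\<exists>z. \<forall>x. cinner (A x) y = cinner x z" for y
  proof -
    have "cmod (cinner (A x) y) \<le> K * norm y * norm x" for x
      using Cauchy_Schwarz_cinner[of "A x" y] mult_right_mono[OF K[of x], of "norm y"]
      by (simp add: mult_ac)
    then obtain z where "\<And>x. x \<in> UNIV \<Longrightarrow> cinner (A x) y = cinner x z"
      using riesz_csubspace[OF csubspace_UNIV, of "\<lambda>x. cinner (A x) y" "K * norm y"]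
        bounded_clinearD(2,5)[OF A] cinner_add_left cinner_scaleC_left by metis
    then show ?thesis by auto
  qed
  then show ?thesis by metis
qed

lemma cadjoint_eqI:
  assumes "\<And>x y. cinner (A x) y = cinner x (A' y)"
  shows "cadjoint A = A'"
  unfolding cadjoint_def
proof (rule the_equality)
  fix A'' assume A'': "\<forall>x y. cinner (A x) y = cinner x (A'' y)"
  have "A'' y = A' y" for y by (rule cinner_eqI) (use A'' assms in simp)
  then show "A'' = A'" by blast
qed (use assms in blast)

lemma cadjoint: "bounded_clinear A \<Longrightarrow> cinner (A x) y = cinner x (cadjoint A y)"
  using adjoint_exists[of A] cadjoint_eqI[of A] by metis

lemma cadjoint':
  assumes "bounded_clinear A" shows "cinner y (A x) = cinner (cadjoint A y) x"
  using cadjoint[OF assms, of x y] by (metis cinner_commute)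

lemma norm_cadjoint_le:
  assumes A: "bounded_clinear A" "\<And>x. norm (A x) \<le> K * norm x" and "0 \<le> K"
  shows "norm (cadjoint A y) \<le> K * norm y"
proof (cases "cadjoint A y = 0")
  case True
  then show ?thesis using \<open>0 \<le> K\<close> by simp
next
  case False
  let ?z = "cadjoint A y"
  have "(norm ?z)\<^sup>2 = cmod (cinner ?z ?z)" by (simp add: cinner_self norm_power)
  also have "\<dots> = cmod (cinner (A ?z) y)" by (simp add: cadjoint[OF A(1)])
  also have "\<dots> \<le> norm (A ?z) * norm y" by (rule Cauchy_Schwarz_cinner)
  also have "\<dots> \<le> (K * norm ?z) * norm y" by (intro mult_right_mono A) auto
  finally have "norm ?z * norm ?z \<le> norm ?z * (K * norm y)" by (simp add: power2_eq_square mult_ac)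
  then show ?thesis using False by simp
qed

lemma bounded_clinear_cadjoint:
  assumes A: "bounded_clinear A" shows "bounded_clinear (cadjoint A)"
proof -
  obtain K where K: "\<And>x. norm (A x) \<le> norm x * K"
    using bounded_clinearD(1)[OF A] bounded_linear.bounded by blast
  show ?thesis
  proof (rule bounded_clinearI)
    show "cadjoint A (x + y) = cadjoint A x + cadjoint A y" for x y
      by (rule cinner_eqI) (simp add: cinner_simps flip: cadjoint[OF A])
    show "cadjoint A (c *\<^sub>C x) = c *\<^sub>C cadjoint A x" for c x
      by (rule cinner_eqI) (simp add: cinner_simps flip: cadjoint[OF A])
    show "norm (cadjoint A y) \<le> \<bar>K\<bar> * norm y" for y
      by (rule norm_cadjoint_le[OF A _ abs_ge_zero])
        (metis K abs_ge_self mult.commute mult_left_mono norm_ge_zero order_trans)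
  qed
qed

subsection \<open>Square roots of positive operators\<close>

lemma positive_opD:
  assumes "positive_op A"
  shows "bounded_clinear A" "Im (cinner (A x) x) = 0" "0 \<le> Re (cinner (A x) x)"
  using assms by (auto simp: positive_op_def)

text \<open>Over the complex numbers a sesquilinear form that vanishes on the diagonal vanishes
  identically: testing on \<open>x + y\<close> and \<open>x + \<i> y\<close> isolates both mixed
  terms. The form \<open>h\<close> vanishes on the diagonal because \<open>cinner (A x) x\<close> is
  real.\<close>

lemma positive_op_selfadjoint:
  assumes "positive_op A"
  shows "cinner (A x) y = cinner x (A y)"
proof -
  note A = bounded_clinearD[OF positive_opD(1)[OF assms]]
  define h where "h x y = cinner (A x) y - cinner x (A y)" for x y
  have h0: "h x x = 0" for x
    using positive_opD(2)[OF assms, of x] cinner_commute[of "A x" x]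
    by (simp add: h_def complex_eq_iff)
  have "h (x + y) (x + y) = 0" "h (x + \<i> *\<^sub>C y) (x + \<i> *\<^sub>C y) = 0" by (rule h0)+
  moreover have "h (x + y) (x + y) = h x x + h y y + (h x y + h y x)"
    "h (x + \<i> *\<^sub>C y) (x + \<i> *\<^sub>C y) = h x x + h y y + \<i> * (h y x - h x y)"
    by (simp_all add: h_def A cinner_simps algebra_simps)
  ultimately have "h x y + h y x = 0" "h y x - h x y = 0" by (simp_all add: h0)
  then have "h x y = 0" by simp
  then show ?thesis by (simp add: h_def)
qed

lemma positive_op_eq_zero:
  assumes "positive_op A" "cinner (A x) x = 0"
  shows "A x = 0"
proof -
  note A = bounded_clinearD[OF positive_opD(1)[OF assms(1)]]
  define n where "n = (norm (A x))\<^sup>2"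
  define q where "q = Re (cinner (A (A x)) (A x))"
  have q: "q \<ge> 0" unfolding q_def by (rule positive_opD(3)[OF assms(1)])
  \<comment> \<open>Optimal up to the \<open>+ 1\<close>, which avoids a division by zero; the form
    at \<open>x + t A x\<close> becomes \<open>- n^2 (q + 2) / (q + 1)^2\<close>, negative unless
    \<open>n = 0\<close>.\<close>
  define t where "t = - n / (q + 1)"
  have "cinner (A (A x)) x = complex_of_real n"
    by (subst positive_op_selfadjoint[OF assms(1)]) (simp add: n_def cinner_self)
  then have "0 \<le> 2 * t * n + t\<^sup>2 * q"
    using positive_opD(3)[OF assms(1), of "x + t *\<^sub>R A x"] assms(2)
    by (simp add: A cinner_simps cinner_self q_def n_def power2_eq_square algebra_simps)
  then have "0 \<le> (2 * t * n + t\<^sup>2 * q) * (q + 1)\<^sup>2" by simp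
  also have "\<dots> = - (n\<^sup>2 * (q + 2))"
  proof -
    have "t * (q + 1) = - n" using q by (simp add: t_def)
    then show ?thesis by algebra
  qed
  finally have "n\<^sup>2 * (q + 2) \<le> 0" by simp
  then have "n = 0" using q by (simp add: mult_le_0_iff)
  then show ?thesis by (simp add: n_def)
qed

text \<open>The identity \<open>C - C^2 = C (I - C) C + (I - C) C (I - C)\<close> writes
  \<open>C - C^2\<close> as a sum of two positive terms, whence \<open>\<parallel>C x\<parallel>^2
  \<le> <C x, x> \<le> \<parallel>x\<parallel>^2\<close>.\<close>

lemma positive_op_contraction:
  assumes "positive_op C" and le: "\<And>x. Re (cinner (C x) x) \<le> (norm x)\<^sup>2"
  shows "norm (C x) \<le> norm x"
proof -
  note C = bounded_clinearD[OF positive_opD(1)[OF assms(1)]]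
  note sa = positive_op_selfadjoint[OF assms(1)]
  define y where "y = x - C x"
  have "0 \<le> Re (cinner (C x - C (C x)) (C x)) + Re (cinner (C y) y)"
    using le[of "C x"] positive_opD(3)[OF assms(1), of y]
    by (simp add: cinner_diff_left flip: norm_sq_cinner)
  also have "\<dots> = Re (cinner (C x) x) - (norm (C x))\<^sup>2"
    by (simp add: y_def C cinner_simps norm_sq_cinner sa)
  finally have "(norm (C x))\<^sup>2 \<le> (norm x)\<^sup>2" using le[of x] by linarith
  then show ?thesis by (rule power2_le_imp_le) simp
qed

section \<open>The power series of the square root\<close>

text \<open>Taylor coefficients of \<open>s(x) = 1 - sqrt (1 - x)\<close>, the solution of \<open>s = (x + s\<^sup>2) / 2\<close>.\<close>

fun sqrt_coeff :: "nat \<Rightarrow> real" where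
  "sqrt_coeff 0 = 0"
| "sqrt_coeff (Suc 0) = 1 / 2"
| "sqrt_coeff (Suc (Suc n)) = (\<Sum>i\<le>n. sqrt_coeff (Suc i) * sqrt_coeff (Suc (n - i))) / 2"

declare sqrt_coeff.simps(3) [simp del]

lemma sqrt_coeff_nonneg: "0 \<le> sqrt_coeff n"
  by (induction n rule: sqrt_coeff.induct) (auto simp: sqrt_coeff.simps(3) intro!: sum_nonneg)

lemma sqrt_coeff_convolution:
  "(\<Sum>i\<le>n. sqrt_coeff i * sqrt_coeff (n - i)) = 2 * sqrt_coeff n - (if n = 1 then 1 else 0)"
proof (cases n)
  case (Suc m)
  show ?thesis
  proof (cases m)
    case (Suc k)
    have "(\<Sum>i\<le>n. sqrt_coeff i * sqrt_coeff (n - i))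
        = (\<Sum>i\<le>Suc k. sqrt_coeff (Suc i) * sqrt_coeff (Suc k - i))"
      unfolding \<open>n = Suc m\<close> Suc by (subst sum.atMost_Suc_shift) simp
    also have "\<dots> = (\<Sum>i\<le>k. sqrt_coeff (Suc i) * sqrt_coeff (Suc k - i))"
      by simp
    also have "\<dots> = (\<Sum>i\<le>k. sqrt_coeff (Suc i) * sqrt_coeff (Suc (k - i)))"
      by (intro sum.cong) (auto simp: Suc_diff_le)
    finally show ?thesis using \<open>n = Suc m\<close> Suc by (simp add: sqrt_coeff.simps(3))
  qed (use Suc in simp)
qed simp

text \<open>Induction on the partial sums \<open>S N\<close>. Coefficient 0 vanishes, so the
  convolutions up to degree \<open>N + 1\<close> use only indices up to \<open>N\<close>; summing
  the recursion gives \<open>2 S (N + 1) - 1 \<le> (S N)^2 \<le> 1\<close>.\<close>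

lemma sum_sqrt_coeff_le: "(\<Sum>n\<le>N. sqrt_coeff n) \<le> 1"
proof (induction N)
  case (Suc N)
  let ?g = "\<lambda>(i, j). sqrt_coeff i * sqrt_coeff j"
  have z: "?g p = 0" if "p \<in> {(i, j). i + j \<le> Suc N} - {..N} \<times> {..N}" for p
  proof -
    obtain i j where p: "p = (i, j)" by fastforce
    have "i = 0 \<or> j = 0" using that by (auto simp: p)
    then show ?thesis by (auto simp: p)
  qed
  have fin: "finite {(i, j). i + j \<le> Suc N}"
    by (rule finite_subset[of _ "{..Suc N} \<times> {..Suc N}"]) auto
  have "(\<Sum>n\<le>Suc N. \<Sum>i\<le>n. sqrt_coeff i * sqrt_coeff (n - i)) = sum ?g {(i, j). i + j \<le> Suc N}"
    by (rule sum.triangle_reindex_eq[symmetric])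
  also have "\<dots> = sum ?g ({(i, j). i + j \<le> Suc N} \<inter> {..N} \<times> {..N})"
    using z by (intro sum.mono_neutral_right fin) auto
  also have "\<dots> \<le> sum ?g ({..N} \<times> {..N})"
    by (intro sum_mono2) (auto intro!: mult_nonneg_nonneg sqrt_coeff_nonneg)
  also have "\<dots> = (\<Sum>n\<le>N. sqrt_coeff n) * (\<Sum>n\<le>N. sqrt_coeff n)"
    by (simp add: sum_product sum.cartesian_product)
  also have "\<dots> \<le> 1"
    using Suc by (intro mult_le_one sum_nonneg sqrt_coeff_nonneg)
  finally have "(\<Sum>n\<le>Suc N. 2 * sqrt_coeff n - (if n = 1 then 1 else 0)) \<le> 1"
    by (simp only: sqrt_coeff_convolution)
  moreover have "(\<Sum>n\<le>Suc N. 2 * sqrt_coeff n - (if n = 1 then 1 else (0::real)))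
      = 2 * (\<Sum>n\<le>Suc N. sqrt_coeff n) - 1"
    unfolding sum_subtractf sum_distrib_left[symmetric] by simp
  ultimately show ?case by linarith
qed simp

lemma summable_sqrt_coeff: "summable sqrt_coeff" and suminf_sqrt_coeff_le: "suminf sqrt_coeff \<le> 1"
proof -
  have le: "sum sqrt_coeff {..<n} \<le> 1" for n
    by (rule order_trans[OF sum_mono2 sum_sqrt_coeff_le[of n]]) (auto simp: sqrt_coeff_nonneg)
  show "summable sqrt_coeff"
    by (rule summableI_nonneg_bounded[OF sqrt_coeff_nonneg le])
  then show "suminf sqrt_coeff \<le> 1" using le by (rule suminf_le_const)
qed

section \<open>Rearrangement of double series\<close>

lemma infsum_eq_suminf:
  fixes f :: "nat \<Rightarrow> 'a::banach"
  assumes "summable (\<lambda>n. norm (f n))"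
  shows "infsum f UNIV = suminf f"
  using norm_summable_imp_has_sum[OF assms] summable_norm_cancel[OF assms]
  by (intro infsumI) (auto intro: summable_sums)

lemma suminf_norm_le:
  fixes f :: "nat \<Rightarrow> 'a::banach"
  assumes "\<And>n. norm (f n) \<le> g n" "summable g"
  shows "summable (\<lambda>n. norm (f n))" "summable f" "norm (suminf f) \<le> suminf g"
proof -
  show *: "summable (\<lambda>n. norm (f n))"
    by (rule summable_comparison_test'[OF assms(2)]) (use assms(1) in simp)
  show "summable f" by (rule summable_norm_cancel[OF *])
  show "norm (suminf f) \<le> suminf g"
    using summable_norm[OF *] suminf_le[OF assms(1) * assms(2)] by linarith
qed

text \<open>Domination by a product of summable sequences makes the family over all pairs
  unconditionally summable, so it can be regrouped along \<open>i + j = n\<close>. This is needed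
  for the square of the operator series \<open>X\<close> below and for the Cauchy product of
  \<open>B\<close> with a Hardy function.\<close>

lemma suminf_double_diagonal:
  fixes f :: "nat \<times> nat \<Rightarrow> 'a::banach"
  assumes b: "\<And>i j. norm (f (i, j)) \<le> a i * c j" and a: "summable a" and c: "summable c"
    and a0: "\<And>i. 0 \<le> a i" and c0: "\<And>i. 0 \<le> c i"
  shows "(\<Sum>i. \<Sum>j. f (i, j)) = (\<Sum>n. \<Sum>i\<le>n. f (i, n - i))"
    and "summable (\<lambda>n. \<Sum>i\<le>n. f (i, n - i))"
proof -
  have row: "summable (\<lambda>j. norm (f (i, j)))" for i
    by (rule suminf_norm_le(1)[OF b summable_mult[OF c]])
  have row': "infsum (\<lambda>j. norm (f (i, j))) UNIV \<le> a i * suminf c" for i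
    using infsum_eq_suminf[of "\<lambda>j. norm (f (i, j))"] row[of i] suminf_le[OF b row summable_mult[OF c]]
    by (simp add: suminf_mult[OF c])
  have sn: "(\<lambda>p. norm (f p)) summable_on (UNIV \<times> UNIV)"
  unfolding Infinite_Sum.abs_summable_on_Sigma_iff
  proof (intro conjI ballI)
    show "(\<lambda>j. norm (f (i, j))) summable_on UNIV" for i
      by (rule norm_summable_imp_summable_on) (use row in simp)
    have "summable (\<lambda>i. norm (infsum (\<lambda>j. norm (f (i, j))) UNIV))"
      by (rule summable_comparison_test'[OF summable_mult2[OF a, of "suminf c"]])
        (use row' in \<open>simp add: infsum_nonneg\<close>)
    then show "(\<lambda>i. norm (infsum (\<lambda>j. norm (f (i, j))) UNIV)) summable_on UNIV"
      by (intro norm_summable_imp_summable_on) simp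
  qed
  then have s: "f summable_on (UNIV \<times> UNIV)" by (rule Infinite_Sum.abs_summable_summable)
  have n2: "summable (\<lambda>i. norm (\<Sum>j. f (i, j)))"
  proof (rule summable_comparison_test'[OF summable_mult2[OF a, of "suminf c"]])
    fix i
    have "norm (\<Sum>j. f (i, j)) \<le> (\<Sum>j. norm (f (i, j)))" by (rule summable_norm[OF row])
    also have "\<dots> \<le> a i * suminf c" 
      using suminf_le[OF b row summable_mult[OF c]] by (simp add: suminf_mult[OF c])
    finally show "norm (norm (\<Sum>j. f (i, j))) \<le> a i * suminf c" by simp
  qed
  define g :: "nat \<times> nat \<Rightarrow> nat \<times> nat" where "g = (\<lambda>(n, i). (i, n - i))"
  have g: "bij_betw g (Sigma UNIV (\<lambda>n. {..n})) (UNIV \<times> UNIV)"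
    by (rule bij_betw_byWitness[where f' = "\<lambda>(i, j). (i + j, i)"]) (auto simp: g_def)
  have sg: "(\<lambda>p. f (g p)) summable_on (Sigma UNIV (\<lambda>n. {..n}))"
    using s summable_on_reindex_bij_betw[OF g, of f] by simp
  have sng: "(\<lambda>p. norm (f (g p))) summable_on (Sigma UNIV (\<lambda>n. {..n}))"
    using sn summable_on_reindex_bij_betw[OF g, of "\<lambda>p. norm (f p)"] by simp
  have d: "summable (\<lambda>n. norm (\<Sum>i\<le>n. f (i, n - i)))"
  proof (rule summable_comparison_test')
    have "(\<lambda>n. infsum (\<lambda>i. norm (f (g (n, i)))) {..n}) summable_on UNIV"
      using summable_on_Sigma_banach[where f = "\<lambda>n i. norm (f (g (n, i)))" and A = UNIV
          and B = "\<lambda>n. {..n}"] sng by (simp add: case_prod_unfold)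
    then show "summable (\<lambda>n. \<Sum>i\<le>n. norm (f (i, n - i)))"
      using summable_on_imp_summable by (simp add: g_def)
  qed (simp add: sum_norm_le)
  then show "summable (\<lambda>n. \<Sum>i\<le>n. f (i, n - i))" by (rule summable_norm_cancel)
  have "(\<Sum>i. \<Sum>j. f (i, j)) = infsum (\<lambda>i. infsum (\<lambda>j. f (i, j)) UNIV) UNIV"
    using infsum_eq_suminf[OF row] infsum_eq_suminf[OF n2] by simp
  also have "\<dots> = infsum f (UNIV \<times> UNIV)" by (rule infsum_Sigma_banach[OF s])
  also have "\<dots> = infsum (\<lambda>p. f (g p)) (Sigma UNIV (\<lambda>n. {..n}))"
    by (rule infsum_reindex_bij_betw[OF g, symmetric])
  also have "\<dots> = infsum (\<lambda>n. infsum (\<lambda>i. f (g (n, i))) {..n}) UNIV"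
    by (rule infsum_Sigma_banach[OF sg, symmetric])
  also have "\<dots> = (\<Sum>n. \<Sum>i\<le>n. f (i, n - i))"
    using infsum_eq_suminf[OF d] by (simp add: g_def)
  finally show "(\<Sum>i. \<Sum>j. f (i, j)) = (\<Sum>n. \<Sum>i\<le>n. f (i, n - i))" .
qed

text \<open>\<open>R = I - s(C)\<close> with \<open>C = I - A\<close>. The contraction
  \<open>C\<close> may have norm 1, where the series for \<open>s\<close> still converges because
  its coefficients are nonnegative with sum at most 1. As \<open>R\<close> is a norm limit of
  polynomials in \<open>A\<close>, it commutes with whatever commutes with \<open>A\<close>; the
  last clause is what uniqueness of the root rests on.\<close>

lemma positive_op_sqrt_exists:
  fixes A :: "'a::complex_hilbert \<Rightarrow> 'a"
  assumes A: "positive_op A" and le: "\<And>x. Re (cinner (A x) x) \<le> (norm x)\<^sup>2"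
  obtains R where "positive_op R" "R \<circ> R = A"
    "\<And>S. bounded_clinear S \<Longrightarrow> (\<And>x. S (A x) = A (S x)) \<Longrightarrow> (\<And>x. S (R x) = R (S x))"
proof -
  define C where "C x = x - A x" for x
  note A' = bounded_clinearD[OF positive_opD(1)[OF A]]
  have C: "bounded_clinear C"
    unfolding C_def by (intro bounded_clinear_diff bounded_clinear_id positive_opD(1)[OF A])
  have Cpos: "positive_op C"
    using C le positive_opD(2)[OF A]
    by (auto simp: positive_op_def C_def cinner_simps cinner_self)
  have Cn: "norm (C x) \<le> norm x" for x
    by (rule positive_op_contraction[OF Cpos])
      (use positive_opD(3)[OF A] in \<open>simp add: C_def cinner_simps cinner_self\<close>)
  have Cp: "bounded_clinear (C ^^ n)" for n
    by (induction n) (auto simp: bounded_clinear_id id_def o_def bounded_clinear_compose[OF C])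
  have Cpn: "norm ((C ^^ n) x) \<le> norm x" for n x
    by (induction n) (auto intro: order_trans[OF Cn])
  define a where "a = sqrt_coeff"
  have a: "a n \<ge> 0" for n by (simp add: a_def sqrt_coeff_nonneg)
  have sa: "summable a" by (simp add: a_def summable_sqrt_coeff)
  have bnd: "norm (a n *\<^sub>R (C ^^ n) x) \<le> a n * norm x" for n x
    using a[of n] Cpn[of n x] by (simp add: mult_left_mono)
  note sm = suminf_norm_le[OF bnd summable_mult2[OF sa]]
  define X where "X x = (\<Sum>n. a n *\<^sub>R (C ^^ n) x)" for x
  have Xn: "norm (X x) \<le> norm x" for x
  proof -
    have "norm (X x) \<le> (\<Sum>n. a n * norm x)" unfolding X_def by (rule sm(3))
    also have "\<dots> = suminf a * norm x" by (rule suminf_mult2[OF sa, symmetric])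
    also have "\<dots> \<le> 1 * norm x"
      by (intro mult_right_mono) (auto simp: a_def suminf_sqrt_coeff_le)
    finally show ?thesis by simp
  qed
  have X: "bounded_clinear X"
  proof (rule bounded_clinearI)
    show "X (x + y) = X x + X y" for x y
      unfolding X_def by (simp add: bounded_clinearD[OF Cp] scaleR_add_right suminf_add[OF sm(2) sm(2)])
    show "X (c *\<^sub>C x) = c *\<^sub>C X x" for c x
      unfolding X_def
      by (simp add: bounded_clinearD[OF Cp] bounded_linear.suminf[OF bounded_linear_scaleC_right sm(2)]
          scaleC_scaleR)
    show "norm (X x) \<le> 1 * norm x" for x using Xn by simp
  qed
  have comm: "S (X x) = X (S x)" if S: "bounded_clinear S" and SC: "\<And>x. S (C x) = C (S x)" for S x
  proof -
    have "S ((C ^^ n) x) = (C ^^ n) (S x)" for n by (induction n) (auto simp: SC)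
    then show ?thesis
      unfolding X_def bounded_linear.suminf[OF bounded_clinearD(1)[OF S] sm(2)]
      by (simp add: bounded_clinearD[OF S])
  qed
  have XX: "X (X x) = 2 *\<^sub>R X x - C x" for x
  proof -
    define f where "f = (\<lambda>(i, j). (a i * a j) *\<^sub>R (C ^^ (i + j)) x)"
    have "X (X x) = (\<Sum>i. \<Sum>j. f (i, j))"
      unfolding X_def[of "X x"]
    proof (rule suminf_cong)
      fix i
      have "(C ^^ i) (X x) = (\<Sum>j. (C ^^ i) (a j *\<^sub>R (C ^^ j) x))"
        unfolding X_def by (rule bounded_linear.suminf[OF bounded_clinearD(1)[OF Cp] sm(2)])
      also have "\<dots> = (\<Sum>j. a j *\<^sub>R (C ^^ (i + j)) x)"
        by (simp add: bounded_clinearD[OF Cp] funpow_add)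
      finally have "a i *\<^sub>R (C ^^ i) (X x) = a i *\<^sub>R (\<Sum>j. a j *\<^sub>R (C ^^ (i + j)) x)" by simp
      also have "\<dots> = (\<Sum>j. a i *\<^sub>R (a j *\<^sub>R (C ^^ (i + j)) x))"
      proof (rule bounded_linear.suminf[OF bounded_linear_scaleR_right])
        show "summable (\<lambda>j. a j *\<^sub>R (C ^^ (i + j)) x)"
          by (rule suminf_norm_le(2)[OF _ summable_mult2[OF sa, of "norm x"]])
            (use a Cpn in \<open>simp add: mult_left_mono\<close>)
      qed
      finally show "a i *\<^sub>R (C ^^ i) (X x) = (\<Sum>j. f (i, j))" by (simp add: f_def)
    qed
    also have "\<dots> = (\<Sum>n. \<Sum>i\<le>n. f (i, n - i))"
    proof (rule suminf_double_diagonal(1))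
      show "norm (f (i, j)) \<le> (a i * norm x) * a j" for i j
        using mult_left_mono[OF Cpn[of "i + j" x], of "a i * a j"] a[of i] a[of j]
        by (simp add: f_def abs_mult mult_ac)
    qed (use a sa in \<open>auto intro: summable_mult2\<close>)
    also have "\<dots> = (\<Sum>n. 2 *\<^sub>R (a n *\<^sub>R (C ^^ n) x) - (if n = 1 then C x else 0))"
    proof (rule suminf_cong)
      fix n
      have "(\<Sum>i\<le>n. f (i, n - i)) = (\<Sum>i\<le>n. a i * a (n - i)) *\<^sub>R (C ^^ n) x"
        unfolding scaleR_sum_left by (intro sum.cong) (auto simp: f_def)
      then show "(\<Sum>i\<le>n. f (i, n - i)) = 2 *\<^sub>R (a n *\<^sub>R (C ^^ n) x) - (if n = 1 then C x else 0)"
        by (simp add: a_def sqrt_coeff_convolution scaleR_diff_left)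
    qed
    also have "\<dots> = (\<Sum>n. 2 *\<^sub>R (a n *\<^sub>R (C ^^ n) x)) - (\<Sum>n. if n = 1 then C x else 0)"
      using sums_single[of 1 "\<lambda>_. C x"]
      by (intro suminf_diff[symmetric] summable_scaleR_right sm(2)) (auto simp: sums_iff)
    also have "(\<Sum>n. if n = 1 then C x else 0) = C x"
      using sums_single[of 1 "\<lambda>_. C x"] by (auto simp: sums_iff)
    also have "(\<Sum>n. 2 *\<^sub>R (a n *\<^sub>R (C ^^ n) x)) = 2 *\<^sub>R X x"
      unfolding X_def by (rule suminf_scaleR_right[OF sm(2), symmetric])
    finally show ?thesis .
  qed
  have CX: "cinner (X x) x = complex_of_real (Re (cinner (X x) x))" for x
  proof -
    have "Im (cinner ((C ^^ n) x) x) = 0" for n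
    proof -
      have *: "cinner ((C ^^ n) x) y = cinner x ((C ^^ n) y)" for x y
        by (induction n arbitrary: x y) (auto simp: positive_op_selfadjoint[OF Cpos] funpow_swap1)
      have "cinner ((C ^^ n) x) x = cnj (cinner ((C ^^ n) x) x)"
        using *[of x x] cinner_commute by metis
      then show ?thesis by (metis cnj.simps(2) equal_neg_zero)
    qed
    then have "Im (cinner (a n *\<^sub>R (C ^^ n) x) x) = 0" for n by (simp add: cinner_simps)
    moreover have "cinner (X x) x = (\<Sum>n. cinner (a n *\<^sub>R (C ^^ n) x) x)"
      unfolding X_def by (rule bounded_linear.suminf[OF bounded_linear_cinner_left sm(2)])
    moreover have "summable (\<lambda>n. cinner (a n *\<^sub>R (C ^^ n) x) x)"
      by (rule bounded_linear.summable[OF bounded_linear_cinner_left sm(2)])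
    ultimately have "Im (cinner (X x) x) = 0" by (simp add: bounded_linear.suminf[OF bounded_linear_Im])
    then show ?thesis by (simp add: complex_eq_iff)
  qed
  define R where "R x = x - X x" for x
  have Rl: "bounded_clinear R"
    unfolding R_def by (intro bounded_clinear_diff bounded_clinear_id X)
  have "positive_op R"
    unfolding positive_op_def
  proof (intro conjI allI Rl)
    fix x
    have "Im (cinner (X x) x) = 0" by (subst CX) simp
    then show "Im (cinner (R x) x) = 0" by (simp add: R_def cinner_simps cinner_self)
    have "Re (cinner (X x) x) \<le> cmod (cinner (X x) x)" by (rule complex_Re_le_cmod)
    also have "\<dots> \<le> norm (X x) * norm x" by (rule Cauchy_Schwarz_cinner)
    also have "\<dots> \<le> norm x * norm x" by (intro mult_right_mono Xn) auto
    finally show "0 \<le> Re (cinner (R x) x)"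
      by (simp add: R_def cinner_simps cinner_self power2_eq_square)
  qed
  moreover have "R \<circ> R = A"
  proof
    show "(R \<circ> R) x = A x" for x
      using XX[of x] by (simp add: R_def bounded_clinearD[OF X] C_def scaleR_2)
  qed
  moreover have "S (R x) = R (S x)" if S: "bounded_clinear S" "\<And>x. S (A x) = A (S x)" for S x
    using comm[OF S(1)] S(2) by (simp add: R_def C_def bounded_clinearD[OF S(1)])
  ultimately show thesis using that by blast
qed

text \<open>Any positive root \<open>S\<close> commutes with \<open>A = S^2\<close>, hence with
  \<open>R\<close>. For \<open>y = S x - R x\<close> this gives
  \<open>(S + R) y = S^2 x - R^2 x = 0\<close>; positivity of both roots then forces
  \<open>S y = R y = 0\<close>, and \<open>\<parallel>y\<parallel>^2 = <x, (S - R) y> = 0\<close>.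
  So the definite description in \<open>op_sqrt\<close> denotes \<open>R\<close>.\<close>

lemma op_sqrt:
  fixes A :: "'a::complex_hilbert \<Rightarrow> 'a"
  assumes A: "positive_op A" and le: "\<And>x. Re (cinner (A x) x) \<le> (norm x)\<^sup>2"
  shows "positive_op (op_sqrt A)" and "op_sqrt A (op_sqrt A x) = A x"
proof -
  obtain R where R: "positive_op R" "R \<circ> R = A"
    and comm: "\<And>S x. bounded_clinear S \<Longrightarrow> (\<And>x. S (A x) = A (S x)) \<Longrightarrow> S (R x) = R (S x)"
    using positive_op_sqrt_exists[OF A le] by metis
  note R' = bounded_clinearD[OF positive_opD(1)[OF R(1)]]
  have "S = R" if S: "positive_op S" "S \<circ> S = A" for S
  proof
    fix x
    note S' = bounded_clinearD[OF positive_opD(1)[OF S(1)]]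
    have SS: "S (S x) = A x" and RR: "R (R x) = A x" for x
      using S(2) R(2) by (metis comp_apply)+
    have SR: "S (R x) = R (S x)" for x
      by (rule comm[OF positive_opD(1)[OF S(1)]]) (simp flip: SS)
    define y where "y = S x - R x"
    have "cinner (S y) y + cinner (R y) y = cinner (S y + R y) y" by (simp add: cinner_simps)
    also have "S y + R y = 0" by (simp add: y_def S' R' SS RR SR)
    finally have sum0: "cinner (S y) y + cinner (R y) y = 0" by simp
    then have "Re (cinner (S y) y) + Re (cinner (R y) y) = 0" by (metis plus_complex.sel(1) zero_complex.sel(1))
    then have "cinner (S y) y = 0" "cinner (R y) y = 0"
      using positive_opD(2,3)[OF S(1), of y] positive_opD(2,3)[OF R(1), of y]
      by (auto simp: complex_eq_iff)
    then have "S y = 0" "R y = 0" using positive_op_eq_zero S(1) R(1) by blast+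
    then have "cinner y y = cinner x (S y - R y)"
      unfolding y_def cinner_diff_left cinner_diff_right
      by (simp add: positive_op_selfadjoint[OF S(1)] positive_op_selfadjoint[OF R(1)] S' R')
    then show "S x = R x" using \<open>S y = 0\<close> \<open>R y = 0\<close> by (simp add: cinner_self y_def)
  qed
  then have "op_sqrt A = R" unfolding op_sqrt_def using R by blast
  with R show "positive_op (op_sqrt A)" "op_sqrt A (op_sqrt A x) = A x" by auto
qed

section \<open>Ranges of positive operators and their norms\<close>

lemma range_norm_eq:
  fixes A :: "'a::complex_hilbert \<Rightarrow> 'b::complex_hilbert"
  assumes A: "bounded_clinear A" and x: "\<And>k. A k = 0 \<Longrightarrow> cinner x k = 0"
  shows "range_norm A (A x) = norm x"
proof -
  have "(THE x'. A x' = A x \<and> (\<forall>k. A k = 0 \<longrightarrow> cinner x' k = 0)) = x"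
  proof (rule the_equality)
    fix x' assume x': "A x' = A x \<and> (\<forall>k. A k = 0 \<longrightarrow> cinner x' k = 0)"
    then have "A (x' - x) = 0" by (simp add: bounded_clinearD[OF A])
    then have "cinner (x' - x) (x' - x) = 0" using x x' by (simp add: cinner_diff_left)
    then show "x' = x" by (simp add: cinner_self)
  qed (use x in auto)
  then show ?thesis by (simp add: range_norm_def)
qed

text \<open>Supplies the hypothesis of \<open>range_norm_eq\<close>: on the closure of
  \<open>range D\<close> the range norm of \<open>D e\<close> is the norm of
  \<open>e\<close>.\<close>

lemma closure_range_orthogonal_ker:
  assumes D: "positive_op D" and e: "e \<in> closure (range D)" and k: "D k = 0"
  shows "cinner e k = 0"
proof -
  obtain X where X: "\<And>n. X n \<in> range D" "X \<longlonglongrightarrow> e" using e closure_sequential by metis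
  have "cinner (X n) k = 0" for n
    using X(1)[of n] k by (auto simp: positive_op_selfadjoint[OF D])
  moreover have "(\<lambda>n. cinner (X n) k) \<longlonglongrightarrow> cinner e k" by (intro tendsto_intros X)
  ultimately show ?thesis by (simp add: LIMSEQ_const_iff)
qed

lemma range_positive_op_rep:
  assumes D: "positive_op D"
  obtains e where "D e = D u" "e \<in> closure (range D)"
proof -
  obtain e where e: "e \<in> closure (range D)" "\<And>v. v \<in> range D \<Longrightarrow> cinner v (u - e) = 0"
    using orthogonal_projection[OF csubspace_range[OF positive_opD(1)[OF D]]] by metis
  have "cinner x (D (u - e)) = 0" for x
    using e(2)[of "D x"] by (simp add: positive_op_selfadjoint[OF D])
  from this[of "D (u - e)"] have "D e = D u"
    by (simp add: cinner_self bounded_clinearD[OF positive_opD(1)[OF D]])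
  with e(1) that show thesis by blast
qed

text \<open>Douglas' range criterion. The bound makes \<open>D x \<mapsto> <x, y>\<close> a well
  defined bounded functional on \<open>range D\<close>; by self-adjointness its Riesz vector is a
  preimage of \<open>y\<close>.\<close>

lemma in_range_positive_op:
  assumes D: "positive_op D" and le: "\<And>x. cmod (cinner x y) \<le> C * norm (D x)"
  obtains e where "D e = y" "e \<in> closure (range D)"
proof -
  note D' = bounded_clinearD[OF positive_opD(1)[OF D]]
  \<comment> \<open>Any preimage may be chosen: two of them differ by a kernel vector, on which the
    bound makes \<open><x, y>\<close> vanish.\<close>
  define f where "f v = cinner (SOME x. D x = v) y" for v
  have f: "f (D x) = cinner x y" for x
  proof -
    define x' where "x' = (SOME x'. D x' = D x)"
    have "D x' = D x" unfolding x'_def by (rule someI) simp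
    then have "D (x' - x) = 0" by (simp add: D')
    then have "cinner (x' - x) y = 0" using le[of "x' - x"] by simp
    then show ?thesis by (simp add: f_def x'_def[symmetric] cinner_simps)
  qed
  obtain e where e: "e \<in> closure (range D)" "\<And>v. v \<in> range D \<Longrightarrow> f v = cinner v e"
  proof (rule riesz_csubspace[OF csubspace_range[OF positive_opD(1)[OF D]], of f C])
    show "f (v + w) = f v + f w" if "v \<in> range D" "w \<in> range D" for v w
      using that f by (auto simp: cinner_simps simp flip: D'(2))
    show "f (c *\<^sub>C v) = c * f v" if "v \<in> range D" for c v
      using that f by (auto simp: cinner_simps simp flip: D'(5))
    show "cmod (f v) \<le> C * norm v" if "v \<in> range D" for v
      using that f le by auto
  qed blast
  have "cinner x (D e) = cinner x y" for x
    using e(2)[of "D x"] f[of x] by (simp add: positive_op_selfadjoint[OF D])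
  then have "D e = y" by (rule cinner_eqI)
  with e(1) that show thesis by blast
qed

subsection \<open>Integration on the circle\<close>

text \<open>The measure of \<open>log_integrable_on_circle\<close>. It is not normalised, which is
  the source of the factors \<open>2 * pi\<close> throughout.\<close>

abbreviation circ :: "real measure" where "circ \<equiv> lebesgue_on {0..2 * pi}"

lemma finite_measure_circ: "finite_measure circ"
  by (rule finite_measure_lebesgue_on) auto

interpretation circ: finite_measure circ by (rule finite_measure_circ)

interpretation circ2: pair_sigma_finite circ circ ..

interpretation circ2: finite_measure "circ \<Otimes>\<^sub>M circ"
  by (rule finite_measure_pair_measure) (rule finite_measure_circ)+

lemma measure_circ [simp]: "measure circ {0..2 * pi} = 2 * pi"
  by (simp add: measure_restrict_space)

lemma ident_measurable_circ [measurable]: "(\<lambda>x. x) \<in> borel_measurable circ"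
  by (intro measurable_restrict_space1 measurable_completion) simp

lemma continuous_measurable_circ:
  fixes f :: "real \<Rightarrow> 'b::topological_space"
  assumes "continuous_on UNIV f" shows "f \<in> borel_measurable circ"
  using measurable_compose[OF ident_measurable_circ borel_measurable_continuous_onI[OF assms]] by simp

lemma integrable_circ_bounded:
  fixes f :: "real \<Rightarrow> 'b::{banach, second_countable_topology}"
  assumes "f \<in> borel_measurable circ" "\<And>t. norm (f t) \<le> C"
  shows "integrable circ f"
  by (rule circ.integrable_const_bound[of _ C]) (use assms in auto)

lemma integrable_circ_continuous:
  fixes f :: "real \<Rightarrow> 'b::{banach, second_countable_topology}"
  assumes "continuous_on UNIV f"
  shows "integrable circ f"
proof -
  have "compact (f ` {0..2 * pi})"
    by (intro compact_continuous_image continuous_on_subset[OF assms]) auto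
  then obtain C where C: "\<And>t. t \<in> {0..2 * pi} \<Longrightarrow> norm (f t) \<le> C"
    using bounded_pos compact_imp_bounded by (metis imageI)
  show ?thesis
    by (rule circ.integrable_const_bound[of _ C])
      (use C continuous_measurable_circ[OF assms] in \<open>auto simp: space_restrict_space intro!: AE_I2\<close>)
qed

lemma integral_circ_cis: "(LINT t|circ. cis (of_int k * t)) = (if k = 0 then 2 * pi else 0)"
proof (cases "k = 0")
  case True
  then show ?thesis by (simp add: scaleR_conv_of_real)
next
  case False
  have "integrable circ (\<lambda>t. cis (of_int k * t))"
    by (intro integrable_circ_continuous continuous_intros)
  then have "(LINT t|circ. cis (of_int k * t)) = integral {0..2 * pi} (\<lambda>t. cis (of_int k * t))"
    by (rule lebesgue_integral_eq_integral) simp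
  also have "\<dots> = 0"
  proof (rule integral_unique)
    have "((\<lambda>t. cis (of_int k * t)) has_integral
        (cis (of_int k * (2 * pi)) / (\<i> * k) - cis (of_int k * 0) / (\<i> * k))) {0..2 * pi}"
    proof (rule fundamental_theorem_of_calculus)
      fix t :: real
      have "((\<lambda>t. exp (\<i> * k * complex_of_real t) / (\<i> * k)) has_vector_derivative
          exp (\<i> * k * complex_of_real t)) (at t within {0..2 * pi})"
        using False by (auto intro!: derivative_eq_intros has_vector_derivative_real_field)
      then show "((\<lambda>t. cis (of_int k * t) / (\<i> * k)) has_vector_derivative cis (of_int k * t))
          (at t within {0..2 * pi})"
        by (simp add: cis_conv_exp mult_ac)
    qed simp
    moreover have "cis (of_int k * (2 * pi)) = 1"
      by (metis cis_multiple_2pi Ints_of_int mult.commute)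
    ultimately show "((\<lambda>t. cis (of_int k * t)) has_integral 0) {0..2 * pi}" by simp
  qed
  finally show ?thesis using False by simp
qed

lemma continuous_on_suminf_bounded:
  fixes f :: "nat \<Rightarrow> 'b::topological_space \<Rightarrow> 'a::banach"
  assumes "\<And>n. continuous_on S (f n)" "\<And>n x. x \<in> S \<Longrightarrow> norm (f n x) \<le> c n" "summable c"
  shows "continuous_on S (\<lambda>x. \<Sum>n. f n x)"
proof -
  have "uniform_limit S (\<lambda>n x. \<Sum>i<n. f i x) (\<lambda>x. \<Sum>i. f i x) sequentially"
    by (rule Weierstrass_m_test) (use assms(2,3) in auto)
  then show ?thesis
    by (rule uniform_limit_theorem[rotated])
      (auto intro!: always_eventually continuous_on_sum assms(1))
qed

lemma integral_circ_suminf: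
  fixes f :: "nat \<Rightarrow> real \<Rightarrow> complex"
  assumes f: "\<And>n. continuous_on UNIV (f n)" and c: "\<And>n t. cmod (f n t) \<le> c n" "summable c"
  shows "(LINT t|circ. (\<Sum>n. f n t)) = (\<Sum>n. LINT t|circ. f n t)"
proof (rule integral_suminf)
  show "integrable circ (f n)" for n by (rule integrable_circ_continuous[OF f])
  show "AE t in circ. summable (\<lambda>n. norm (f n t))"
    by (intro always_eventually allI summable_comparison_test'[OF c(2)]) (use c(1) in auto)
  show "summable (\<lambda>n. LINT t|circ. norm (f n t))"
  proof (rule summable_comparison_test'[OF summable_mult2[OF c(2), of "2 * pi"]])
    fix n
    have "(LINT t|circ. norm (f n t)) \<le> (LINT t|circ. c n)"
      by (intro integral_mono integrable_circ_continuous continuous_intros f) (use c(1) in auto)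
    then show "norm (LINT t|circ. norm (f n t)) \<le> c n * (2 * pi)"
      by (simp add: mult.commute[of "c n"])
  qed
qed

text \<open>The exponents are negative because \<open>cinner\<close> is antilinear in its second
  argument: pairing a fixed vector with such a series gives a series in positive powers of
  \<open>cis t\<close>, as is required for \<open>B (r * cis t) x\<close>.\<close>

definition circ_series :: "(nat \<Rightarrow> 'a::complex_hilbert) \<Rightarrow> real \<Rightarrow> 'a" where
  "circ_series a t = (\<Sum>n. cis (- real n * t) *\<^sub>C a n)"

lemma summable_circ_series:
  fixes a :: "nat \<Rightarrow> 'a::complex_hilbert"
  assumes "summable (\<lambda>n. norm (a n))"
  shows "summable (\<lambda>n. cis (- real n * t) *\<^sub>C a n)"
  by (rule summable_norm_cancel) (use assms in \<open>simp add: norm_scaleC\<close>)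

lemma continuous_circ_series:
  assumes "summable (\<lambda>n. norm (a n))"
  shows "continuous_on UNIV (circ_series a)"
  unfolding circ_series_def
  by (rule continuous_on_suminf_bounded[where c = "\<lambda>n. norm (a n)"])
    (auto intro!: continuous_intros assms simp: norm_scaleC)

lemma norm_circ_series_le:
  assumes "summable (\<lambda>n. norm (a n))"
  shows "norm (circ_series a t) \<le> (\<Sum>n. norm (a n))"
  unfolding circ_series_def
  by (rule order_trans[OF summable_norm]) (use assms in \<open>simp_all add: norm_scaleC\<close>)

lemma integral_circ_series_coeff_int:
  fixes a :: "nat \<Rightarrow> complex" and m :: int
  assumes a: "summable (\<lambda>n. norm (a n))"
  shows "(LINT t|circ. cis (real_of_int m * t) * circ_series a t)
    = (if 0 \<le> m then 2 * pi * a (nat m) else 0)"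
proof -
  have "(LINT t|circ. cis (real_of_int m * t) * circ_series a t)
      = (LINT t|circ. (\<Sum>n. cis (real_of_int (m - int n) * t) * a n))"
  proof (rule Bochner_Integration.integral_cong[OF refl])
    fix t
    have "cis (real_of_int m * t) * circ_series a t
        = (\<Sum>n. cis (real_of_int m * t) * (cis (- real n * t) *\<^sub>C a n))"
      unfolding circ_series_def by (rule suminf_mult[OF summable_circ_series[OF a], symmetric])
    also have "\<dots> = (\<Sum>n. cis (real_of_int (m - int n) * t) * a n)"
    proof (rule suminf_cong)
      fix n
      have "cis (real_of_int m * t) * cis (- real n * t) = cis (real_of_int (m - int n) * t)"
        unfolding cis_mult by (simp add: algebra_simps)
      then show "cis (real_of_int m * t) * (cis (- real n * t) *\<^sub>C a n)
          = cis (real_of_int (m - int n) * t) * a n"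
        by (simp only: scaleC_complex_def mult.assoc[symmetric])
    qed
    finally show "cis (real_of_int m * t) * circ_series a t
        = (\<Sum>n. cis (real_of_int (m - int n) * t) * a n)" .
  qed
  also have "\<dots> = (\<Sum>n. LINT t|circ. cis (real_of_int (m - int n) * t) * a n)"
    by (rule integral_circ_suminf[OF _ _ a]) (auto intro!: continuous_intros simp: norm_mult)
  also have "\<dots> = (\<Sum>n. if m = int n then 2 * pi * a n else 0)"
    by (intro suminf_cong) (simp add: integral_circ_cis del: of_int_diff)
  also have "\<dots> = (if 0 \<le> m then 2 * pi * a (nat m) else 0)"
  proof (cases "0 \<le> m")
    case True
    then have "(\<lambda>n. if m = int n then 2 * pi * a n else 0) = (\<lambda>n. if n = nat m then 2 * pi * a n else 0)"
      by auto
    then show ?thesis using True sums_single[of "nat m" "\<lambda>n. 2 * pi * a n"] by (simp add: sums_iff)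
  next
    case False
    then have "(\<lambda>n. if m = int n then 2 * pi * a n else 0) = (\<lambda>n. 0)" by auto
    then show ?thesis using False by simp
  qed
  finally show ?thesis .
qed

lemma integral_circ_series_coeff:
  fixes a :: "nat \<Rightarrow> complex"
  assumes a: "summable (\<lambda>n. norm (a n))"
  shows "(LINT t|circ. cis (real m * t) * circ_series a t) = 2 * pi * a m"
  using integral_circ_series_coeff_int[OF a, of "int m"] by simp

lemma cinner_circ_series:
  assumes a: "summable (\<lambda>n. norm (a n))"
  shows "cinner (circ_series a t) v = circ_series (\<lambda>n. cinner (a n) v) t"
  unfolding circ_series_def
  by (subst bounded_linear.suminf[OF bounded_linear_cinner_left summable_circ_series[OF a]])
    (simp add: cinner_scaleC_left scaleC_complex_def)

lemma summable_cinner: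
  fixes v :: "'a::complex_hilbert"
  assumes "summable (\<lambda>n. norm (a n))"
  shows "summable (\<lambda>n. norm (cinner (a n) v))"
  by (rule summable_comparison_test'[OF summable_mult2[OF assms, of "norm v"]])
    (simp add: Cauchy_Schwarz_cinner)

text \<open>Only the second argument of \<open>cinner (F t) (F t)\<close> is expanded. Each
  resulting integral is a Fourier coefficient of the scalar series
  \<open>cinner (F t) (a m)\<close>, so no double series arises.\<close>

lemma parseval_circ:
  fixes a :: "nat \<Rightarrow> 'a::complex_hilbert"
  assumes a: "summable (\<lambda>n. norm (a n))"
  shows "(LINT t|circ. (norm (circ_series a t))\<^sup>2) = 2 * pi * (\<Sum>n. (norm (a n))\<^sup>2)"
    and "summable (\<lambda>n. (norm (a n))\<^sup>2)"
proof -
  let ?F = "circ_series a"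
  define C where "C = (\<Sum>n. norm (a n))"
  have FC: "norm (?F t) \<le> C" for t unfolding C_def by (rule norm_circ_series_le[OF a])
  have C0: "0 \<le> C" using order_trans[OF norm_ge_zero FC] .
  have aC: "norm (a n) \<le> C" for n
    unfolding C_def using sum_le_suminf[OF a, of "{n}"] by simp
  show s2: "summable (\<lambda>n. (norm (a n))\<^sup>2)"
    by (rule summable_comparison_test'[OF summable_mult[OF a, of C]])
      (use aC in \<open>auto simp: power2_eq_square intro!: mult_right_mono\<close>)
  have "complex_of_real (LINT t|circ. (norm (?F t))\<^sup>2) = (LINT t|circ. cinner (?F t) (?F t))"
    by (simp add: cinner_self flip: of_real_power)
  also have "\<dots> = (LINT t|circ. (\<Sum>m. cis (real m * t) * cinner (?F t) (a m)))"
  proof (rule Bochner_Integration.integral_cong[OF refl])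
    fix t
    have "cinner (?F t) (?F t) = (\<Sum>m. cinner (?F t) (cis (- real m * t) *\<^sub>C a m))"
      by (subst (2) circ_series_def)
        (rule bounded_linear.suminf[OF bounded_linear_cinner_right summable_circ_series[OF a]])
    then show "cinner (?F t) (?F t) = (\<Sum>m. cis (real m * t) * cinner (?F t) (a m))"
      by (simp add: cinner_scaleC_right cis_cnj)
  qed
  also have "\<dots> = (\<Sum>m. LINT t|circ. cis (real m * t) * cinner (?F t) (a m))"
  proof (rule integral_circ_suminf)
    show "continuous_on UNIV (\<lambda>t. cis (real m * t) * cinner (?F t) (a m))" for m
      by (intro continuous_intros continuous_circ_series[OF a])
    show "cmod (cis (real m * t) * cinner (?F t) (a m)) \<le> C * norm (a m)" for m t
      using order_trans[OF Cauchy_Schwarz_cinner mult_right_mono[OF FC norm_ge_zero]]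
      by (simp add: norm_mult)
    show "summable (\<lambda>m. C * norm (a m))" by (intro summable_mult a)
  qed
  also have "\<dots> = (\<Sum>m. complex_of_real (2 * pi * (norm (a m))\<^sup>2))"
    by (simp add: cinner_circ_series[OF a] integral_circ_series_coeff[OF summable_cinner[OF a]] cinner_self)
  also have "\<dots> = complex_of_real (\<Sum>m. 2 * pi * (norm (a m))\<^sup>2)"
    by (rule suminf_of_real[symmetric]) (intro summable_mult s2)
  finally show "(LINT t|circ. (norm (?F t))\<^sup>2) = 2 * pi * (\<Sum>n. (norm (a n))\<^sup>2)"
    by (simp only: of_real_eq_iff suminf_mult[OF s2])
qed

subsection \<open>The Poisson kernel\<close>

text \<open>Its integral over the circle is \<open>2 * pi\<close>; the factor
  \<open>1 / (2 * pi)\<close> is put in where the kernel is used.\<close>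

definition poisson :: "real \<Rightarrow> real \<Rightarrow> real \<Rightarrow> real" where
  "poisson r t s = (1 - r\<^sup>2) / (1 - 2 * r * cos (t - s) + r\<^sup>2)"

lemma poisson_denom:
  assumes "0 \<le> (r::real)"
  shows "(1 - r)\<^sup>2 \<le> 1 - 2 * r * cos u + r\<^sup>2"
  using mult_left_mono[OF cos_le_one[of u], of "2 * r"] assms by (simp add: power2_diff)

lemma poisson_denom_pos:
  assumes "0 \<le> (r::real)" "r < 1"
  shows "0 < 1 - 2 * r * cos u + r\<^sup>2"
  using poisson_denom[OF assms(1), of u] assms(2) zero_less_power[of "1 - r" 2] by linarith

lemma poisson_nonneg: "0 \<le> r \<Longrightarrow> r < 1 \<Longrightarrow> 0 \<le> poisson r t s"
  unfolding poisson_def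
  by (intro divide_nonneg_pos poisson_denom_pos) (auto simp: power_le_one_iff abs_le_square_iff)

lemma poisson_commute: "poisson r t s = poisson r s t"
  unfolding poisson_def using cos_minus[of "t - s"] by simp

lemma poisson_le:
  assumes "0 \<le> r" "r \<le> R" "R < 1"
  shows "poisson r t s \<le> 1 / (1 - R)\<^sup>2"
  unfolding poisson_def
proof (rule frac_le)
  have "(1 - R)\<^sup>2 \<le> (1 - r)\<^sup>2" using assms by (intro power_mono) auto
  then show "(1 - R)\<^sup>2 \<le> 1 - 2 * r * cos (t - s) + r\<^sup>2"
    using poisson_denom[OF assms(1), of "t - s"] by linarith
qed (use assms in auto)

lemma continuous_poisson:
  assumes "0 \<le> r" "r < 1"
  shows "continuous_on UNIV (poisson r t)"
  unfolding poisson_def using poisson_denom_pos[OF assms]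
  by (intro continuous_intros) (auto simp: less_le)

text \<open>In passing from \<open>r\<close> to \<open>q\<close> the numerator grows at most by the
  factor 2, since \<open>1 - r^4 \<le> 2 (1 - r^2)\<close>, and the denominator shrinks at most by
  the factor 4; their product is 8. The range \<open>r^2 \<le> q \<le> r\<close> is the one in which
  the product of \<open>r\<close> with a larger radius lies.\<close>

lemma poisson_le_8:
  assumes r: "0 \<le> r" "r < 1" and q: "r\<^sup>2 \<le> q" "q \<le> r"
  shows "poisson q t s \<le> 8 * poisson r t s"
proof -
  define u where "u = t - s"
  define dr where "dr = 1 - 2 * r * cos u + r\<^sup>2"
  define dq where "dq = 1 - 2 * q * cos u + q\<^sup>2"
  have q0: "0 \<le> q" "q < 1" using r q by (auto intro: order_trans[OF _ q(1)])
  have dr0: "dr > 0" and dq0: "dq > 0"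
    unfolding dr_def dq_def by (intro poisson_denom_pos r q0)+
  have c: "0 \<le> 1 - cos u" "1 - cos u \<le> 2" using cos_ge_minus_one[of u] by auto
  define X where "X = r * (1 - cos u)"
  define Y where "Y = q * (1 - cos u)"
  have Y0: "0 \<le> Y" using q0 c by (simp add: Y_def)
  have e: "dr = (1 - r)\<^sup>2 + 2 * X" "dq = (1 - q)\<^sup>2 + 2 * Y"
    by (simp_all add: dr_def dq_def X_def Y_def power2_eq_square algebra_simps)
  have m: "(1 - r)\<^sup>2 \<le> (1 - q)\<^sup>2" using r q by (intro power_mono) auto
  have "dr \<le> 4 * dq"
  \<comment> \<open>For small \<open>r\<close> the term \<open>(1 - q)^2 \<ge> 1/2\<close> dominates
    \<open>X\<close>. Otherwise \<open>q \<ge> r^2 \<ge> r / 4\<close>, so the cosine terms are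
    comparable as well.\<close>
  proof (cases "r \<le> 1/4")
    case True
    have "X \<le> (1/4) * 2" unfolding X_def using True r c by (intro mult_mono) auto
    moreover have "(3/4)\<^sup>2 \<le> (1 - q)\<^sup>2" using True q by (intro power_mono) auto
    then have "1/2 \<le> (1 - q)\<^sup>2" by (simp add: power2_eq_square)
    moreover have "a + 2 * X \<le> 4 * (b + 2 * Y)" if "a \<le> b" "X \<le> (1/4) * 2" "1/2 \<le> b" for a b :: real
      using that Y0 by simp
    ultimately show ?thesis using m unfolding e by blast
  next
    case False
    have "r * (1/4) \<le> r * r" using False r by (intro mult_left_mono) auto
    then have "r \<le> 4 * q" using q(1) by (simp add: power2_eq_square)
    then have "X \<le> (4 * q) * (1 - cos u)" unfolding X_def using c by (intro mult_right_mono) auto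
    then have "X \<le> 4 * Y" by (simp add: Y_def)
    moreover have "a + 2 * X \<le> 4 * (b + 2 * Y)" if "a \<le> b" "X \<le> 4 * Y" "0 \<le> b" for a b :: real
      using that by simp
    moreover have "0 \<le> (1 - q)\<^sup>2" by simp
    ultimately show ?thesis using m unfolding e by blast
  qed
  have r2: "0 \<le> r\<^sup>2" "r\<^sup>2 < 1" using r by (auto simp: power_less_one_iff abs_square_less_1)
  have "(r\<^sup>2)\<^sup>2 \<le> q\<^sup>2" using q by (intro power_mono) auto
  then have n: "1 - q\<^sup>2 \<le> 2 * (1 - r\<^sup>2)"
    using mult_nonneg_nonneg[of "1 - r\<^sup>2" "1 - r\<^sup>2"] r2 by (simp add: power2_eq_square algebra_simps)
  have "(1 - q\<^sup>2) / dq \<le> 2 * (1 - r\<^sup>2) / (dr / 4)"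
    by (rule frac_le) (use n \<open>dr \<le> 4 * dq\<close> dr0 r2 in auto)
  then show ?thesis by (simp add: poisson_def dr_def dq_def u_def)
qed

lemma poisson_product_le:
  assumes "0 \<le> r" "r < 1" "0 \<le> q" "q < 1"
  shows "poisson (r * q) t s \<le> 8 * (poisson r t s + poisson q t s)"
proof -
  have *: "poisson (r * q) t s \<le> 8 * poisson r t s" if "0 \<le> r" "r \<le> q" "q < 1" for r q
    by (rule poisson_le_8)
      (use that mult_left_mono[of r q r] mult_left_mono[of q 1 r] in \<open>auto simp: power2_eq_square\<close>)
  show ?thesis
    using *[of r q] *[of q r] assms poisson_nonneg[of r t s] poisson_nonneg[of q t s]
    by (cases "r \<le> q") (auto simp: mult.commute)
qed

text \<open>Coefficients of \<open>(1 + z) / (1 - z) = 1 + 2 z + 2 z^2 + ...\<close> at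
  \<open>z = r * cis (s - t)\<close>, as a series in \<open>t\<close>; the Poisson kernel is its
  real part.\<close>

definition poisson_coeff :: "real \<Rightarrow> real \<Rightarrow> nat \<Rightarrow> complex" where
  "poisson_coeff r s n = (if n = 0 then 1 else 2 * r ^ n * cis (n * s))"

lemma summable_poisson_coeff:
  assumes "0 \<le> r" "r < 1"
  shows "summable (\<lambda>n. norm (poisson_coeff r s n))"
proof (rule summable_comparison_test')
  show "summable (\<lambda>n. 2 * r ^ n)" using assms by (intro summable_mult summable_geometric) simp
qed (use assms in \<open>auto simp: poisson_coeff_def norm_mult norm_power\<close>)

lemma poisson_series:
  assumes r: "0 \<le> r" "r < 1"
  shows "poisson r t s = Re (circ_series (poisson_coeff r s) t)"
proof -
  define z where "z = r * cis (s - t)"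
  have z: "cmod z < 1" using r by (simp add: z_def norm_mult)
  have "(\<lambda>n. 2 * z ^ n - (if n = 0 then 1 else 0)) sums (2 * (1 / (1 - z)) - 1)"
    by (intro sums_diff sums_mult geometric_sums z) (use sums_single[of 0 "\<lambda>_. 1"] in auto)
  moreover have "cis (- real n * t) *\<^sub>C poisson_coeff r s n = 2 * z ^ n - (if n = 0 then 1 else 0)" for n
  proof (cases "n = 0")
    case False
    have "cis (- real n * t) * cis (real n * s) = cis (s - t) ^ n"
      unfolding cis_mult Complex.DeMoivre by (simp add: algebra_simps)
    then show ?thesis using False
      by (simp add: poisson_coeff_def scaleC_complex_def z_def power_mult_distrib)
  qed (simp add: poisson_coeff_def scaleC_complex_def)
  ultimately have "circ_series (poisson_coeff r s) t = 2 * (1 / (1 - z)) - 1"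
    by (simp add: circ_series_def sums_iff)
  moreover have "Re (2 * (1 / (1 - z)) - 1) = poisson r t s"
  proof -
    have Re1: "Re (1 - z) = 1 - r * cos (t - s)" using cos_minus[of "t - s"] by (simp add: z_def)
    have "(cmod (1 - z))\<^sup>2 = 1 - 2 * r * cos (t - s) + r\<^sup>2"
    proof -
      have "(cmod (1 - z))\<^sup>2 = (1 - r * cos (t - s))\<^sup>2 + (r * sin (t - s))\<^sup>2"
        unfolding cmod_power2 Re1 using sin_minus[of "t - s"] by (simp add: z_def power_mult_distrib)
      also have "\<dots> = 1 - 2 * r * cos (t - s) + r\<^sup>2 * ((cos (t - s))\<^sup>2 + (sin (t - s))\<^sup>2)"
        by algebra
      finally show ?thesis by simp
    qed
    then have "Re (1 / (1 - z)) = (1 - r * cos (t - s)) / (1 - 2 * r * cos (t - s) + r\<^sup>2)"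
      using Re1 by (simp add: Re_divide' complex_mult_cnj flip: cmod_power2)
    moreover have "Re (2 * (1 / (1 - z)) - 1) = 2 * Re (1 / (1 - z)) - 1"
      by (simp del: times_divide_eq_right)
    ultimately show ?thesis
      using poisson_denom_pos[OF r, of "t - s"] by (simp add: poisson_def field_simps)
  qed
  ultimately show ?thesis by simp
qed


lemma integral_cis_mult_suminf:
  fixes d c :: "nat \<Rightarrow> complex"
  assumes d: "summable (\<lambda>n. norm (d n))" and c: "summable (\<lambda>n. norm (c n))"
  shows "(LINT s|circ. circ_series d s * circ_series c s) = 2 * pi * d 0 * c 0"
    and "(LINT s|circ. cnj (circ_series d s) * circ_series c s) = 2 * pi * (\<Sum>m. cnj (d m) * c m)"
proof -
  define C where "C = (\<Sum>n. norm (c n))"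
  have C: "cmod (circ_series c s) \<le> C" for s unfolding C_def by (rule norm_circ_series_le[OF c])
  have C0: "0 \<le> C" using order_trans[OF norm_ge_zero C] .
  have cont: "continuous_on UNIV (\<lambda>s. d' * (cis (real_of_int m * s) * circ_series c s))" for m d'
    by (intro continuous_intros continuous_circ_series[OF c])
  have bd: "cmod (d' * (cis (real_of_int m * s) * circ_series c s)) \<le> cmod d' * C" for m d' s
    using mult_left_mono[OF C, of "cmod d'"] by (simp add: norm_mult)
  have "(LINT s|circ. circ_series d s * circ_series c s)
      = (LINT s|circ. (\<Sum>m. d m * (cis (real_of_int (- int m) * s) * circ_series c s)))"
  proof (rule Bochner_Integration.integral_cong[OF refl])
    fix s
    show "circ_series d s * circ_series c s
        = (\<Sum>m. d m * (cis (real_of_int (- int m) * s) * circ_series c s))"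
      unfolding circ_series_def[of d]
      by (subst suminf_mult2[OF summable_circ_series[OF d]])
        (simp add: scaleC_complex_def mult_ac)
  qed
  also have "\<dots> = (\<Sum>m. LINT s|circ. d m * (cis (real_of_int (- int m) * s) * circ_series c s))"
    by (rule integral_circ_suminf[OF cont bd summable_mult2[OF d]])
  also have "\<dots> = (\<Sum>m. if m = 0 then d m * (2 * pi * c 0) else 0)"
    by (rule suminf_cong) (simp only: integral_mult_right_zero integral_circ_series_coeff_int[OF c], simp)
  also have "\<dots> = 2 * pi * d 0 * c 0"
    using sums_single[of 0 "\<lambda>m. d m * (2 * pi * c 0)"] by (simp add: sums_iff)
  finally show "(LINT s|circ. circ_series d s * circ_series c s) = 2 * pi * d 0 * c 0" .
  have d': "summable (\<lambda>m. norm (cnj (d m)))" using d by simp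
  have "(LINT s|circ. cnj (circ_series d s) * circ_series c s)
      = (LINT s|circ. (\<Sum>m. cnj (d m) * (cis (real_of_int (int m) * s) * circ_series c s)))"
  proof (rule Bochner_Integration.integral_cong[OF refl])
    fix s
    have "cnj (circ_series d s) = (\<Sum>m. cnj (cis (- real m * s) *\<^sub>C d m))"
      unfolding circ_series_def by (rule bounded_linear.suminf[OF bounded_linear_cnj summable_circ_series[OF d]])
    also have "\<dots> = (\<Sum>m. cis (real m * s) * cnj (d m))" by (simp add: scaleC_complex_def cis_cnj)
    finally have *: "cnj (circ_series d s) = (\<Sum>m. cis (real m * s) * cnj (d m))" .
    have "summable (\<lambda>m. cis (real m * s) * cnj (d m))"
      by (rule summable_norm_cancel) (use d in \<open>simp add: norm_mult\<close>)
    then show "cnj (circ_series d s) * circ_series c s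
        = (\<Sum>m. cnj (d m) * (cis (real_of_int (int m) * s) * circ_series c s))"
      unfolding * by (subst suminf_mult2) (simp_all add: mult_ac)
  qed
  also have "\<dots> = (\<Sum>m. LINT s|circ. cnj (d m) * (cis (real_of_int (int m) * s) * circ_series c s))"
    by (rule integral_circ_suminf[OF cont bd]) (use summable_mult2[OF d] in simp)
  also have "\<dots> = (\<Sum>m. 2 * pi * (cnj (d m) * c m))"
    by (rule suminf_cong) (simp only: integral_mult_right_zero integral_circ_series_coeff_int[OF c], simp)
  also have "\<dots> = 2 * pi * (\<Sum>m. cnj (d m) * c m)"
  proof (rule suminf_mult)
    have cb: "cmod (c m) \<le> C" for m unfolding C_def using sum_le_suminf[OF c, of "{m}"] by simp
    show "summable (\<lambda>m. cnj (d m) * c m)"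
      by (rule summable_comparison_test'[OF summable_mult2[OF d, of C]])
        (simp add: norm_mult cb mult_left_mono)
  qed
  finally show "(LINT s|circ. cnj (circ_series d s) * circ_series c s) = 2 * pi * (\<Sum>m. cnj (d m) * c m)" .
qed

lemma poisson_integral:
  fixes c :: "nat \<Rightarrow> complex"
  assumes r: "0 \<le> r" "r < 1" and c: "summable (\<lambda>n. norm (c n))"
  shows "(LINT s|circ. poisson r t s * circ_series c s) = 2 * pi * circ_series (\<lambda>n. complex_of_real (r ^ n) * c n) t"
proof -
  define d where "d = poisson_coeff r t"
  have d: "summable (\<lambda>n. norm (d n))" unfolding d_def by (rule summable_poisson_coeff[OF r])
  define C where "C = (\<Sum>n. norm (c n))"
  have cb: "cmod (c m) \<le> C" for m unfolding C_def using sum_le_suminf[OF c, of "{m}"] by simp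
  have s1: "summable (\<lambda>m. cnj (d m) * c m)"
    by (rule summable_comparison_test'[OF summable_mult2[OF d, of C]])
      (simp add: norm_mult cb mult_left_mono)
  have eq: "complex_of_real (poisson r t s) * circ_series c s
      = (1/2) * (circ_series d s * circ_series c s + cnj (circ_series d s) * circ_series c s)" for s
  proof -
    have "complex_of_real (poisson r t s) = (circ_series d s + cnj (circ_series d s)) / 2"
      by (subst poisson_commute) (simp add: poisson_series[OF r] d_def complex_add_cnj)
    then show ?thesis by (simp add: algebra_simps add_divide_distrib)
  qed
  have "(LINT s|circ. poisson r t s * circ_series c s)
      = (1/2) * ((LINT s|circ. circ_series d s * circ_series c s)
         + (LINT s|circ. cnj (circ_series d s) * circ_series c s))"
    unfolding eq integral_mult_right_zero
    by (subst Bochner_Integration.integral_add)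
      (auto intro!: integrable_circ_continuous continuous_intros continuous_circ_series c d)
  also have "\<dots> = pi * (d 0 * c 0 + (\<Sum>m. cnj (d m) * c m))"
    unfolding integral_cis_mult_suminf[OF d c] by (simp add: algebra_simps)
  \<comment> \<open>The coefficients \<open>d m\<close> carry a factor 2 except at
    \<open>m = 0\<close>; the extra term \<open>d 0 * c 0\<close> supplies the missing half
    there.\<close>
  also have "d 0 * c 0 + (\<Sum>m. cnj (d m) * c m) = 2 * circ_series (\<lambda>n. complex_of_real (r ^ n) * c n) t"
  proof -
    have "(\<lambda>m. (if m = 0 then c 0 else 0) + cnj (d m) * c m) sums (c 0 + (\<Sum>m. cnj (d m) * c m))"
      by (intro sums_add summable_sums[OF s1]) (use sums_single[of 0 "\<lambda>_. c 0"] in auto)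
    moreover have "(if m = 0 then c 0 else 0) + cnj (d m) * c m
        = 2 * (cis (- real m * t) *\<^sub>C (complex_of_real (r ^ m) * c m))" for m
      by (simp add: d_def poisson_coeff_def scaleC_complex_def cis_cnj)
    ultimately have "(\<lambda>m. 2 * (cis (- real m * t) *\<^sub>C (complex_of_real (r ^ m) * c m))) sums (c 0 + (\<Sum>m. cnj (d m) * c m))"
      by simp
    then have "(\<lambda>m. cis (- real m * t) *\<^sub>C (complex_of_real (r ^ m) * c m)) sums ((c 0 + (\<Sum>m. cnj (d m) * c m)) / 2)"
      using sums_mult[of _ _ "1/2"] by fastforce
    then have "circ_series (\<lambda>n. complex_of_real (r ^ n) * c n) t = (c 0 + (\<Sum>m. cnj (d m) * c m)) / 2"
      unfolding circ_series_def by (rule sums_unique[symmetric])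
    moreover have "d 0 = 1" by (simp add: d_def poisson_coeff_def)
    ultimately show ?thesis by (simp add: mult.commute)
  qed
  finally show ?thesis by simp
qed

text \<open>Semigroup property: convolution with the kernel of radius \<open>r\<close> multiplies
  the \<open>n\<close>-th coefficient by \<open>r ^ n\<close>, so radii multiply.\<close>

lemma poisson_convolution:
  assumes r: "0 \<le> r" "r < 1" and q: "0 \<le> q" "q < 1"
  shows "(LINT u|circ. poisson r t u * poisson q u s) = 2 * pi * poisson (r * q) t s"
proof -
  have rq: "0 \<le> r * q" "r * q < 1" using r q mult_strict_mono[of r 1 q 1] by auto
  have s: "summable (\<lambda>n. norm (poisson_coeff q s n))" by (rule summable_poisson_coeff[OF q])
  have int: "integrable circ (\<lambda>u. complex_of_real (poisson r t u) * circ_series (poisson_coeff q s) u)"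
    by (intro integrable_circ_continuous continuous_intros continuous_circ_series s continuous_poisson[OF r])
  have "(LINT u|circ. poisson r t u * poisson q u s)
      = (LINT u|circ. Re (complex_of_real (poisson r t u) * circ_series (poisson_coeff q s) u))"
    by (simp add: poisson_series[OF q])
  also have "\<dots> = Re (2 * pi * circ_series (\<lambda>n. complex_of_real (r ^ n) * poisson_coeff q s n) t)"
    by (simp only: integral_Re[OF int] poisson_integral[OF r s])
  also have "(\<lambda>n. complex_of_real (r ^ n) * poisson_coeff q s n) = poisson_coeff (r * q) s"
    by (auto simp: poisson_coeff_def power_mult_distrib)
  finally show ?thesis by (simp add: poisson_series[OF rq])
qed

subsection \<open>The maximal inequality\<close>

lemma fst_measurable_circ2 [measurable]: "(\<lambda>p. fst p) \<in> borel_measurable (circ \<Otimes>\<^sub>M circ)"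
  using measurable_compose[OF measurable_fst ident_measurable_circ] by simp

lemma snd_measurable_circ2 [measurable]: "(\<lambda>p. snd p) \<in> borel_measurable (circ \<Otimes>\<^sub>M circ)"
  using measurable_compose[OF measurable_snd ident_measurable_circ] by simp

lemma fst_compose_circ2 [measurable]:
  "f \<in> borel_measurable circ \<Longrightarrow> (\<lambda>p. f (fst p)) \<in> borel_measurable (circ \<Otimes>\<^sub>M circ)"
  by (rule measurable_compose[OF measurable_fst])

lemma snd_compose_circ2 [measurable]:
  "f \<in> borel_measurable circ \<Longrightarrow> (\<lambda>p. f (snd p)) \<in> borel_measurable (circ \<Otimes>\<^sub>M circ)"
  by (rule measurable_compose[OF measurable_snd])

lemma circ_fubini:
  fixes f :: "real \<Rightarrow> real \<Rightarrow> real"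
  assumes m: "(\<lambda>p. f (fst p) (snd p)) \<in> borel_measurable (circ \<Otimes>\<^sub>M circ)" and b: "\<And>t s. \<bar>f t s\<bar> \<le> C"
  shows "(LINT t|circ. LINT s|circ. f t s) = (LINT s|circ. LINT t|circ. f t s)"
    and "(\<lambda>t. LINT s|circ. f t s) \<in> borel_measurable circ"
    and "(\<lambda>s. LINT t|circ. f t s) \<in> borel_measurable circ"
    and "\<bar>LINT s|circ. f t s\<bar> \<le> 2 * pi * C" and "\<bar>LINT t|circ. f t s\<bar> \<le> 2 * pi * C"
proof -
  have m': "case_prod f \<in> borel_measurable (circ \<Otimes>\<^sub>M circ)" using m by (simp add: case_prod_beta')
  have i: "integrable (circ \<Otimes>\<^sub>M circ) (case_prod f)"
    by (rule circ2.integrable_const_bound[of _ C]) (use b m' in auto)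
  show "(LINT t|circ. LINT s|circ. f t s) = (LINT s|circ. LINT t|circ. f t s)"
    by (rule circ2.Fubini_integral[OF i, symmetric])
  show "(\<lambda>t. LINT s|circ. f t s) \<in> borel_measurable circ"
    using circ2.integrable_fst[OF i] by blast
  show "(\<lambda>s. LINT t|circ. f t s) \<in> borel_measurable circ"
    using circ2.integrable_snd[OF i] by blast
  have C0: "0 \<le> C" using b[of 0 0] by linarith
  have bd: "\<bar>LINT t|circ. g t\<bar> \<le> 2 * pi * C" if "\<And>t. \<bar>g t\<bar> \<le> C" for g :: "real \<Rightarrow> real"
  proof (cases "integrable circ g")
    case True
    have "\<bar>LINT t|circ. g t\<bar> \<le> (LINT t|circ. \<bar>g t\<bar>)" using integral_norm_bound[of circ g] by simp
    also have "\<dots> \<le> (LINT t|circ. C)" by (intro integral_mono) (use True that in auto)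
    finally show ?thesis by simp
  qed (simp add: not_integrable_integral_eq C0)
  show "\<bar>LINT s|circ. f t s\<bar> \<le> 2 * pi * C" "\<bar>LINT t|circ. f t s\<bar> \<le> 2 * pi * C"
    by (intro bd b)+
qed

lemma poisson_measurable [measurable]:
  assumes [measurable]: "\<rho> \<in> borel_measurable circ"
  shows "(\<lambda>p. poisson (\<rho> (fst p)) (fst p) (snd p)) \<in> borel_measurable (circ \<Otimes>\<^sub>M circ)"
  unfolding poisson_def by measurable

text \<open>The linearised maximal operator \<open>T g t = \<integral> P\<^bsub>\<rho> t\<^esub>(t, s) g s ds\<close> satisfies
  \<open>T T\<^sup>* \<le> 8 (T + T\<^sup>*)\<close> on nonnegative functions, because \<open>P\<^bsub>rq\<^esub> \<le> 8 (P\<^bsub>r\<^esub> + P\<^bsub>q\<^esub>)\<close>; this bounds its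
  norm on \<open>L\<^sup>2\<close>.\<close>

lemma poisson_linearised_L2_bound:
  assumes \<rho>[measurable]: "\<rho> \<in> borel_measurable circ" and \<rho>R: "\<And>t. 0 \<le> \<rho> t" "\<And>t. \<rho> t \<le> R" and R: "R < 1"
    and g[measurable]: "g \<in> borel_measurable circ" and g0: "\<And>t. 0 \<le> g t" and gC: "\<And>t. g t \<le> C"
  shows "(LINT t|circ. (LINT s|circ. poisson (\<rho> t) t s / (2 * pi) * g s)\<^sup>2) \<le> 256 * (LINT t|circ. (g t)\<^sup>2)"
proof -
  have \<rho>1: "\<rho> t < 1" for t using \<rho>R(2)[of t] R by linarith
  define k where "k t s = poisson (\<rho> t) t s / (2 * pi)" for t s
  define K where "K = 1 / (1 - R)\<^sup>2 / (2 * pi)"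
  have k0: "0 \<le> k t s" for t s
    unfolding k_def using poisson_nonneg[OF \<rho>R(1) \<rho>1] by simp
  have kK: "k t s \<le> K" for t s
    unfolding k_def K_def using poisson_le[OF \<rho>R(1) \<rho>R(2) R] by (intro divide_right_mono) auto
  have K0: "0 \<le> K" using order_trans[OF k0 kK] .
  have km[measurable]: "(\<lambda>p. k (fst p) (snd p)) \<in> borel_measurable (circ \<Otimes>\<^sub>M circ)"
    unfolding k_def by measurable
  have C0: "0 \<le> C" using order_trans[OF g0 gC] .
  define T where "T f t = (LINT s|circ. k t s * f s)" for f t
  define A where "A f s = (LINT t|circ. k t s * f t)" for f s
  \<comment> \<open>The class \<open>bm\<close> is preserved by \<open>T\<close> and by its adjoint
    \<open>A\<close>, and all pairings of its members are finite.\<close>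
  define bm where "bm f \<longleftrightarrow> f \<in> borel_measurable circ \<and> (\<forall>t. 0 \<le> f t) \<and> (\<exists>D. \<forall>t. f t \<le> D)" for f :: "real \<Rightarrow> real"
  have bmT: "bm (T f)" and bmA: "bm (A f)" if f: "bm f" for f
  proof -
    from f obtain D where D: "\<And>t. f t \<le> D" and fm[measurable]: "f \<in> borel_measurable circ"
      and f0: "\<And>t. 0 \<le> f t" by (auto simp: bm_def)
    have D0: "0 \<le> D" using order_trans[OF f0 D] .
    have b: "\<bar>k t s * f u\<bar> \<le> K * D" for t s u
      using mult_mono[OF kK[of t s] D[of u] K0 f0] k0[of t s] f0[of u] by (simp add: abs_mult)
    have m1: "(\<lambda>p. k (fst p) (snd p) * f (snd p)) \<in> borel_measurable (circ \<Otimes>\<^sub>M circ)"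
      and m2: "(\<lambda>p. k (fst p) (snd p) * f (fst p)) \<in> borel_measurable (circ \<Otimes>\<^sub>M circ)"
      by measurable
    have "\<bar>T f t\<bar> \<le> 2 * pi * (K * D)" for t unfolding T_def by (rule circ_fubini(4)[OF m1 b])
    then have "T f t \<le> 2 * pi * (K * D)" for t using abs_ge_self order_trans by blast
    moreover have "T f \<in> borel_measurable circ" unfolding T_def by (rule circ_fubini(2)[OF m1 b])
    moreover have "0 \<le> T f t" for t
      unfolding T_def by (intro Bochner_Integration.integral_nonneg mult_nonneg_nonneg k0 f0)
    ultimately show "bm (T f)" unfolding bm_def by blast
    have "\<bar>A f s\<bar> \<le> 2 * pi * (K * D)" for s unfolding A_def by (rule circ_fubini(5)[OF m2 b])
    then have "A f s \<le> 2 * pi * (K * D)" for s using abs_ge_self order_trans by blast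
    moreover have "A f \<in> borel_measurable circ" unfolding A_def by (rule circ_fubini(3)[OF m2 b])
    moreover have "0 \<le> A f s" for s
      unfolding A_def by (intro Bochner_Integration.integral_nonneg mult_nonneg_nonneg k0 f0)
    ultimately show "bm (A f)" unfolding bm_def by blast
  qed
  have int: "integrable circ (\<lambda>t. f t * h t)" if f: "bm f" and h: "bm h" for f h
  proof -
    from f h obtain D E where D: "\<And>t. f t \<le> D" "\<And>t. h t \<le> E" "\<And>t. 0 \<le> f t" "\<And>t. 0 \<le> h t"
      and [measurable]: "f \<in> borel_measurable circ" "h \<in> borel_measurable circ" by (auto simp: bm_def)
    have D0: "0 \<le> D" using order_trans[OF D(3) D(1)] .
    show ?thesis
      by (rule integrable_circ_bounded[of _ "D * E"])
        (use mult_mono[OF D(1) D(2) D0 D(4)] D(3,4) in \<open>auto simp: abs_mult\<close>)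
  qed
  have adj: "(LINT t|circ. f t * T h t) = (LINT s|circ. A f s * h s)" if f: "bm f" and h: "bm h" for f h
  proof -
    from f h obtain D E where D: "\<And>t. f t \<le> D" "\<And>t. h t \<le> E" "\<And>t. 0 \<le> f t" "\<And>t. 0 \<le> h t"
      and [measurable]: "f \<in> borel_measurable circ" "h \<in> borel_measurable circ" by (auto simp: bm_def)
    have D0: "0 \<le> D" using order_trans[OF D(3) D(1)] .
    have DE: "\<bar>f t * (k t s * h s)\<bar> \<le> D * (K * E)" for t s
      using D k0 by (auto simp: abs_mult intro!: mult_mono kK D0 mult_nonneg_nonneg K0)
    have m: "(\<lambda>p. f (fst p) * (k (fst p) (snd p) * h (snd p))) \<in> borel_measurable (circ \<Otimes>\<^sub>M circ)"
      by measurable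
    have "(LINT t|circ. f t * T h t) = (LINT t|circ. LINT s|circ. f t * (k t s * h s))"
      by (simp add: T_def)
    also have "\<dots> = (LINT s|circ. LINT t|circ. f t * (k t s * h s))" by (rule circ_fubini(1)[OF m DE])
    also have "\<dots> = (LINT s|circ. LINT t|circ. (k t s * f t) * h s)" by (simp add: mult_ac)
    also have "\<dots> = (LINT s|circ. A f s * h s)" by (simp add: A_def)
    finally show ?thesis .
  qed
  have TA: "T (A h) t \<le> 8 * (T h t + A h t)" if h: "bm h" for h t
  proof -
    from h obtain E where D: "\<And>t. h t \<le> E" "\<And>t. 0 \<le> h t"
      and [measurable]: "h \<in> borel_measurable circ" by (auto simp: bm_def)
    have [measurable]: "(\<lambda>s. k t s) \<in> borel_measurable circ"
      unfolding k_def poisson_def by measurable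
    have [measurable]: "(\<lambda>s. k s t) \<in> borel_measurable circ"
      unfolding k_def poisson_def by measurable
    have bd: "\<bar>k t s * (k u s * h u)\<bar> \<le> K * (K * E)" for s u
      using D k0 by (auto simp: abs_mult intro!: mult_mono kK K0 mult_nonneg_nonneg)
    have m: "(\<lambda>p. k t (fst p) * (k (snd p) (fst p) * h (snd p))) \<in> borel_measurable (circ \<Otimes>\<^sub>M circ)"
    proof -
      have "(\<lambda>p. k (snd p) (fst p)) \<in> borel_measurable (circ \<Otimes>\<^sub>M circ)"
        unfolding k_def poisson_def by measurable
      moreover have "(\<lambda>p. k t (fst p)) \<in> borel_measurable (circ \<Otimes>\<^sub>M circ)" by measurable
      ultimately show ?thesis by measurable
    qed
    have conv: "(LINT s|circ. k t s * k u s) = poisson (\<rho> t * \<rho> u) t u / (2 * pi)" for u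
    proof -
      have "(LINT s|circ. k t s * k u s)
          = (LINT s|circ. (poisson (\<rho> t) t s * poisson (\<rho> u) s u) / (2 * pi * (2 * pi)))"
        by (simp add: k_def poisson_commute[of "\<rho> u" u])
      also have "\<dots> = 2 * pi * poisson (\<rho> t * \<rho> u) t u / (2 * pi * (2 * pi))"
        by (simp only: integral_divide_zero poisson_convolution[OF \<rho>R(1) \<rho>1 \<rho>R(1) \<rho>1])
      finally show ?thesis by simp
    qed
    have i1: "integrable circ (\<lambda>u. k t u * h u)" "integrable circ (\<lambda>u. k u t * h u)"
      by (rule integrable_circ_bounded[of _ "K * E"];
          use D k0 in \<open>auto simp: abs_mult intro!: mult_mono kK K0\<close>)+
    have "T (A h) t = (LINT s|circ. LINT u|circ. k t s * (k u s * h u))"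
      by (simp add: T_def A_def)
    also have "\<dots> = (LINT u|circ. LINT s|circ. k t s * (k u s * h u))" by (rule circ_fubini(1)[OF m bd])
    also have "\<dots> = (LINT u|circ. (LINT s|circ. k t s * k u s) * h u)" by (simp flip: mult.assoc)
    also have "\<dots> \<le> (LINT u|circ. 8 * (k t u * h u + k u t * h u))"
    proof (rule integral_mono')
      show "integrable circ (\<lambda>u. 8 * (k t u * h u + k u t * h u))" using i1 by simp
      fix u
      have "poisson (\<rho> t * \<rho> u) t u \<le> 8 * (poisson (\<rho> t) t u + poisson (\<rho> u) t u)"
        by (rule poisson_product_le[OF \<rho>R(1) \<rho>1 \<rho>R(1) \<rho>1])
      then have "(LINT s|circ. k t s * k u s) \<le> 8 * (k t u + k u t)"
        unfolding conv by (simp add: k_def poisson_commute[of "\<rho> u" t] field_simps)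
      then have "(LINT s|circ. k t s * k u s) * h u \<le> 8 * (k t u + k u t) * h u"
        by (intro mult_right_mono D)
      then show "(LINT s|circ. k t s * k u s) * h u \<le> 8 * (k t u * h u + k u t * h u)"
        by (simp add: algebra_simps)
      show "0 \<le> 8 * (k t u * h u + k u t * h u)" by (intro mult_nonneg_nonneg add_nonneg_nonneg k0 D) auto
    qed
    also have "\<dots> = 8 * (T h t + A h t)" using i1 by (simp add: T_def A_def)
    finally show ?thesis .
  qed
  have bg: "bm g" using g g0 gC by (auto simp: bm_def)
  define h where "h = T g"
  have bh: "bm h" unfolding h_def by (rule bmT[OF bg])
  note bAh = bmA[OF bh]
  define a where "a = (LINT t|circ. A h t * A h t)"
  define b where "b = (LINT t|circ. h t * h t)"
  define c where "c = (LINT t|circ. g t * g t)"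
  have "a = (LINT t|circ. h t * T (A h) t)" unfolding a_def by (rule adj[OF bh bAh, symmetric])
  also have "\<dots> \<le> (LINT t|circ. 8 * (h t * T h t + A h t * h t))"
  proof (rule integral_mono)
    show "integrable circ (\<lambda>t. h t * T (A h) t)" by (intro int bh bmT bAh)
    show "integrable circ (\<lambda>t. 8 * (h t * T h t + A h t * h t))"
      using int[OF bh bmT[OF bh]] int[OF bAh bh] by simp
    show "h t * T (A h) t \<le> 8 * (h t * T h t + A h t * h t)" for t
      using mult_left_mono[OF TA[OF bh, of t], of "h t"] bh by (auto simp: bm_def algebra_simps)
  qed
  also have "\<dots> = 16 * (LINT t|circ. A h t * h t)"
    using int[OF bh bmT[OF bh]] int[OF bAh bh] adj[OF bh bh] by simp
  also have "\<dots> = (LINT t|circ. 16 * (A h t * h t))" by simp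
  \<comment> \<open>The weights let half of \<open>a\<close> be absorbed on the left, leaving
    \<open>a \<le> 256 b\<close>.\<close>
  also have "\<dots> \<le> (LINT t|circ. (1/2) * (A h t * A h t) + 128 * (h t * h t))"
  proof (rule integral_mono)
    show "16 * (A h t * h t) \<le> (1/2) * (A h t * A h t) + 128 * (h t * h t)" for t
      using zero_le_square[of "A h t - 16 * h t"] by (simp add: algebra_simps)
  qed (use int bh bAh in auto)
  also have "\<dots> = (1/2) * a + 128 * b"
    using int[OF bAh bAh] int[OF bh bh] by (simp add: a_def b_def)
  finally have ab: "a \<le> 256 * b" by simp
  have "b = (LINT t|circ. A h t * g t)" unfolding b_def h_def[symmetric] using adj[OF bh bg] by (simp add: h_def)
  \<comment> \<open>With \<open>a \<le> 256 b\<close> the weight \<open>1/512\<close> bounds the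
    first term by \<open>b / 2\<close>, leaving \<open>b \<le> 256 c\<close>.\<close>
  also have "\<dots> \<le> (LINT t|circ. (1/512) * (A h t * A h t) + 128 * (g t * g t))"
  proof (rule integral_mono)
    show "A h t * g t \<le> (1/512) * (A h t * A h t) + 128 * (g t * g t)" for t
      using zero_le_square[of "A h t - 256 * g t"] by (simp add: algebra_simps)
  qed (use int bg bAh in auto)
  also have "\<dots> = (1/512) * a + 128 * c"
    using int[OF bAh bAh] int[OF bg bg] by (simp add: a_def c_def)
  finally have "b \<le> 256 * c" using ab by simp
  then show ?thesis by (simp add: b_def c_def h_def T_def k_def power2_eq_square)
qed

subsection \<open>Radial limits\<close>

text \<open>Pairing with the value \<open>y\<close> of the damped series itself reduces the
  vector-valued statement to the scalar Poisson integral; one factor \<open>norm y\<close> then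
  cancels.\<close>

lemma poisson_dominates:
  fixes c :: "nat \<Rightarrow> 'a::complex_hilbert"
  assumes r: "0 \<le> r" "r < 1" and c: "summable (\<lambda>n. norm (c n))"
  shows "norm (circ_series (\<lambda>n. r ^ n *\<^sub>R c n) t)
    \<le> (LINT s|circ. poisson r t s / (2 * pi) * norm (circ_series c s))"
proof (cases "circ_series (\<lambda>n. r ^ n *\<^sub>R c n) t = 0")
  case True
  then show ?thesis
    using poisson_nonneg[OF r] by (auto intro!: Bochner_Integration.integral_nonneg)
next
  case False
  define y where "y = circ_series (\<lambda>n. r ^ n *\<^sub>R c n) t"
  have ny: "norm y > 0" using False by (simp add: y_def)
  have rc: "summable (\<lambda>n. norm (r ^ n *\<^sub>R c n))"
    by (rule summable_comparison_test'[OF c])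
      (use r in \<open>auto simp: power_le_one mult_left_le_one_le\<close>)
  have "complex_of_real ((norm y)\<^sup>2) = cinner (circ_series (\<lambda>n. r ^ n *\<^sub>R c n) t) y"
    by (simp add: cinner_self y_def)
  also have "\<dots> = circ_series (\<lambda>n. complex_of_real (r ^ n) * cinner (c n) y) t"
    unfolding cinner_circ_series[OF rc] by (simp add: cinner_scaleR_left)
  also have "\<dots> = (LINT s|circ. poisson r t s * cinner (circ_series c s) y) / (2 * pi)"
    unfolding cinner_circ_series[OF c] poisson_integral[OF r summable_cinner[OF c]] by simp
  finally have "(norm y)\<^sup>2 = cmod ((LINT s|circ. poisson r t s * cinner (circ_series c s) y) / (2 * pi))"
    by (metis abs_power2 norm_of_real power2_abs)
  also have "\<dots> = cmod (LINT s|circ. poisson r t s * cinner (circ_series c s) y) / (2 * pi)"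
    by (simp add: norm_divide)
  also have "\<dots> \<le> (LINT s|circ. poisson r t s * norm (circ_series c s) * norm y) / (2 * pi)"
  proof (intro divide_right_mono)
    have "cmod (LINT s|circ. poisson r t s * cinner (circ_series c s) y)
        \<le> (LINT s|circ. cmod (poisson r t s * cinner (circ_series c s) y))"
      by (rule integral_norm_bound)
    also have "\<dots> \<le> (LINT s|circ. poisson r t s * norm (circ_series c s) * norm y)"
    proof (rule integral_mono)
      show "integrable circ (\<lambda>s. cmod (poisson r t s * cinner (circ_series c s) y))"
        "integrable circ (\<lambda>s. poisson r t s * norm (circ_series c s) * norm y)"
        by (intro integrable_circ_continuous continuous_intros continuous_circ_series c continuous_poisson[OF r])+
      show "cmod (poisson r t s * cinner (circ_series c s) y) \<le> poisson r t s * norm (circ_series c s) * norm y" for s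
        using mult_left_mono[OF Cauchy_Schwarz_cinner poisson_nonneg[OF r]] poisson_nonneg[OF r, of t s]
        by (simp add: norm_mult mult.assoc)
    qed
    finally show "cmod (LINT s|circ. poisson r t s * cinner (circ_series c s) y)
        \<le> (LINT s|circ. poisson r t s * norm (circ_series c s) * norm y)" .
  qed simp
  also have "\<dots> = (LINT s|circ. poisson r t s / (2 * pi) * norm (circ_series c s)) * norm y"
    by simp
  finally have "norm y * norm y \<le> (LINT s|circ. poisson r t s / (2 * pi) * norm (circ_series c s)) * norm y"
    by (simp only: power2_eq_square)
  then show ?thesis unfolding y_def[symmetric] using ny by (rule mult_right_le_imp_le)
qed

text \<open>A measurable choice of the maximising radius turns a maximum over \<open>r\<close> into
  a single linear operator with variable radius \<open>\<rho> t\<close>, to which the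
  \<open>L^2\<close> bound applies.\<close>

lemma measurable_argmax:
  fixes U :: "real \<Rightarrow> 'b \<Rightarrow> real"
  assumes "finite F" "F \<noteq> {}" "\<And>r. r \<in> F \<Longrightarrow> U r \<in> borel_measurable M"
  shows "\<exists>\<rho>\<in>borel_measurable M. (\<lambda>t. U (\<rho> t) t) \<in> borel_measurable M
    \<and> (\<forall>t. \<rho> t \<in> F \<and> (\<forall>r\<in>F. U r t \<le> U (\<rho> t) t))"
  using assms
proof (induction F rule: finite_ne_induct)
  case (singleton x)
  then show ?case by (intro bexI[of _ "\<lambda>_. x"]) auto
next
  case (insert x F)
  then obtain \<rho> where \<rho>[measurable]: "\<rho> \<in> borel_measurable M" "(\<lambda>t. U (\<rho> t) t) \<in> borel_measurable M"
    and \<rho>F: "\<And>t. \<rho> t \<in> F" "\<And>t r. r \<in> F \<Longrightarrow> U r t \<le> U (\<rho> t) t" by auto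
  have [measurable]: "U x \<in> borel_measurable M" using insert.prems by simp
  define \<sigma> where "\<sigma> t = (if U (\<rho> t) t < U x t then x else \<rho> t)" for t
  have "\<sigma> \<in> borel_measurable M" unfolding \<sigma>_def by measurable
  moreover have "(\<lambda>t. U (\<sigma> t) t) = (\<lambda>t. if U (\<rho> t) t < U x t then U x t else U (\<rho> t) t)"
    by (auto simp: \<sigma>_def)
  then have "(\<lambda>t. U (\<sigma> t) t) \<in> borel_measurable M" by simp
  moreover have "\<sigma> t \<in> insert x F \<and> (\<forall>r\<in>insert x F. U r t \<le> U (\<sigma> t) t)" for t
    using \<rho>F by (auto simp: \<sigma>_def intro: order_trans[OF \<rho>F(2) less_imp_le])
  ultimately show ?case by blast
qed

text \<open>The constant is the 256 of the linearised bound times the \<open>2 * pi\<close> of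
  Parseval's identity. It does not depend on \<open>F\<close>, which allows the passage to countably
  many radii.\<close>

lemma radial_maximal_finite:
  fixes c :: "nat \<Rightarrow> 'a::complex_hilbert"
  assumes F: "finite F" "F \<noteq> {}" "F \<subseteq> {0..<1}" and c: "summable (\<lambda>n. norm (c n))"
  shows "(LINT t|circ. Max ((\<lambda>r. (norm (circ_series (\<lambda>n. r ^ n *\<^sub>R c n) t))\<^sup>2) ` F))
    \<le> 512 * pi * (\<Sum>n. (norm (c n))\<^sup>2)"
proof -
  define g where "g s = norm (circ_series c s)" for s
  define U where "U r t = (LINT s|circ. poisson r t s / (2 * pi) * g s)" for r t
  define C where "C = (\<Sum>n. norm (c n))"
  have gC: "g s \<le> C" for s unfolding g_def C_def by (rule norm_circ_series_le[OF c])
  have gm[measurable]: "g \<in> borel_measurable circ"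
    unfolding g_def by (intro continuous_measurable_circ continuous_intros continuous_circ_series c)
  have g0: "0 \<le> g s" for s by (simp add: g_def)
  have C0: "0 \<le> C" using order_trans[OF g0 gC] .
  have b: "\<bar>poisson r t s / (2 * pi) * g u\<bar> \<le> 1 / (1 - r)\<^sup>2 / (2 * pi) * C" if "r \<in> F" for r t s u
  proof -
    have r: "0 \<le> r" "r < 1" using that F by auto
    have "\<bar>poisson r t s / (2 * pi) * g u\<bar> = poisson r t s / (2 * pi) * g u"
      using poisson_nonneg[OF r, of t s] g0[of u] by simp
    also have "\<dots> \<le> 1 / (1 - r)\<^sup>2 / (2 * pi) * C"
      by (intro mult_mono divide_right_mono poisson_le[OF r(1) order_refl r(2)] gC g0) auto
    finally show ?thesis .
  qed
  have Um: "U r \<in> borel_measurable circ" if "r \<in> F" for r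
    unfolding U_def by (rule circ_fubini(2)[OF _ b[OF that]]) measurable
  obtain \<rho> where \<rho>: "\<rho> \<in> borel_measurable circ" and Um': "(\<lambda>t. U (\<rho> t) t) \<in> borel_measurable circ"
    and \<rho>F: "\<And>t. \<rho> t \<in> F" "\<And>t r. r \<in> F \<Longrightarrow> U r t \<le> U (\<rho> t) t"
    using measurable_argmax[where U = U, OF F(1,2) Um] by blast
  have U0: "0 \<le> U r t" if "r \<in> F" for r t
    unfolding U_def by (intro Bochner_Integration.integral_nonneg mult_nonneg_nonneg g0 divide_nonneg_nonneg poisson_nonneg)
      (use that F in auto)
  have bU: "\<bar>U r t\<bar> \<le> 2 * pi * (1 / (1 - Max F)\<^sup>2 / (2 * pi) * C)" if "r \<in> F" for r t
  proof -
    have "\<bar>U r t\<bar> \<le> 2 * pi * (1 / (1 - r)\<^sup>2 / (2 * pi) * C)"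
      unfolding U_def by (rule circ_fubini(4)[OF _ b[OF that]]) measurable
    also have "\<dots> \<le> 2 * pi * (1 / (1 - Max F)\<^sup>2 / (2 * pi) * C)"
    proof -
      have "r \<le> Max F" "Max F \<in> F" using F that by auto
      moreover have "Max F < 1" using \<open>Max F \<in> F\<close> F(3) by auto
      ultimately have "1 / (1 - r)\<^sup>2 \<le> 1 / (1 - Max F)\<^sup>2"
        by (intro divide_left_mono power_mono mult_pos_pos zero_less_power) auto
      then show ?thesis using C0 by (intro mult_left_mono mult_right_mono divide_right_mono) auto
    qed
    finally show ?thesis .
  qed
  have dom: "(norm (circ_series (\<lambda>n. r ^ n *\<^sub>R c n) t))\<^sup>2 \<le> (U (\<rho> t) t)\<^sup>2" if "r \<in> F" for r t
  proof (rule power_mono)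
    have "norm (circ_series (\<lambda>n. r ^ n *\<^sub>R c n) t) \<le> U r t"
      unfolding U_def g_def by (rule poisson_dominates[OF _ _ c]) (use that F in auto)
    then show "norm (circ_series (\<lambda>n. r ^ n *\<^sub>R c n) t) \<le> U (\<rho> t) t" using \<rho>F(2)[OF that] by (rule order_trans)
  qed simp
  have "(LINT t|circ. Max ((\<lambda>r. (norm (circ_series (\<lambda>n. r ^ n *\<^sub>R c n) t))\<^sup>2) ` F)) \<le> (LINT t|circ. (U (\<rho> t) t)\<^sup>2)"
  proof (rule integral_mono')
    show "integrable circ (\<lambda>t. (U (\<rho> t) t)\<^sup>2)"
      by (rule integrable_circ_bounded[of _ "(2 * pi * (1 / (1 - Max F)\<^sup>2 / (2 * pi) * C))\<^sup>2"])
        (use Um' bU[OF \<rho>F(1)] in \<open>auto simp: abs_le_square_iff[symmetric] intro: order_trans[OF _ abs_ge_self] simp del: times_divide_eq_right times_divide_eq_left\<close>)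
    show "Max ((\<lambda>r. (norm (circ_series (\<lambda>n. r ^ n *\<^sub>R c n) t))\<^sup>2) ` F) \<le> (U (\<rho> t) t)\<^sup>2" for t
      using F dom by auto
  qed simp
  also have "\<dots> \<le> 256 * (LINT t|circ. (g t)\<^sup>2)"
    unfolding U_def
  proof (rule poisson_linearised_L2_bound[OF \<rho> _ _ _ gm g0 gC])
    show "0 \<le> \<rho> t" "\<rho> t \<le> Max F" for t using \<rho>F(1)[of t] F by auto
    show "Max F < 1" using Max_in[OF F(1,2)] F(3) by auto
  qed
  also have "(LINT t|circ. (g t)\<^sup>2) = 2 * pi * (\<Sum>n. (norm (c n))\<^sup>2)"
    unfolding g_def by (rule parseval_circ(1)[OF c])
  finally show ?thesis by simp
qed

text \<open>The value of the power series with coefficients \<open>a n\<close> at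
  \<open>r * cis (- t)\<close>.\<close>

definition radial :: "(nat \<Rightarrow> 'a::complex_hilbert) \<Rightarrow> real \<Rightarrow> real \<Rightarrow> 'a" where
  "radial a r t = circ_series (\<lambda>n. r ^ n *\<^sub>R a n) t"

lemma summable_radial:
  assumes a: "summable (\<lambda>n. (norm (a n))\<^sup>2)" and r: "0 \<le> r" "r < 1"
  shows "summable (\<lambda>n. norm (r ^ n *\<^sub>R a n))"
proof -
  have "norm (a n) \<le> sqrt (\<Sum>n. (norm (a n))\<^sup>2)" for n
    using sum_le_suminf[OF a, of "{n}"] by (intro real_le_rsqrt) simp
  then show ?thesis
    by (intro summable_comparison_test'[OF summable_mult2[OF summable_geometric[of r]]])
      (use r in \<open>auto intro!: mult_left_mono\<close>)
qed

text \<open>Square summable coefficients need not be absolutely summable. Damping by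
  \<open>R ^ n\<close> with \<open>Max F < R < 1\<close> makes them so, at the price of replacing
  the radii by \<open>r / R < 1\<close>. The nonnegative integral prepares for monotone
  convergence.\<close>

lemma radial_maximal:
  assumes a: "summable (\<lambda>n. (norm (a n))\<^sup>2)" and F: "finite F" "F \<subseteq> {0<..<1}" "F \<noteq> {}"
  shows "(\<integral>\<^sup>+t. (SUP r\<in>F. ennreal ((norm (radial a r t))\<^sup>2)) \<partial>circ) \<le> ennreal (512 * pi * (\<Sum>n. (norm (a n))\<^sup>2))"
proof -
  obtain R where R: "Max F < R" "R < 1" using dense[of "Max F" 1] Max_in[OF F(1,3)] F(2) by (meson greaterThanLessThan_iff subsetD)
  have R0: "0 < R" using R(1) Max_in[OF F(1,3)] F(2) by fastforce
  define c where "c n = R ^ n *\<^sub>R a n" for n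
  have c: "summable (\<lambda>n. norm (c n))" unfolding c_def by (rule summable_radial[OF a]) (use R R0 in auto)
  define F' where "F' = (\<lambda>r. r / R) ` F"
  have F': "finite F'" "F' \<noteq> {}" "F' \<subseteq> {0..<1}"
    using F R R0 by (auto simp: F'_def divide_less_eq_1 dest: Max_ge[OF F(1)])
  have rad: "radial a r t = circ_series (\<lambda>n. (r / R) ^ n *\<^sub>R c n) t" for r t
    using R0 by (simp add: radial_def c_def power_divide)
  define m where "m t = Max ((\<lambda>r. (norm (circ_series (\<lambda>n. r ^ n *\<^sub>R c n) t))\<^sup>2) ` F')" for t
  have cr: "summable (\<lambda>n. norm (r ^ n *\<^sub>R c n))" if "r \<in> F'" for r
    by (rule summable_comparison_test'[OF c])
      (use F'(3) that in \<open>auto simp: power_le_one mult_left_le_one_le\<close>)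
  have m0: "0 \<le> m t" for t
    unfolding m_def using F'(1,2) by (subst Max_ge_iff) auto
  have mi: "integrable circ m"
    unfolding m_def
  proof (rule integrable_circ_continuous)
    show "continuous_on UNIV (\<lambda>t. Max ((\<lambda>r. (norm (circ_series (\<lambda>n. r ^ n *\<^sub>R c n) t))\<^sup>2) ` F'))"
      using F'(1,2) cr
    proof (induction F' rule: finite_ne_induct)
      case (singleton x)
      then show ?case by (auto intro!: continuous_intros continuous_circ_series)
    next
      case (insert x F)
      then have "continuous_on UNIV (\<lambda>t. max ((norm (circ_series (\<lambda>n. x ^ n *\<^sub>R c n) t))\<^sup>2)
          (Max ((\<lambda>r. (norm (circ_series (\<lambda>n. r ^ n *\<^sub>R c n) t))\<^sup>2) ` F)))"
        by (intro continuous_intros continuous_circ_series) auto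
      then show ?case using insert by simp
    qed
  qed
  have "(SUP r\<in>F. ennreal ((norm (radial a r t))\<^sup>2)) \<le> ennreal (m t)" for t
  proof (rule SUP_least)
    fix r assume "r \<in> F"
    then have "(norm (radial a r t))\<^sup>2 \<le> m t"
      unfolding m_def rad using F'(1) by (intro Max_ge) (auto simp: F'_def)
    then show "ennreal ((norm (radial a r t))\<^sup>2) \<le> ennreal (m t)" by (rule ennreal_leI)
  qed
  then have "(\<integral>\<^sup>+t. (SUP r\<in>F. ennreal ((norm (radial a r t))\<^sup>2)) \<partial>circ) \<le> (\<integral>\<^sup>+t. ennreal (m t) \<partial>circ)"
    by (intro nn_integral_mono)
  also have "\<dots> = ennreal (LINT t|circ. m t)"
    by (rule nn_integral_eq_integral[OF mi]) (use m0 in auto)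
  also have "\<dots> \<le> ennreal (512 * pi * (\<Sum>n. (norm (c n))\<^sup>2))"
    unfolding m_def by (intro ennreal_leI radial_maximal_finite F' c)
  also have "\<dots> \<le> ennreal (512 * pi * (\<Sum>n. (norm (a n))\<^sup>2))"
  proof (intro ennreal_leI mult_left_mono suminf_le parseval_circ(2)[OF c] a)
    show "(norm (c n))\<^sup>2 \<le> (norm (a n))\<^sup>2" for n
      unfolding c_def using R R0 by (intro power_mono) (auto simp: power_le_one mult_left_le_one_le)
  qed (simp add: pi_ge_zero)
  finally show ?thesis .
qed

lemma continuous_radial:
  assumes a: "summable (\<lambda>n. (norm (a n))\<^sup>2)"
  shows "continuous_on {0<..<1} (\<lambda>r. radial a r t)"
proof (rule continuous_at_imp_continuous_on, rule ballI)
  fix r :: real assume r: "r \<in> {0<..<1}"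
  obtain R where R: "r < R" "R < 1" using dense[of r 1] r by auto
  have R0: "0 \<le> R" using r R by simp
  have "continuous_on {0<..<R} (\<lambda>r. radial a r t)"
    unfolding radial_def circ_series_def
  proof (rule continuous_on_suminf_bounded[OF _ _ summable_radial[OF a R0 R(2)]])
    fix n and q :: real assume "q \<in> {0<..<R}"
    then show "norm (cis (- real n * t) *\<^sub>C q ^ n *\<^sub>R a n) \<le> norm (R ^ n *\<^sub>R a n)"
      by (auto simp: norm_scaleC power_mono intro!: mult_right_mono)
  qed (intro continuous_intros)
  then show "isCont (\<lambda>r. radial a r t) r"
    using r R by (simp add: continuous_on_eq_continuous_at)
qed

lemma radial_split:
  assumes a: "summable (\<lambda>n. (norm (a n))\<^sup>2)" and r: "0 \<le> r" "r < 1"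
  shows "radial a r t = (\<Sum>n<N. cis (- real n * t) *\<^sub>C (r ^ n *\<^sub>R a n))
    + radial (\<lambda>n. if n < N then 0 else a n) r t"
proof -
  note s = summable_circ_series[OF summable_radial[OF a r], of t]
  have "(\<lambda>n. if n < N then cis (- real n * t) *\<^sub>C (r ^ n *\<^sub>R a n) else 0) sums
      (\<Sum>n<N. cis (- real n * t) *\<^sub>C (r ^ n *\<^sub>R a n))"
    using sums_If_finite_set[of "{..<N}" "\<lambda>n. cis (- real n * t) *\<^sub>C (r ^ n *\<^sub>R a n)"] by simp
  from sums_diff[OF summable_sums[OF s] this]
  have "(\<lambda>n. cis (- real n * t) *\<^sub>C (r ^ n *\<^sub>R (if n < N then 0 else a n))) sums
      (radial a r t - (\<Sum>n<N. cis (- real n * t) *\<^sub>C (r ^ n *\<^sub>R a n)))"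
    unfolding radial_def circ_series_def
    by (rule sums_cong[THEN iffD1, rotated]) simp
  then show ?thesis unfolding radial_def circ_series_def by (simp add: sums_iff)
qed

lemma tendsto_at_left_Cauchy:
  fixes f :: "real \<Rightarrow> 'a::banach"
  assumes "\<And>e. e > 0 \<Longrightarrow> \<exists>d>0. \<forall>r s. 1 - d < r \<longrightarrow> r < 1 \<longrightarrow> 1 - d < s \<longrightarrow> s < 1 \<longrightarrow> norm (f r - f s) \<le> e"
  shows "\<exists>l. (f \<longlongrightarrow> l) (at_left 1)"
proof -
  define x where "x k = 1 - 1 / real (Suc k)" for k
  have x1: "x k < 1" for k by (simp add: x_def)
  have xd: "\<exists>M. \<forall>k\<ge>M. 1 - d < x k" if d: "d > 0" for d
  proof -
    obtain M where M: "1 / real (Suc M) < d" using reals_Archimedean[OF d] by (auto simp: inverse_eq_divide)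
    have "1 / real (Suc k) \<le> 1 / real (Suc M)" if "k \<ge> M" for k
      using that by (intro divide_left_mono) auto
    with M show ?thesis unfolding x_def by (intro exI[of _ M]) fastforce
  qed
  have "Cauchy (\<lambda>k. f (x k))"
  proof (rule CauchyI)
    fix e :: real assume "e > 0"
    then obtain d where d: "d > 0" "\<And>r s. 1 - d < r \<Longrightarrow> r < 1 \<Longrightarrow> 1 - d < s \<Longrightarrow> s < 1 \<Longrightarrow> norm (f r - f s) \<le> e / 2"
      using assms[of "e / 2"] by auto
    obtain M where "\<forall>k\<ge>M. 1 - d < x k" using xd[OF d(1)] by blast
    then have "norm (f (x m) - f (x n)) \<le> e / 2" if "m \<ge> M" "n \<ge> M" for m n
      using d(2) x1 that by blast
    then show "\<exists>M. \<forall>m\<ge>M. \<forall>n\<ge>M. norm (f (x m) - f (x n)) < e"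
      using \<open>e > 0\<close> by (intro exI[of _ M]) fastforce
  qed
  then obtain l where l: "(\<lambda>k. f (x k)) \<longlonglongrightarrow> l" using Cauchy_convergent convergent_def by blast
  have "(f \<longlongrightarrow> l) (at_left 1)"
    unfolding tendsto_iff
  proof (intro allI impI)
    fix e :: real assume "e > 0"
    then obtain d where d: "d > 0" "\<And>r s. 1 - d < r \<Longrightarrow> r < 1 \<Longrightarrow> 1 - d < s \<Longrightarrow> s < 1 \<Longrightarrow> norm (f r - f s) \<le> e / 2"
      using assms[of "e / 2"] by auto
    obtain M where M: "\<forall>k\<ge>M. 1 - d < x k" using xd[OF d(1)] by blast
    have "norm (f r - l) \<le> e / 2" if "1 - d < r" "r < 1" for r
    proof (rule tendsto_upperbound)
      show "(\<lambda>k. norm (f r - f (x k))) \<longlonglongrightarrow> norm (f r - l)" by (intro tendsto_intros l)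
      show "\<forall>\<^sub>F k in sequentially. norm (f r - f (x k)) \<le> e / 2"
        unfolding eventually_sequentially using M d(2) x1 that by blast
    qed simp
    then show "\<forall>\<^sub>F r in at_left 1. dist (f r) l < e"
      using \<open>e > 0\<close> d(1) unfolding eventually_at_left_field dist_norm
      by (intro exI[of _ "1 - d"]) fastforce
  qed
  then show ?thesis by blast
qed

text \<open>The maximal function \<open>H N\<close> of the tail has integral at most a constant
  times \<open>\<tau> N\<close>, so the infimum over \<open>N\<close> vanishes almost everywhere. At
  such a point the radial function is uniformly as close as desired to a polynomial in
  \<open>r\<close>, which is continuous at 1; this is the Cauchy criterion. Rational radii keep the
  supremum countable and thus measurable.\<close>

theorem radial_limits:
  fixes a :: "nat \<Rightarrow> 'a::complex_hilbert"
  assumes a: "summable (\<lambda>n. (norm (a n))\<^sup>2)"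
  shows "AE t in circ. \<exists>l. ((\<lambda>r. radial a r t) \<longlongrightarrow> l) (at_left 1)"
proof -
  define aN where "aN N n = (if n < N then 0 else a n)" for N n
  have aN: "summable (\<lambda>n. (norm (aN N n))\<^sup>2)" for N
    by (rule summable_comparison_test'[OF a]) (simp add: aN_def)
  define \<tau> where "\<tau> N = (\<Sum>n. (norm (aN N n))\<^sup>2)" for N
  have \<tau>: "\<tau> \<longlonglongrightarrow> 0"
  proof -
    have "\<tau> N = (\<Sum>n. (norm (a (n + N)))\<^sup>2)" for N
      using suminf_split_initial_segment[OF aN[of N], of N] by (simp add: \<tau>_def aN_def)
    then show ?thesis using suminf_exist_split2[OF a] by presburger
  qed
  define Q where "Q = \<rat> \<inter> {0<..<1::real}"
  have Q: "countable Q" "Q \<noteq> {}"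
    using countable_rat countable_Int1 Rats_dense_in_real[of 0 1] by (auto simp: Q_def)
  define q where "q = from_nat_into Q"
  have q: "range q = Q" unfolding q_def using Q by (simp add: range_from_nat_into)
  define H where "H N t = (SUP k. ennreal ((norm (radial (aN N) (q k) t))\<^sup>2))" for N t
  have q01: "0 < q k" "q k < 1" for k using q by (auto simp: Q_def)
  have rm[measurable]: "(\<lambda>t. ennreal ((norm (radial (aN N) (q k) t))\<^sup>2)) \<in> borel_measurable circ" for N k
    unfolding radial_def
    by (intro measurable_compose[OF _ measurable_ennreal] continuous_measurable_circ continuous_intros
        continuous_circ_series summable_radial[OF aN]) (use q01[of k] in auto)
  have Hm[measurable]: "H N \<in> borel_measurable circ" for N unfolding H_def by measurable
  have Hint: "(\<integral>\<^sup>+t. H N t \<partial>circ) \<le> ennreal (512 * pi * \<tau> N)" for N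
  proof -
    define G where "G k t = (SUP r\<in>q ` {..k}. ennreal ((norm (radial (aN N) r t))\<^sup>2))" for k t
    have HG: "H N t = (SUP k. G k t)" for t
    proof (rule antisym)
      show "H N t \<le> (SUP k. G k t)"
        unfolding H_def
      proof (rule SUP_least)
        fix k
        have "ennreal ((norm (radial (aN N) (q k) t))\<^sup>2) \<le> G k t"
          unfolding G_def by (rule SUP_upper) auto
        then show "ennreal ((norm (radial (aN N) (q k) t))\<^sup>2) \<le> (SUP k. G k t)"
          by (rule order_trans) (rule SUP_upper, simp)
      qed
      show "(SUP k. G k t) \<le> H N t"
        unfolding H_def G_def by (intro SUP_least) (auto intro!: SUP_upper)
    qed
    have "(\<integral>\<^sup>+t. H N t \<partial>circ) = (SUP k. \<integral>\<^sup>+t. G k t \<partial>circ)"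
      unfolding HG
    proof (rule nn_integral_monotone_convergence_SUP)
      show "incseq G"
        unfolding incseq_def le_fun_def G_def by (auto intro!: SUP_subset_mono)
      show "G k \<in> borel_measurable circ" for k
        unfolding G_def image_image by measurable
    qed
    also have "\<dots> \<le> ennreal (512 * pi * \<tau> N)"
    proof (rule SUP_least)
      show "(\<integral>\<^sup>+t. G k t \<partial>circ) \<le> ennreal (512 * pi * \<tau> N)" for k
        unfolding G_def \<tau>_def by (rule radial_maximal[OF aN]) (use q01 in auto)
    qed
    finally show ?thesis .
  qed
  have "(\<integral>\<^sup>+t. (INF N. H N t) \<partial>circ) = 0"
  proof -
    have "(\<integral>\<^sup>+t. (INF N. H N t) \<partial>circ) \<le> ennreal (512 * pi * \<tau> N)" for N
      by (rule order_trans[OF nn_integral_mono Hint[of N]]) (rule INF_lower, simp)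
    moreover have "(\<lambda>N. ennreal (512 * pi * \<tau> N)) \<longlonglongrightarrow> ennreal (512 * pi * 0)"
      by (intro tendsto_ennrealI tendsto_intros \<tau>)
    ultimately have "(\<integral>\<^sup>+t. (INF N. H N t) \<partial>circ) \<le> ennreal (512 * pi * 0)"
      by (intro LIMSEQ_le_const) auto
    then show ?thesis by simp
  qed
  then have "AE t in circ. (INF N. H N t) = 0"
    by (subst (asm) nn_integral_0_iff_AE) auto
  then show ?thesis
  proof (rule AE_mp, intro AE_I2 impI)
    fix t assume t: "(INF N. H N t) = 0"
    show "\<exists>l. ((\<lambda>r. radial a r t) \<longlongrightarrow> l) (at_left 1)"
    proof (rule tendsto_at_left_Cauchy)
      fix e :: real assume e: "e > 0"
      have "(INF N. H N t) < ennreal ((e / 3)\<^sup>2)" using t e by simp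
      then obtain N where N: "H N t < ennreal ((e / 3)\<^sup>2)" by (auto simp: INF_less_iff)
      have small_q: "norm (radial (aN N) r t) < e / 3" if rQ: "r \<in> Q" for r
      proof -
        obtain k where "r = q k" using rQ q by blast
        then have "ennreal ((norm (radial (aN N) r t))\<^sup>2) \<le> H N t" unfolding H_def by (auto intro: SUP_upper)
        then have "ennreal ((norm (radial (aN N) r t))\<^sup>2) < ennreal ((e / 3)\<^sup>2)" using N by (rule le_less_trans)
        then have "(norm (radial (aN N) r t))\<^sup>2 < (e / 3)\<^sup>2"
          by (simp only: ennreal_less_iff[OF zero_le_power2])
        then show ?thesis by (rule power2_less_imp_less) (use e in simp)
      qed
      \<comment> \<open>Continuity in \<open>r\<close> carries the bound from rational radii to all
        radii.\<close>
      have small: "norm (radial (aN N) r t) \<le> e / 3" if r: "0 < r" "r < 1" for r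
      proof (rule ccontr)
        assume "\<not> ?thesis"
        then have gt: "norm (radial (aN N) r t) > e / 3" by simp
        have "isCont (\<lambda>r. norm (radial (aN N) r t)) r"
          using continuous_radial[OF aN[of N], of t] r
          by (auto simp: continuous_on_eq_continuous_at intro!: continuous_intros)
        then have "\<forall>\<^sub>F s in at r. norm (radial (aN N) s t) > e / 3"
          unfolding isCont_def by (rule order_tendstoD(1)) (rule gt)
        moreover have "\<forall>\<^sub>F s in at r. s \<in> {0<..<1}"
          by (rule eventually_at_in_open') (use r in auto)
        ultimately have "\<forall>\<^sub>F s in at r. norm (radial (aN N) s t) > e / 3 \<and> s \<in> {0<..<1}"
          by (rule eventually_conj)
        then obtain d where d: "d > 0"
          "\<And>s. s \<noteq> r \<Longrightarrow> dist s r < d \<Longrightarrow> norm (radial (aN N) s t) > e / 3 \<and> s \<in> {0<..<1}"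
          unfolding eventually_at by blast
        obtain s where s: "s \<in> \<rat>" "r < s" "s < r + d" using Rats_dense_in_real[of r "r + d"] d(1) by auto
        then have "dist s r < d" by (simp add: dist_real_def)
        with d(2)[of s] s(1,2) small_q[of s] show False by (auto simp: Q_def)
      qed
      define P where "P r = (\<Sum>n<N. cis (- real n * t) *\<^sub>C (r ^ n *\<^sub>R a n))" for r :: real
      have "isCont P 1" 
      proof -
        have "continuous_on UNIV P" unfolding P_def by (intro continuous_intros)
        then show ?thesis by (simp add: continuous_on_eq_continuous_at)
      qed
      then obtain d where d: "d > 0" "\<And>r. dist r 1 < d \<Longrightarrow> dist (P r) (P 1) < e / 6"
        unfolding continuous_at_eps_delta using e by (metis divide_pos_pos zero_less_numeral)
      have split: "radial a r t = P r + radial (aN N) r t" if "0 < r" "r < 1" for r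
        using radial_split[OF a, of r t N] that by (simp add: P_def aN_def[abs_def])
      have "norm (radial a r t - radial a s t) \<le> e"
        if "1 - min d 1 < r" "r < 1" "1 - min d 1 < s" "s < 1" for r s
      proof -
        have rs: "0 < r" "0 < s" "dist r 1 < d" "dist s 1 < d" using that by (auto simp: dist_real_def)
        have "norm (radial a r t - radial a s t)
            = norm ((P r - P 1) - (P s - P 1) + radial (aN N) r t - radial (aN N) s t)"
          using split that rs by (simp add: algebra_simps)
        also have "\<dots> \<le> norm (P r - P 1) + norm (P s - P 1) + norm (radial (aN N) r t) + norm (radial (aN N) s t)"
          by (smt (verit) norm_triangle_ineq norm_triangle_ineq4)
        also have "\<dots> \<le> e / 6 + e / 6 + e / 3 + e / 3"
          using d(2)[OF rs(3)] d(2)[OF rs(4)] small[of r] small[of s] rs that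
          by (intro add_mono) (auto simp: dist_norm)
        finally show ?thesis by simp
      qed
      then show "\<exists>d>0. \<forall>r s. 1 - d < r \<longrightarrow> r < 1 \<longrightarrow> 1 - d < s \<longrightarrow> s < 1 \<longrightarrow>
          norm (radial a r t - radial a s t) \<le> e"
        using d(1) by (intro exI[of _ "min d 1"]) auto
    qed
  qed
qed

subsection \<open>Jensen's inequality and the Szego bound\<close>

text \<open>Mean value property: the integrand is the real part of a convergent logarithm series
  without constant term.\<close>

lemma integral_circ_ln_norm_small:
  assumes b: "cmod b < 1"
  shows "(LINT t|circ. ln (cmod (1 - b * cis (- t)))) = 0"
proof -
  \<comment> \<open>At \<open>n = 0\<close> division by zero gives 0, which is the correct constant
    term of the logarithm.\<close>
  define a where "a n = - (b ^ n) / of_nat n" for n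
  have sa: "summable (\<lambda>n. norm (a n))"
  proof (rule summable_comparison_test'[OF summable_geometric[of "cmod b"], of 1])
    fix n :: nat assume "n \<ge> 1"
    then have "cmod b ^ n / real n \<le> cmod b ^ n / 1" by (intro divide_left_mono) auto
    then show "norm (norm (a n)) \<le> cmod b ^ n" by (simp add: a_def norm_divide norm_power)
  qed (use b in simp)
  have eq: "ln (cmod (1 - b * cis (- t))) = Re (circ_series a t)" for t
  proof -
    define z where "z = - (b * cis (- t))"
    have z: "cmod z < 1" using b by (simp add: z_def norm_mult)
    have "(\<lambda>n. (-1) ^ Suc n / of_nat n * z ^ n) sums ln (1 + z)" by (rule Ln_series[OF z])
    moreover have "(-1) ^ Suc n / of_nat n * z ^ n = cis (- real n * t) *\<^sub>C a n" for n
    proof -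
      have "z ^ n = (-1) ^ n * (b ^ n * cis (- real n * t))"
        unfolding z_def power_minus[of "b * cis (- t)"] power_mult_distrib Complex.DeMoivre by simp
      moreover have "(-1) ^ Suc n * (-1) ^ n = (- 1 :: complex)" by (simp flip: power_add)
      ultimately show ?thesis by (simp add: scaleC_complex_def a_def field_simps)
    qed
    ultimately have "circ_series a t = ln (1 + z)" by (simp add: circ_series_def sums_iff)
    moreover have "1 + z \<noteq> 0" using z by (metis add_eq_0_iff less_irrefl norm_minus_cancel norm_one)
    ultimately show ?thesis by (simp add: z_def)
  qed
  have "(LINT t|circ. ln (cmod (1 - b * cis (- t)))) = Re (LINT t|circ. circ_series a t)"
    unfolding eq by (rule integral_Re[OF integrable_circ_continuous[OF continuous_circ_series[OF sa]]])
  also have "(LINT t|circ. circ_series a t) = 0"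
  proof -
    have "a 0 = 0" by (simp add: a_def)
    then show ?thesis using integral_circ_series_coeff[OF sa, of 0] by simp
  qed
  finally show ?thesis by simp
qed

text \<open>For a root inside the disc,
  \<open>|cis (- t) - \<alpha>| = |1 - cnj \<alpha> * cis (- t)|\<close> and the mean is 0; for a
  root outside, \<open>\<alpha>\<close> factors out and contributes
  \<open>ln |\<alpha>| > 0\<close>.\<close>

lemma integral_circ_ln_linear_nonneg:
  assumes "cmod \<alpha> \<noteq> 1"
  shows "0 \<le> (LINT t|circ. ln (cmod (cis (- t) - \<alpha>)))"
proof (cases "cmod \<alpha> < 1")
  case True
  have "cmod (cis (- t) - \<alpha>) = cmod (1 - cnj \<alpha> * cis (- t))" for t
  proof -
    have "cmod (cis (- t) - \<alpha>) = cmod (cis t * (cis (- t) - \<alpha>))" by (simp add: norm_mult)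
    also have "cis t * (cis (- t) - \<alpha>) = cnj (1 - cnj \<alpha> * cis (- t))"
      by (simp add: cis_mult cis_cnj algebra_simps)
    finally show ?thesis by (simp only: complex_mod_cnj)
  qed
  then show ?thesis using integral_circ_ln_norm_small[of "cnj \<alpha>"] True by simp
next
  case False
  then have a: "cmod \<alpha> > 1" using assms by simp
  have eq: "ln (cmod (cis (- t) - \<alpha>)) = ln (cmod \<alpha>) + ln (cmod (1 - inverse \<alpha> * cis (- t)))" for t
  proof -
    have "cis (- t) \<noteq> \<alpha>" using a by (metis less_irrefl norm_cis)
    then have n: "1 - inverse \<alpha> * cis (- t) \<noteq> 0" using a by (auto simp: field_simps)
    have "cis (- t) - \<alpha> = - \<alpha> * (1 - inverse \<alpha> * cis (- t))" using a by (auto simp: field_simps)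
    then have "cmod (cis (- t) - \<alpha>) = cmod \<alpha> * cmod (1 - inverse \<alpha> * cis (- t))"
      by (simp only: norm_mult norm_minus_cancel)
    then show ?thesis using n a by (simp add: ln_mult)
  qed
  have i: "integrable circ (\<lambda>t. ln (cmod (1 - inverse \<alpha> * cis (- t))))"
  proof (intro integrable_circ_continuous continuous_intros)
    show "\<forall>t\<in>UNIV. cmod (1 - inverse \<alpha> * cis (- t)) \<noteq> 0"
    proof
      fix t
      have "cis (- t) \<noteq> \<alpha>" using a by (metis less_irrefl norm_cis)
      then show "cmod (1 - inverse \<alpha> * cis (- t)) \<noteq> 0" using a by (auto simp: field_simps)
    qed
  qed
  have "cmod (inverse \<alpha>) < 1" using a by (simp add: norm_inverse inverse_less_1_iff)
  then have "(LINT t|circ. ln (cmod (cis (- t) - \<alpha>))) = 2 * pi * ln (cmod \<alpha>)"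
    unfolding eq using i integral_circ_ln_norm_small[of "inverse \<alpha>"] by simp
  then show ?thesis using a by simp
qed

lemma continuous_on_poly_cis: "continuous_on UNIV (\<lambda>t. poly q (cis (- t)))"
  by (intro continuous_intros)

text \<open>Each linear factor has a nonnegative logarithmic mean, so only the leading coefficient
  is left. It takes the place usually held by the value at the origin, because
  \<open>szego_bound\<close> lists its coefficients in reverse order.\<close>

lemma jensen_polynomial:
  fixes q :: "complex poly"
  assumes "q \<noteq> 0" "\<And>z. cmod z = 1 \<Longrightarrow> poly q z \<noteq> 0"
  shows "2 * pi * ln (cmod (lead_coeff q)) \<le> (LINT t|circ. ln (cmod (poly q (cis (- t)))))"
  using assms
proof (induction "degree q" arbitrary: q)
  case 0
  then obtain c where "q = [:c:]" by (metis degree_eq_zeroE)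
  then show ?case by simp
next
  case (Suc n)
  obtain \<alpha> where \<alpha>: "poly q \<alpha> = 0"
    using fundamental_theorem_of_algebra[of q] constant_degree[of q] Suc.hyps(2) by auto
  then obtain p where q: "q = [:- \<alpha>, 1:] * p" by (metis dvdE poly_eq_0_iff_dvd)
  have p0: "p \<noteq> 0" using Suc.prems(1) q by auto
  have deg: "n = degree p" using Suc.hyps(2) p0 unfolding q by (subst (asm) degree_mult_eq) auto
  have \<alpha>1: "cmod \<alpha> \<noteq> 1" using Suc.prems(2)[of \<alpha>] \<alpha> by blast
  have pn: "poly p z \<noteq> 0" if "cmod z = 1" for z using Suc.prems(2)[OF that] by (simp add: q)
  have IH: "2 * pi * ln (cmod (lead_coeff p)) \<le> (LINT t|circ. ln (cmod (poly p (cis (- t)))))"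
    by (rule Suc.hyps(1)[OF deg p0 pn])
  have nz: "cis (- t) - \<alpha> \<noteq> 0" for t using \<alpha>1 by auto
  have eq: "ln (cmod (poly q (cis (- t)))) = ln (cmod (cis (- t) - \<alpha>)) + ln (cmod (poly p (cis (- t))))" for t
  proof -
    have "poly q (cis (- t)) = (cis (- t) - \<alpha>) * poly p (cis (- t))" by (simp add: q algebra_simps)
    then show ?thesis using nz[of t] pn[of "cis (- t)"] by (simp add: norm_mult ln_mult)
  qed
  have i: "integrable circ (\<lambda>t. ln (cmod (cis (- t) - \<alpha>)))"
    "integrable circ (\<lambda>t. ln (cmod (poly p (cis (- t)))))"
    using nz pn by (intro integrable_circ_continuous continuous_intros; simp)+
  have "lead_coeff q = lead_coeff p" unfolding q lead_coeff_mult by simp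
  then show ?case
    unfolding eq using i IH integral_circ_ln_linear_nonneg[OF \<alpha>1] by simp
qed

text \<open>Jensen's inequality for \<open>exp\<close>, through the tangent line at the mean
  \<open>m\<close> of \<open>l + 2 ln |q|\<close>; the bound \<open>exp l \<le> 1\<close> makes the
  right-hand side integrable.\<close>

lemma weighted_jensen_no_unimodular_roots:
  fixes q :: "complex poly"
  assumes l: "integrable circ l" and w: "AE t in circ. exp (l t) \<le> 1"
    and q: "q \<noteq> 0" "\<And>z. cmod z = 1 \<Longrightarrow> poly q z \<noteq> 0"
  shows "2 * pi * exp ((LINT t|circ. l t) / (2 * pi)) * (cmod (lead_coeff q))\<^sup>2
    \<le> (LINT t|circ. exp (l t) * (cmod (poly q (cis (- t))))\<^sup>2)"
proof -
  have lm[measurable]: "l \<in> borel_measurable circ" using l by (rule borel_measurable_integrable)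
  define u where "u t = ln (cmod (poly q (cis (- t))))" for t
  have nz: "poly q (cis (- t)) \<noteq> 0" for t by (rule q(2)) simp
  have ui: "integrable circ u"
    unfolding u_def using nz by (intro integrable_circ_continuous continuous_intros) simp
  define m where "m = (LINT t|circ. l t + 2 * u t) / (2 * pi)"
  have yi: "integrable circ (\<lambda>t. l t + 2 * u t)" using l ui by simp
  have e: "exp (l t) * (cmod (poly q (cis (- t))))\<^sup>2 = exp (l t + 2 * u t)" for t
  proof -
    have "exp (l t + 2 * u t) = exp (l t) * (exp (u t) * exp (u t))"
      by (simp only: exp_add mult_2)
    also have "exp (u t) = cmod (poly q (cis (- t)))" unfolding u_def using nz[of t] by (intro exp_ln) simp
    finally show ?thesis by (simp only: power2_eq_square)
  qed
  have cq: "continuous_on UNIV (\<lambda>t. (cmod (poly q (cis (- t))))\<^sup>2)"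
    by (intro continuous_on_power continuous_on_norm continuous_on_poly_cis)
  have ei: "integrable circ (\<lambda>t. exp (l t + 2 * u t))"
  proof (rule Bochner_Integration.integrable_bound[OF integrable_circ_continuous[OF cq]])
    show "(\<lambda>t. exp (l t + 2 * u t)) \<in> borel_measurable circ"
      using borel_measurable_integrable[OF yi] by measurable
    show "AE t in circ. norm (exp (l t + 2 * u t)) \<le> norm ((cmod (poly q (cis (- t))))\<^sup>2)"
      using w
    proof (rule AE_mp, intro AE_I2 impI)
      fix t assume "exp (l t) \<le> 1"
      then have "exp (l t) * (cmod (poly q (cis (- t))))\<^sup>2 \<le> 1 * (cmod (poly q (cis (- t))))\<^sup>2"
        by (intro mult_right_mono) auto
      then have "exp (l t + 2 * u t) \<le> (cmod (poly q (cis (- t))))\<^sup>2" by (simp only: e mult_1)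
      then show "norm (exp (l t + 2 * u t)) \<le> norm ((cmod (poly q (cis (- t))))\<^sup>2)"
        by (simp only: real_norm_def abs_exp_cancel abs_power2)
    qed
  qed
  have "2 * pi * exp ((LINT t|circ. l t) / (2 * pi)) * (cmod (lead_coeff q))\<^sup>2 \<le> 2 * pi * exp m"
  proof -
    have "(LINT t|circ. l t) + 2 * (2 * pi * ln (cmod (lead_coeff q))) \<le> (LINT t|circ. l t + 2 * u t)"
      using jensen_polynomial[OF q] l ui by (simp flip: u_def)
    then have "((LINT t|circ. l t) + 2 * (2 * pi * ln (cmod (lead_coeff q)))) / (2 * pi) \<le> m"
      unfolding m_def by (intro divide_right_mono) auto
    then have "(LINT t|circ. l t) / (2 * pi) + 2 * ln (cmod (lead_coeff q)) \<le> m"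
      by (simp add: add_divide_distrib)
    then have "exp ((LINT t|circ. l t) / (2 * pi) + 2 * ln (cmod (lead_coeff q))) \<le> exp m" by simp
    moreover have "exp ((LINT t|circ. l t) / (2 * pi) + 2 * ln (cmod (lead_coeff q)))
        = exp ((LINT t|circ. l t) / (2 * pi)) * (cmod (lead_coeff q))\<^sup>2"
    proof -
      have "exp (ln (cmod (lead_coeff q))) = cmod (lead_coeff q)" using q(1) by (intro exp_ln) simp
      then show ?thesis
        by (simp only: exp_add mult_2[of "ln (cmod (lead_coeff q))"] power2_eq_square)
    qed
    ultimately show ?thesis by simp
  qed
  also have "2 * pi * exp m = (LINT t|circ. exp m * (1 + (l t + 2 * u t) - m))"
    using yi by (simp add: m_def)
  also have "\<dots> \<le> (LINT t|circ. exp (l t + 2 * u t))"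
  proof (rule integral_mono[OF _ ei])
    fix t
    have "exp m * (1 + (l t + 2 * u t - m)) \<le> exp m * exp (l t + 2 * u t - m)"
      by (intro mult_left_mono exp_ge_add_one_self) simp
    then show "exp m * (1 + (l t + 2 * u t) - m) \<le> exp (l t + 2 * u t)"
      by (simp add: exp_diff algebra_simps)
  qed (use yi in simp)
  finally show ?thesis by (simp add: e)
qed

lemma one_minus_inverse_tendsto: "(\<lambda>k. 1 - 1 / real (k + 2)) \<longlonglongrightarrow> 1"
proof -
  have "(\<lambda>k. 1 - 1 / real (k + 2)) \<longlonglongrightarrow> 1 - 0"
    by (intro tendsto_intros LIMSEQ_ignore_initial_segment lim_1_over_n)
  then show ?thesis by simp
qed

text \<open>Roots on the circle are removed by dilation: \<open>q (\<rho> z)\<close> has a root of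
  modulus 1 only if \<open>\<rho>\<close> is the modulus of a root of \<open>q\<close>, which
  happens for finitely many \<open>k\<close>. The inequality then survives the limit by dominated
  convergence.\<close>

lemma weighted_jensen:
  fixes q :: "complex poly"
  assumes l: "integrable circ l" and w: "AE t in circ. exp (l t) \<le> 1" and q: "q \<noteq> 0"
  shows "2 * pi * exp ((LINT t|circ. l t) / (2 * pi)) * (cmod (lead_coeff q))\<^sup>2
    \<le> (LINT t|circ. exp (l t) * (cmod (poly q (cis (- t))))\<^sup>2)"
proof -
  have lm[measurable]: "l \<in> borel_measurable circ" using l by (rule borel_measurable_integrable)
  define \<rho> where "\<rho> k = 1 - 1 / real (k + 2)" for k
  have \<rho>: "0 < \<rho> k" "\<rho> k < 1" for k by (auto simp: \<rho>_def)
  have \<rho>lim: "\<rho> \<longlonglongrightarrow> 1"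
    unfolding \<rho>_def by (rule one_minus_inverse_tendsto)
  define qk where "qk k = pcompose q [:0, complex_of_real (\<rho> k):]" for k
  have pq: "poly (qk k) z = poly q (complex_of_real (\<rho> k) * z)" for k and z :: complex by (simp add: qk_def poly_pcompose mult.commute)
  have nz: "qk k \<noteq> 0" for k
    using q \<rho>(1)[of k] by (simp add: qk_def pcompose_eq_0_iff)
  have lead: "lead_coeff (qk k) = lead_coeff q * \<rho> k ^ degree q" for k
    unfolding qk_def using \<rho>(1)[of k] by (subst lead_coeff_comp) auto
  have "finite {k. \<rho> k \<in> cmod ` {z. poly q z = 0}}"
  proof (rule finite_vimageI[unfolded vimage_def])
    show "finite (cmod ` {z. poly q z = 0})" using poly_roots_finite[OF q] by simp
    show "inj \<rho>" by (auto simp: inj_def \<rho>_def)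
  qed
  then have "\<forall>\<^sub>F k in sequentially. k \<notin> {k. \<rho> k \<in> cmod ` {z. poly q z = 0}}"
    unfolding eventually_sequentially finite_nat_set_iff_bounded by (meson not_le)
  then have "\<forall>\<^sub>F k in sequentially. 2 * pi * exp ((LINT t|circ. l t) / (2 * pi)) * (cmod (lead_coeff (qk k)))\<^sup>2
      \<le> (LINT t|circ. exp (l t) * (cmod (poly (qk k) (cis (- t))))\<^sup>2)"
  proof eventually_elim
    case (elim k)
    show ?case
    proof (rule weighted_jensen_no_unimodular_roots[OF l w nz])
      fix z assume z: "cmod z = 1"
      have "cmod (\<rho> k * z) = \<rho> k" using z \<rho>(1)[of k] by (simp add: norm_mult)
      then have "poly q (\<rho> k * z) = 0 \<Longrightarrow> \<rho> k \<in> cmod ` {z. poly q z = 0}"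
        by (intro image_eqI[of _ _ "\<rho> k * z"]) auto
      then have "poly q (\<rho> k * z) \<noteq> 0" using elim by blast
      then show "poly (qk k) z \<noteq> 0" by (simp only: pq not_False_eq_True)
    qed
  qed
  moreover have "(\<lambda>k. 2 * pi * exp ((LINT t|circ. l t) / (2 * pi)) * (cmod (lead_coeff (qk k)))\<^sup>2)
      \<longlonglongrightarrow> 2 * pi * exp ((LINT t|circ. l t) / (2 * pi)) * (cmod (lead_coeff q * complex_of_real (1 ^ degree q)))\<^sup>2"
    unfolding lead by (intro tendsto_intros \<rho>lim)
  moreover have "(\<lambda>k. LINT t|circ. exp (l t) * (cmod (poly (qk k) (cis (- t))))\<^sup>2)
      \<longlonglongrightarrow> (LINT t|circ. exp (l t) * (cmod (poly q (cis (- t))))\<^sup>2)"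
  proof -
    have "compact (poly q ` cball 0 1)"
      by (intro compact_continuous_image continuous_on_poly continuous_on_id compact_cball)
    then obtain C where C: "\<And>z. z \<in> cball 0 1 \<Longrightarrow> cmod (poly q z) \<le> C"
      using bounded_pos compact_imp_bounded by (metis imageI)
    show ?thesis
    proof (rule integral_dominated_convergence[where w = "\<lambda>_. C\<^sup>2"])
      have [measurable]: "(\<lambda>t. cmod (poly q (cis (- t)))) \<in> borel_measurable circ"
        "(\<lambda>t. cmod (poly (qk k) (cis (- t)))) \<in> borel_measurable circ" for k
        by (intro continuous_measurable_circ continuous_intros)+
      show "(\<lambda>t. exp (l t) * (cmod (poly q (cis (- t))))\<^sup>2) \<in> borel_measurable circ"
        "\<And>k. (\<lambda>t. exp (l t) * (cmod (poly (qk k) (cis (- t))))\<^sup>2) \<in> borel_measurable circ"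
        by measurable
      show "AE t in circ. (\<lambda>k. exp (l t) * (cmod (poly (qk k) (cis (- t))))\<^sup>2)
          \<longlonglongrightarrow> exp (l t) * (cmod (poly q (cis (- t))))\<^sup>2"
      proof (intro AE_I2)
        fix t
        have "(\<lambda>k. exp (l t) * (cmod (poly q (\<rho> k * cis (- t))))\<^sup>2)
          \<longlonglongrightarrow> exp (l t) * (cmod (poly q (complex_of_real 1 * cis (- t))))\<^sup>2"
          by (intro tendsto_intros \<rho>lim)
        then show "(\<lambda>k. exp (l t) * (cmod (poly (qk k) (cis (- t))))\<^sup>2)
          \<longlonglongrightarrow> exp (l t) * (cmod (poly q (cis (- t))))\<^sup>2" by (simp add: pq)
      qed
      show "AE t in circ. norm (exp (l t) * (cmod (poly (qk k) (cis (- t))))\<^sup>2) \<le> C\<^sup>2" for k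
        using w
      proof (rule AE_mp, intro AE_I2 impI)
        fix t assume le: "exp (l t) \<le> 1"
        have "cmod (poly (qk k) (cis (- t))) \<le> C"
          unfolding pq using \<rho>[of k] by (intro C) (auto simp: norm_mult)
        then have "(cmod (poly (qk k) (cis (- t))))\<^sup>2 \<le> C\<^sup>2" by (intro power_mono) auto
        with le have "exp (l t) * (cmod (poly (qk k) (cis (- t))))\<^sup>2 \<le> 1 * C\<^sup>2" by (intro mult_mono) auto
        then show "norm (exp (l t) * (cmod (poly (qk k) (cis (- t))))\<^sup>2) \<le> C\<^sup>2" by simp
      qed
    qed simp
  qed
  ultimately show ?thesis
    by (intro tendsto_le[OF sequentially_bot]) auto
qed


text \<open>With \<open>a j = 0\<close> for negative \<open>j\<close>, the numbers \<open>\<Sum>j\<le>d. x j * a (m - d + j)\<close> are the Fourier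
  coefficients of \<open>x\<close> times the boundary function of \<open>a\<close>, shifted by \<open>d\<close>.\<close>

lemma szego_bound:
  fixes a :: "nat \<Rightarrow> 'a::complex_hilbert" and x :: "nat \<Rightarrow> complex" and d M :: nat
  assumes a: "summable (\<lambda>n. (norm (a n))\<^sup>2)" and a1: "\<And>r t. 0 < r \<Longrightarrow> r < 1 \<Longrightarrow> norm (radial a r t) \<le> 1"
    and l: "integrable circ l"
    and lim: "AE t in circ. \<exists>y. ((\<lambda>r. radial a r t) \<longlongrightarrow> y) (at_left 1) \<and> exp (l t) = 1 - (norm y)\<^sup>2"
  defines "h \<equiv> \<lambda>m. \<Sum>j\<le>d. x j *\<^sub>C (if d \<le> m + j then a (m + j - d) else 0)"
  shows "(\<Sum>m<M. (norm (h m))\<^sup>2) \<le> (\<Sum>j\<le>d. (cmod (x j))\<^sup>2) - exp ((LINT t|circ. l t) / (2 * pi)) * (cmod (x 0))\<^sup>2"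
proof -
  have lm[measurable]: "l \<in> borel_measurable circ" using l by (rule borel_measurable_integrable)
  \<comment> \<open>Reversing the coefficients gives \<open>Q t = cis (- d * t) * p (cis t)\<close>
    for the polynomial \<open>p\<close> with coefficients \<open>x j\<close>. So
    \<open>|Q| = |p|\<close> on the circle, \<open>Q\<close> has the one-sided form of
    \<open>circ_series\<close>, and \<open>x 0\<close> becomes the leading coefficient.\<close>
  define q where "q = (\<Sum>j\<le>d. monom (x j) (d - j))"
  define Q where "Q t = poly q (cis (- t))" for t
  have Q: "Q t = (\<Sum>j\<le>d. cis (- real (d - j) * t) * x j)" for t
    by (simp add: Q_def q_def poly_sum poly_monom Complex.DeMoivre mult.commute del: of_nat_diff)
  have Qc: "continuous_on UNIV Q" unfolding Q_def by (rule continuous_on_poly_cis)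
  define C where "C = (\<Sum>j\<le>d. cmod (x j))"
  have QC: "cmod (Q t) \<le> C" for t
    unfolding Q C_def by (rule order_trans[OF norm_sum]) (simp add: norm_mult)
  define c where "c = (\<lambda>n. if n \<le> d then x (d - n) else 0)"
  have csum: "summable (\<lambda>n. norm (c n))"
    by (rule summable_finite[of "{..d}"]) (auto simp: c_def)
  have Qs: "Q t = circ_series c t" for t
  proof -
    have "(\<lambda>n. cis (- real n * t) *\<^sub>C c n) sums (\<Sum>n\<le>d. cis (- real n * t) *\<^sub>C c n)"
      by (rule sums_finite) (auto simp: c_def)
    then have "circ_series c t = (\<Sum>n\<le>d. cis (- real n * t) * x (d - n))"
      by (simp add: circ_series_def sums_iff c_def scaleC_complex_def)
    also have "\<dots> = (\<Sum>j\<le>d. cis (- real (d - j) * t) * x j)"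
      by (rule sum.reindex_bij_witness[of _ "\<lambda>j. d - j" "\<lambda>j. d - j"]) auto
    finally show ?thesis by (simp add: Q)
  qed
  have Q2: "(LINT t|circ. (cmod (Q t))\<^sup>2) = 2 * pi * (\<Sum>j\<le>d. (cmod (x j))\<^sup>2)"
  proof -
    have "(\<lambda>n. (cmod (c n))\<^sup>2) sums (\<Sum>n\<le>d. (cmod (c n))\<^sup>2)"
      by (rule sums_finite) (auto simp: c_def)
    then have "(\<Sum>n. (cmod (c n))\<^sup>2) = (\<Sum>n\<le>d. (cmod (x (d - n)))\<^sup>2)"
      by (simp add: sums_iff c_def)
    also have "\<dots> = (\<Sum>j\<le>d. (cmod (x j))\<^sup>2)"
      by (rule sum.reindex_bij_witness[of _ "\<lambda>j. d - j" "\<lambda>j. d - j"]) auto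
    finally show ?thesis unfolding Qs parseval_circ(1)[OF csum] by simp
  qed
  have w1: "AE t in circ. exp (l t) \<le> 1"
    using lim
  proof (rule AE_mp, intro AE_I2 impI)
    fix t assume "\<exists>y. ((\<lambda>r. radial a r t) \<longlongrightarrow> y) (at_left 1) \<and> exp (l t) = 1 - (norm y)\<^sup>2"
    then obtain y :: 'a where "exp (l t) = 1 - (norm y)\<^sup>2" by blast
    then show "exp (l t) \<le> 1" using zero_le_power2[of "norm y"] by linarith
  qed
  have lower: "2 * pi * exp ((LINT t|circ. l t) / (2 * pi)) * (cmod (x 0))\<^sup>2
      \<le> (LINT t|circ. exp (l t) * (cmod (Q t))\<^sup>2)"
  proof (cases "x 0 = 0")
    case True
    then show ?thesis by simp
  next
    case False
    have cf: "coeff q n = (if n \<le> d then x (d - n) else 0)" for n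
    proof -
      have "coeff q n = (\<Sum>j\<le>d. if d - j = n then x j else 0)" by (simp add: q_def coeff_sum)
      also have "\<dots> = (\<Sum>j\<le>d. if j = d - n then (if n \<le> d then x j else 0) else 0)"
        by (intro sum.cong) auto
      finally show ?thesis by simp
    qed
    have "degree q = d"
      by (rule antisym[OF degree_le le_degree]) (use False in \<open>auto simp: cf\<close>)
    then have lead: "lead_coeff q = x 0" and "q \<noteq> 0" using cf[of d] False by auto
    show ?thesis using weighted_jensen[OF l w1 \<open>q \<noteq> 0\<close>] lead unfolding Q_def by simp
  qed
  define hr where "hr r m = (\<Sum>j\<le>d. x j *\<^sub>C (if d \<le> m + j then r ^ (m + j - d) *\<^sub>R a (m + j - d) else 0))" for r :: real and m
  \<comment> \<open>The numbers \<open>hr r m\<close> are the coefficients of \<open>Q\<close> times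
    \<open>radial a r\<close>, so this is Parseval; keeping only \<open>M\<close> of them makes the
    limit \<open>r \<rightarrow> 1\<close> a limit of a finite sum.\<close>
  have part: "2 * pi * (\<Sum>m<M. (norm (hr r m))\<^sup>2) \<le> (LINT t|circ. (cmod (Q t))\<^sup>2 * (norm (radial a r t))\<^sup>2)"
    if r: "0 < r" "r < 1" for r
  proof -
    define b where "b n = r ^ n *\<^sub>R a n" for n
    have b: "summable (\<lambda>n. norm (b n))" unfolding b_def using summable_radial[OF a] r by simp
    define bs where "bs k m = (if k \<le> m then b (m - k) else 0)" for k m
    have bss: "(\<lambda>m. cis (- real m * t) *\<^sub>C bs k m) sums (cis (- real k * t) *\<^sub>C radial a r t)"
      and bsn: "summable (\<lambda>m. norm (bs k m))" for k t
    proof -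
      have "(\<lambda>n. cis (- real n * t) *\<^sub>C b n) sums radial a r t"
        unfolding radial_def circ_series_def b_def[symmetric] by (rule summable_sums[OF summable_circ_series[OF b]])
      then have "(\<lambda>n. cis (- real k * t) *\<^sub>C (cis (- real n * t) *\<^sub>C b n)) sums (cis (- real k * t) *\<^sub>C radial a r t)"
        by (rule bounded_linear.sums[OF bounded_linear_scaleC_right])
      moreover have "cis (- real k * t) *\<^sub>C (cis (- real n * t) *\<^sub>C b n) = cis (- real (n + k) * t) *\<^sub>C bs k (n + k)" for n
        unfolding scaleC_scaleC cis_mult by (simp add: bs_def algebra_simps)
      ultimately have "(\<lambda>n. cis (- real (n + k) * t) *\<^sub>C bs k (n + k)) sums (cis (- real k * t) *\<^sub>C radial a r t)"
        by simp
      then show "(\<lambda>m. cis (- real m * t) *\<^sub>C bs k m) sums (cis (- real k * t) *\<^sub>C radial a r t)"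
        by (subst (asm) sums_iff_shift) (simp add: bs_def)
      have "summable (\<lambda>m. norm (bs k (m + k)))" using b by (simp add: bs_def)
      then show "summable (\<lambda>m. norm (bs k m))" by (subst (asm) summable_iff_shift)
    qed
    have hrb: "hr r m = (\<Sum>j\<le>d. x j *\<^sub>C bs (d - j) m)" for m
      unfolding hr_def bs_def b_def by (intro sum.cong refl) (auto simp: le_diff_conv add.commute intro!: arg_cong[where f = "\<lambda>y. x _ *\<^sub>C y"])
    have hrn: "summable (\<lambda>m. norm (hr r m))"
    proof (rule summable_comparison_test')
      show "summable (\<lambda>m. \<Sum>j\<le>d. cmod (x j) * norm (bs (d - j) m))"
        by (intro summable_sum summable_mult bsn)
      show "norm (norm (hr r m)) \<le> (\<Sum>j\<le>d. cmod (x j) * norm (bs (d - j) m))" for m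
        unfolding hrb using norm_sum[of "\<lambda>j. x j *\<^sub>C bs (d - j) m" "{..d}"] by (simp add: norm_scaleC)
    qed
    have "circ_series (hr r) t = Q t *\<^sub>C radial a r t" for t
    proof -
      have "(\<lambda>m. \<Sum>j\<le>d. x j *\<^sub>C (cis (- real m * t) *\<^sub>C bs (d - j) m)) sums
          (\<Sum>j\<le>d. x j *\<^sub>C (cis (- real (d - j) * t) *\<^sub>C radial a r t))"
        by (intro sums_sum bounded_linear.sums[OF bounded_linear_scaleC_right] bss)
      moreover have "(\<Sum>j\<le>d. x j *\<^sub>C (cis (- real m * t) *\<^sub>C bs (d - j) m)) = cis (- real m * t) *\<^sub>C hr r m" for m
        by (simp add: hrb scaleC_sum_right scaleC_scaleC mult.commute)
      moreover have "(\<Sum>j\<le>d. x j *\<^sub>C (cis (- real (d - j) * t) *\<^sub>C radial a r t)) = Q t *\<^sub>C radial a r t"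
        unfolding Q by (simp add: scaleC_scaleC mult.commute
            linear_sum[OF bounded_linear.linear[OF bounded_linear_scaleC_left]])
      ultimately show ?thesis by (simp add: circ_series_def sums_iff)
    qed
    then have "(LINT t|circ. (cmod (Q t))\<^sup>2 * (norm (radial a r t))\<^sup>2) = 2 * pi * (\<Sum>m. (norm (hr r m))\<^sup>2)"
      using parseval_circ(1)[OF hrn] by (simp add: norm_scaleC power_mult_distrib)
    moreover have "(\<Sum>m<M. (norm (hr r m))\<^sup>2) \<le> (\<Sum>m. (norm (hr r m))\<^sup>2)"
      by (rule sum_le_suminf[OF parseval_circ(2)[OF hrn]]) auto
    ultimately show ?thesis by simp
  qed
  define \<rho> where "\<rho> k = 1 - 1 / real (k + 2)" for k
  have \<rho>: "0 < \<rho> k" "\<rho> k < 1" for k by (auto simp: \<rho>_def)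
  have \<rho>lim: "\<rho> \<longlonglongrightarrow> 1"
    unfolding \<rho>_def by (rule one_minus_inverse_tendsto)
  have \<rho>left: "filterlim \<rho> (at_left 1) sequentially"
    using \<rho>lim \<rho>(2) by (intro tendsto_imp_filterlim_at_left) auto
  have lhs: "(\<lambda>k. 2 * pi * (\<Sum>m<M. (norm (hr (\<rho> k) m))\<^sup>2)) \<longlonglongrightarrow> 2 * pi * (\<Sum>m<M. (norm (h m))\<^sup>2)"
  proof -
    have "(\<lambda>k. hr (\<rho> k) m) \<longlonglongrightarrow> hr 1 m" for m
    proof -
      have "(\<lambda>k. if d \<le> m + j then \<rho> k ^ (m + j - d) *\<^sub>R a (m + j - d) else 0)
          \<longlonglongrightarrow> (if d \<le> m + j then 1 ^ (m + j - d) *\<^sub>R a (m + j - d) else 0)" for j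
        by (cases "d \<le> m + j") (auto intro!: tendsto_eq_intros \<rho>lim)
      then show ?thesis unfolding hr_def by (intro tendsto_intros)
    qed
    moreover have "hr 1 = h" by (auto simp: hr_def h_def cong: if_cong)
    ultimately show ?thesis by (intro tendsto_intros) auto
  qed
  have Qm[measurable]: "(\<lambda>t. cmod (Q t)) \<in> borel_measurable circ"
    by (intro continuous_measurable_circ continuous_on_norm Qc)
  \<comment> \<open>Norm convergence of the radial limits enters here: it identifies the limit of
    \<open>\<parallel>radial a r t\<parallel>^2\<close> as \<open>1 - exp (l t)\<close>.\<close>
  have rhs: "(\<lambda>k. LINT t|circ. (cmod (Q t))\<^sup>2 * (norm (radial a (\<rho> k) t))\<^sup>2)
      \<longlonglongrightarrow> (LINT t|circ. (cmod (Q t))\<^sup>2 * (1 - exp (l t)))"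
  proof (rule integral_dominated_convergence[where w = "\<lambda>_. C\<^sup>2"])
    show "(\<lambda>t. (cmod (Q t))\<^sup>2 * (1 - exp (l t))) \<in> borel_measurable circ" by measurable
    have "continuous_on UNIV (radial a (\<rho> k))" for k
      unfolding radial_def[abs_def]
      by (rule continuous_circ_series[OF summable_radial[OF a]]) (use \<rho>[of k] in auto)
    then have [measurable]: "(\<lambda>t. norm (radial a (\<rho> k) t)) \<in> borel_measurable circ" for k
      by (intro continuous_measurable_circ continuous_on_norm)
    show "(\<lambda>t. (cmod (Q t))\<^sup>2 * (norm (radial a (\<rho> k) t))\<^sup>2) \<in> borel_measurable circ" for k by measurable
    show "AE t in circ. (\<lambda>k. (cmod (Q t))\<^sup>2 * (norm (radial a (\<rho> k) t))\<^sup>2) \<longlonglongrightarrow> (cmod (Q t))\<^sup>2 * (1 - exp (l t))"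
      using lim
    proof (rule AE_mp, intro AE_I2 impI)
      fix t assume "\<exists>y. ((\<lambda>r. radial a r t) \<longlongrightarrow> y) (at_left 1) \<and> exp (l t) = 1 - (norm y)\<^sup>2"
      then obtain y where y: "((\<lambda>r. radial a r t) \<longlongrightarrow> y) (at_left 1)" "1 - exp (l t) = (norm y)\<^sup>2" by auto
      show "(\<lambda>k. (cmod (Q t))\<^sup>2 * (norm (radial a (\<rho> k) t))\<^sup>2) \<longlonglongrightarrow> (cmod (Q t))\<^sup>2 * (1 - exp (l t))"
        unfolding y(2) by (intro tendsto_intros filterlim_compose[OF y(1) \<rho>left])
    qed
    show "AE t in circ. norm ((cmod (Q t))\<^sup>2 * (norm (radial a (\<rho> k) t))\<^sup>2) \<le> C\<^sup>2" for k
    proof (intro AE_I2)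
      fix t
      have "(cmod (Q t))\<^sup>2 * (norm (radial a (\<rho> k) t))\<^sup>2 \<le> C\<^sup>2 * 1\<^sup>2"
        by (intro mult_mono power_mono QC a1 \<rho>) auto
      then show "norm ((cmod (Q t))\<^sup>2 * (norm (radial a (\<rho> k) t))\<^sup>2) \<le> C\<^sup>2" by simp
    qed
  qed simp
  have "2 * pi * (\<Sum>m<M. (norm (h m))\<^sup>2) \<le> (LINT t|circ. (cmod (Q t))\<^sup>2 * (1 - exp (l t)))"
    by (rule LIMSEQ_le[OF lhs rhs]) (use part \<rho> in blast)
  also have "\<dots> = (LINT t|circ. (cmod (Q t))\<^sup>2) - (LINT t|circ. exp (l t) * (cmod (Q t))\<^sup>2)"
  proof -
    have "integrable circ (\<lambda>t. exp (l t) * (cmod (Q t))\<^sup>2)"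
    proof (rule circ.integrable_const_bound[of _ "C\<^sup>2"])
      show "AE t in circ. norm (exp (l t) * (cmod (Q t))\<^sup>2) \<le> C\<^sup>2"
        using w1
      proof (rule AE_mp, intro AE_I2 impI)
        fix t assume "exp (l t) \<le> 1"
        then have "exp (l t) * (cmod (Q t))\<^sup>2 \<le> 1 * C\<^sup>2" by (intro mult_mono power_mono QC) auto
        then show "norm (exp (l t) * (cmod (Q t))\<^sup>2) \<le> C\<^sup>2" by simp
      qed
    qed measurable
    moreover have "integrable circ (\<lambda>t. (cmod (Q t))\<^sup>2)"
      by (intro integrable_circ_continuous continuous_on_power continuous_on_norm Qc)
    ultimately have "(LINT t|circ. (cmod (Q t))\<^sup>2 - exp (l t) * (cmod (Q t))\<^sup>2)
        = (LINT t|circ. (cmod (Q t))\<^sup>2) - (LINT t|circ. exp (l t) * (cmod (Q t))\<^sup>2)"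
      by (intro Bochner_Integration.integral_diff)
    then show ?thesis by (simp add: algebra_simps)
  qed
  also have "\<dots> \<le> 2 * pi * ((\<Sum>j\<le>d. (cmod (x j))\<^sup>2) - exp ((LINT t|circ. l t) / (2 * pi)) * (cmod (x 0))\<^sup>2)"
    using lower unfolding Q2 by (simp add: algebra_simps)
  finally show ?thesis by (simp add: mult_le_cancel_left_pos)
qed

subsection \<open>Power series of Hardy space functions\<close>

lemma radial_Parseval:
  assumes "0 \<le> r" "r < 1" "summable (\<lambda>n. norm (r ^ n *\<^sub>R a n))"
  shows "(LINT t|circ. (norm (radial a r t))\<^sup>2) = 2 * pi * (\<Sum>n. (r ^ n * norm (a n))\<^sup>2)"
    and "summable (\<lambda>n. (r ^ n * norm (a n))\<^sup>2)"
  using parseval_circ[OF assms(3)] assms(1,2) unfolding radial_def by simp_all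

lemma radial_L2_bound:
  assumes r: "0 \<le> r" "r < 1" "summable (\<lambda>n. norm (r ^ n *\<^sub>R a n))"
    and le: "(LINT t|circ. (norm (radial a r t))\<^sup>2) \<le> 2 * pi * K"
  shows "(\<Sum>n<N. (r ^ n * norm (a n))\<^sup>2) \<le> K"
proof -
  have "2 * pi * (\<Sum>n<N. (r ^ n * norm (a n))\<^sup>2) \<le> 2 * pi * (\<Sum>n. (r ^ n * norm (a n))\<^sup>2)"
    by (intro mult_left_mono sum_le_suminf radial_Parseval(2)[OF r]) auto
  also have "\<dots> \<le> 2 * pi * K" using le unfolding radial_Parseval(1)[OF r] .
  finally show ?thesis by (simp add: mult_le_cancel_left_pos)
qed

text \<open>For a fixed number of terms the limit \<open>r \<rightarrow> 1\<close> is harmless, so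
  bounds on the means inside the disc yield square summability without boundary values.\<close>

lemma radial_L2_bound_limit:
  assumes s: "\<And>r. 0 < r \<Longrightarrow> r < 1 \<Longrightarrow> summable (\<lambda>n. norm (r ^ n *\<^sub>R a n))"
    and le: "\<And>r. 0 < r \<Longrightarrow> r < 1 \<Longrightarrow> (LINT t|circ. (norm (radial a r t))\<^sup>2) \<le> 2 * pi * K"
  shows "(\<Sum>n<N. (norm (a n))\<^sup>2) \<le> K"
proof (rule tendsto_upperbound)
  show "((\<lambda>r. \<Sum>n<N. (r ^ n * norm (a n))\<^sup>2) \<longlongrightarrow> (\<Sum>n<N. (norm (a n))\<^sup>2)) (at_left 1)"
    by (auto intro!: tendsto_eq_intros)
  have "(\<Sum>n<N. (r ^ n * norm (a n))\<^sup>2) \<le> K" if "0 < r" "r < 1" for r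
    by (rule radial_L2_bound[OF _ _ s le]) (use that in auto)
  then show "\<forall>\<^sub>F r in at_left 1. (\<Sum>n<N. (r ^ n * norm (a n))\<^sup>2) \<le> K"
    unfolding eventually_at_left_field by (intro exI[of _ 0]) auto
qed simp

lemma power_scaleC_radial:
  "(complex_of_real r * cis (- t)) ^ n *\<^sub>C a = cis (- real n * t) *\<^sub>C (r ^ n *\<^sub>R a)"
proof -
  have "(complex_of_real r * cis (- t)) ^ n = cis (- real n * t) * complex_of_real (r ^ n)"
    by (simp add: power_mult_distrib Complex.DeMoivre)
  then show ?thesis by (simp only: scaleC_scaleC[symmetric] scaleC_of_real)
qed

lemma L2_circ_bounded:
  fixes a :: "nat \<Rightarrow> 'a::complex_hilbert"
  assumes "summable (\<lambda>n. norm (r ^ n *\<^sub>R a n))" "\<And>t. norm (radial a r t) \<le> K"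
  shows "(LINT t|circ. (norm (radial a r t))\<^sup>2) \<le> 2 * pi * K\<^sup>2"
proof -
  have "(LINT t|circ. (norm (radial a r t))\<^sup>2) \<le> (LINT t|circ. K\<^sup>2)"
  proof (rule integral_mono)
    show "integrable circ (\<lambda>t. (norm (radial a r t))\<^sup>2)"
      unfolding radial_def
      by (intro integrable_circ_continuous continuous_on_power continuous_on_norm continuous_circ_series assms)
  qed (auto intro!: power_mono assms)
  then show ?thesis by simp
qed

lemma powser_summable_norm:
  fixes c :: "nat \<Rightarrow> complex"
  assumes s: "\<And>z. cmod z < 1 \<Longrightarrow> (\<lambda>n. z ^ n * c n) sums f z" and r: "0 < r" "r < 1"
  shows "summable (\<lambda>n. norm (r ^ n *\<^sub>R c n))"
proof -
  obtain q where q: "r < q" "q < 1" using dense[OF r(2)] by blast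
  then have "summable (\<lambda>n. c n * complex_of_real q ^ n)"
    using s[of "complex_of_real q"] r by (simp add: sums_iff mult.commute)
  then have "summable (\<lambda>n. norm (c n * complex_of_real r ^ n))"
    by (rule powser_insidea) (use q r in simp)
  then show ?thesis using r by (simp add: norm_mult norm_power mult.commute)
qed

text \<open>A single coefficient is bounded by the mean square, hence by the supremum. With
  \<open>K = 0\<close> this is the uniqueness of power series coefficients, and it is used in that
  role below.\<close>

lemma powser_coeff_bound:
  fixes c :: "nat \<Rightarrow> complex"
  assumes s: "\<And>z. cmod z < 1 \<Longrightarrow> (\<lambda>n. z ^ n * c n) sums f z" and K: "\<And>z. cmod z < 1 \<Longrightarrow> cmod (f z) \<le> K"
  shows "cmod (c n) \<le> K"
proof -
  note abs = powser_summable_norm[OF s]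
  have rad: "radial c r t = f (complex_of_real r * cis (- t))" if r: "0 < r" "r < 1" for r t
  proof -
    have "(\<lambda>n. (complex_of_real r * cis (- t)) ^ n *\<^sub>C c n) sums f (complex_of_real r * cis (- t))"
      unfolding scaleC_complex_def using r by (intro s) (simp add: norm_mult)
    then show ?thesis unfolding power_scaleC_radial by (simp add: radial_def circ_series_def sums_iff)
  qed
  have "(\<Sum>m<Suc n. (cmod (c m))\<^sup>2) \<le> K\<^sup>2"
  proof (rule radial_L2_bound_limit[OF abs])
    fix r :: real assume r: "0 < r" "r < 1"
    show "(LINT t|circ. (norm (radial c r t))\<^sup>2) \<le> 2 * pi * K\<^sup>2"
      using r by (intro L2_circ_bounded abs) (auto simp: rad norm_mult intro!: K)
  qed
  then have "(cmod (c n))\<^sup>2 \<le> K\<^sup>2"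
    using sum_nonneg[of "{..<n}" "\<lambda>m. (cmod (c m))\<^sup>2"] by simp
  moreover have "0 \<le> K" using order_trans[OF norm_ge_zero K[of 0]] by simp
  ultimately show ?thesis by (rule power2_le_imp_le)
qed

lemma summable_h2_eval:
  assumes "cmod z < 1"
  shows "summable (\<lambda>n. norm (z ^ n *\<^sub>C h2_coeff f n))"
proof -
  have "summable (\<lambda>n. norm (cmod z ^ n *\<^sub>R h2_coeff f n))"
    by (rule summable_radial[OF summable_h2_coeff]) (use assms in auto)
  then show ?thesis by (simp add: norm_scaleC norm_power)
qed

lemma h2_eval_sums: "cmod z < 1 \<Longrightarrow> (\<lambda>n. z ^ n *\<^sub>C h2_coeff f n) sums h2_eval f z"
  unfolding h2_eval_def by (rule summable_sums[OF summable_norm_cancel[OF summable_h2_eval]])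

lemma h2_eval_radial:
  "h2_eval f (complex_of_real r * cis (- t)) = radial (h2_coeff f) r t"
  unfolding h2_eval_def radial_def circ_series_def power_scaleC_radial ..

lemma h2_coeff_unique:
  fixes f :: "complex hardy2"
  assumes "\<And>z. cmod z < 1 \<Longrightarrow> (\<lambda>n. z ^ n * c n) sums h2_eval f z"
  shows "h2_coeff f n = c n"
proof -
  have "cmod (h2_coeff f n - c n) \<le> 0"
  proof (rule powser_coeff_bound[where f = "\<lambda>_. 0"])
    show "(\<lambda>n. z ^ n * (h2_coeff f n - c n)) sums 0" if "cmod z < 1" for z
      using sums_diff[OF h2_eval_sums[OF that, of f] assms[OF that]]
      by (simp add: algebra_simps scaleC_complex_def)
  qed simp
  then show ?thesis by simp
qed

lemma Abs_hardy2_coeff: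
  "summable (\<lambda>n. (norm (a n))\<^sup>2) \<Longrightarrow> h2_coeff (Abs_hardy2 a) = a"
  by (simp add: Abs_hardy2_inverse)

lemma norm_h2_sq: "(norm f)\<^sup>2 = (\<Sum>n. (norm (h2_coeff f n))\<^sup>2)"
  unfolding norm_hardy2_def by (simp add: suminf_nonneg summable_h2_coeff)

lemma norm_h2_le:
  assumes "\<And>N. (\<Sum>n<N. (norm (h2_coeff f n))\<^sup>2) \<le> K\<^sup>2" "0 \<le> K"
  shows "norm f \<le> K"
proof (rule power2_le_imp_le)
  show "(norm f)\<^sup>2 \<le> K\<^sup>2"
    unfolding norm_h2_sq by (intro suminf_le_const summable_h2_coeff assms)
qed (rule assms)

definition h2_mono :: "nat \<Rightarrow> 'a::complex_hilbert \<Rightarrow> 'a hardy2" where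
  "h2_mono n d = Abs_hardy2 (\<lambda>k. if k = n then d else 0)"

lemma h2_coeff_mono: "h2_coeff (h2_mono n d) k = (if k = n then d else 0)"
  unfolding h2_mono_def
  by (subst Abs_hardy2_coeff) (rule summable_finite[of "{n}"], auto)

lemma norm_le_one_if_cinner_self_le:
  assumes "cmod (cinner y y) \<le> norm (y::'a::complex_hilbert)"
  shows "norm y \<le> 1"
proof (cases "y = 0")
  case False
  have "cmod (cinner y y) = norm y * norm y" by (simp add: cinner_self norm_power power2_eq_square norm_mult)
  with assms have "norm y * norm y \<le> 1 * norm y" by simp
  then show ?thesis by (rule mult_right_le_imp_le) (use False in simp)
qed simp

lemma cinner_h2: "cinner f g = (\<Sum>n. cinner (h2_coeff f n) (h2_coeff g n))"
  by (rule cinner_hardy2_def)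

lemma cinner_h2_mono: "cinner (h2_mono n d) f = cinner d (h2_coeff f n)"
proof -
  have "(\<lambda>k. cinner (h2_coeff (h2_mono n d) k) (h2_coeff f k)) = (\<lambda>k. if k = n then cinner d (h2_coeff f k) else 0)"
    by (auto simp: h2_coeff_mono)
  then show ?thesis using sums_single[of n "\<lambda>k. cinner d (h2_coeff f k)"] by (simp add: cinner_h2 sums_iff)
qed

lemma cinner_h2_mono_right: "cinner f (h2_mono n d) = cinner (h2_coeff f n) d"
  using cinner_h2_mono[of n d f] by (metis cinner_commute)

definition h2_shift :: "'a::complex_hilbert hardy2 \<Rightarrow> 'a hardy2" where
  "h2_shift f = Abs_hardy2 (\<lambda>k. case k of 0 \<Rightarrow> 0 | Suc m \<Rightarrow> h2_coeff f m)"

lemma h2_coeff_shift: "h2_coeff (h2_shift f) k = (case k of 0 \<Rightarrow> 0 | Suc m \<Rightarrow> h2_coeff f m)"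
proof -
  have "summable (\<lambda>k. (norm (case k of 0 \<Rightarrow> 0 | Suc m \<Rightarrow> h2_coeff f m))\<^sup>2)"
    by (subst summable_Suc_iff[symmetric]) (simp add: summable_h2_coeff)
  then show ?thesis unfolding h2_shift_def by (subst Abs_hardy2_coeff) auto
qed

lemma h2_coeff_shift_simps [simp]:
  "h2_coeff (h2_shift f) 0 = 0" "h2_coeff (h2_shift f) (Suc k) = h2_coeff f k"
  by (simp_all add: h2_coeff_shift)

lemma norm_h2_shift [simp]: "norm (h2_shift f) = norm f"
proof -
  have "(norm (h2_shift f))\<^sup>2 = (norm f)\<^sup>2"
    unfolding norm_h2_sq using suminf_split_head[OF summable_h2_coeff[of "h2_shift f"]] by simp
  then show ?thesis by simp
qed

lemma bounded_clinear_h2_shift: "bounded_clinear h2_shift"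
  by (rule bounded_clinearI[of _ 1]; (intro hardy2_eqI)?)
    (auto simp: h2_coeff_shift h2_coeff_simps h2_coeff_scaleC split: nat.split)

subsection \<open>Multiplication by a Schur function\<close>

locale scalar_schur =
  fixes B :: "complex \<Rightarrow> 'd::complex_hilbert \<Rightarrow> complex"
  assumes B: "B \<in> schur_class"
begin

lemma B_bounded_clinear: "cmod z < 1 \<Longrightarrow> bounded_clinear (B z)"
  using B by (auto simp: schur_class_def)

lemma B_le: "cmod z < 1 \<Longrightarrow> cmod (B z x) \<le> norm x"
proof -
  assume z: "cmod z < 1"
  have "onorm (B z) \<le> 1" using B z by (auto simp: schur_class_def)
  moreover have "cmod (B z x) \<le> onorm (B z) * norm x"
    by (rule onorm[OF bounded_clinearD(1)[OF B_bounded_clinear[OF z]]])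
  ultimately show ?thesis by (metis mult_1 mult_right_mono norm_ge_zero order_trans)
qed

lemma B_holomorphic: "(\<lambda>z. B z x) holomorphic_on ball 0 1"
proof (rule holomorphic_onI)
  fix z :: complex assume zb: "z \<in> ball 0 1"
  then have z: "cmod z < 1" by simp
  obtain L where L: "bounded_clinear L"
    and lim: "((\<lambda>w. onorm (\<lambda>x. inverse (w - z) *\<^sub>C (B w x - B z x) - L x)) \<longlongrightarrow> 0) (at z)"
    using B zb unfolding schur_class_def by blast
  have bl: "bounded_linear (\<lambda>x. inverse (w - z) *\<^sub>C (B w x - B z x) - L x)" if "cmod w < 1" for w
    by (intro bounded_linear_sub bounded_linear_compose[OF bounded_linear_scaleC_right]
        bounded_clinearD(1) L B_bounded_clinear z that)
  have "((\<lambda>w. (B w x - B z x) / (w - z) - L x) \<longlongrightarrow> 0) (at z)"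
  proof (rule Lim_null_comparison)
    have "\<forall>\<^sub>F w in at z. w \<in> ball 0 1"
      by (rule eventually_at_in_open') (use z in auto)
    then show "\<forall>\<^sub>F w in at z. norm ((B w x - B z x) / (w - z) - L x)
        \<le> onorm (\<lambda>x. inverse (w - z) *\<^sub>C (B w x - B z x) - L x) * norm x"
    proof eventually_elim
      case (elim w)
      show ?case
        using onorm[OF bl, of w x] elim by (simp add: scaleC_complex_def divide_inverse mult.commute)
    qed
    show "((\<lambda>w. onorm (\<lambda>x. inverse (w - z) *\<^sub>C (B w x - B z x) - L x) * norm x) \<longlongrightarrow> 0) (at z)"
      using tendsto_mult_right[OF lim, of "norm x"] by simp
  qed
  then have "((\<lambda>z. B z x) has_field_derivative L x) (at z)"
    unfolding has_field_derivative_iff by (rule Lim_null[THEN iffD2])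
  then show "(\<lambda>z. B z x) field_differentiable at z within ball 0 1"
    using field_differentiable_at_within field_differentiable_def by blast
qed

definition bvec :: "nat \<Rightarrow> 'd" where
  "bvec = (SOME b. \<forall>z x. cmod z < 1 \<longrightarrow> (\<lambda>n. z ^ n * cinner x (b n)) sums B z x)"

text \<open>Applying \<open>B\<close> to a fixed \<open>x\<close> gives a scalar power series. Its
  coefficients are linear in \<open>x\<close> by uniqueness and bounded by \<open>norm x\<close> by
  contractivity, so the Riesz theorem represents them by vectors. This licenses the choice in
  \<open>bvec\<close>.\<close>

lemma B_sums: "cmod z < 1 \<Longrightarrow> (\<lambda>n. z ^ n * cinner x (bvec n)) sums B z x"
proof -
  define c where "c n x = (deriv ^^ n) (\<lambda>z. B z x) 0 / fact n" for n x
  have c: "(\<lambda>n. z ^ n * c n x) sums B z x" if "cmod z < 1" for z x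
    using holomorphic_power_series[OF B_holomorphic, of z x] that
    by (simp add: c_def mult.commute)
  have cb: "cmod (c n x) \<le> norm x" for n x by (rule powser_coeff_bound[OF c B_le])
  have cl: "c n (x + y) = c n x + c n y" for n x y
  proof -
    have "cmod (c n (x + y) - (c n x + c n y)) \<le> 0"
    proof (rule powser_coeff_bound[where f = "\<lambda>_. 0"])
      show "(\<lambda>n. z ^ n * (c n (x + y) - (c n x + c n y))) sums 0" if "cmod z < 1" for z
        using sums_diff[OF c[OF that] sums_add[OF c[OF that] c[OF that]], of "x + y" x y]
        by (simp add: bounded_clinearD[OF B_bounded_clinear[OF that]] algebra_simps)
    qed simp
    then show ?thesis by simp
  qed
  have cs: "c n (s *\<^sub>C x) = s * c n x" for n s x
  proof -
    have "cmod (c n (s *\<^sub>C x) - s * c n x) \<le> 0"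
    proof (rule powser_coeff_bound[where f = "\<lambda>_. 0"])
      show "(\<lambda>n. z ^ n * (c n (s *\<^sub>C x) - s * c n x)) sums 0" if "cmod z < 1" for z
        using sums_diff[OF c[OF that] sums_mult[OF c[OF that]], of "s *\<^sub>C x" s x]
        by (simp add: bounded_clinearD[OF B_bounded_clinear[OF that]] scaleC_complex_def algebra_simps)
    qed simp
    then show ?thesis by simp
  qed
  have "\<exists>y. \<forall>x. c n x = cinner x y" for n
  proof -
    have "\<And>x. cmod (c n x) \<le> 1 * norm x" using cb by simp
    then obtain y where "\<And>x. x \<in> UNIV \<Longrightarrow> c n x = cinner x y"
      using riesz_csubspace[OF csubspace_UNIV, of "c n" 1] cl cs by metis
    then show ?thesis by auto
  qed
  then obtain b where b: "\<And>n x. c n x = cinner x (b n)" by metis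
  have "\<exists>b. \<forall>z x. cmod z < 1 \<longrightarrow> (\<lambda>n. z ^ n * cinner x (b n)) sums B z x"
    using c by (intro exI[of _ b] allI impI) (simp only: b)
  then show "cmod z < 1 \<Longrightarrow> (\<lambda>n. z ^ n * cinner x (bvec n)) sums B z x"
    unfolding bvec_def by (rule someI2_ex) blast
qed

lemma norm_bvec_le: "norm (bvec n) \<le> 1"
proof -
  have "cmod (cinner (bvec n) (bvec n)) \<le> norm (bvec n)"
    by (rule powser_coeff_bound[OF B_sums B_le])
  then show ?thesis by (rule norm_le_one_if_cinner_self_le)
qed

lemma summable_radial_bvec: "0 \<le> r \<Longrightarrow> r < 1 \<Longrightarrow> summable (\<lambda>n. norm (r ^ n *\<^sub>R bvec n))"
  by (rule summable_comparison_test'[OF summable_geometric[of r]])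
    (auto simp: mult_left_le norm_bvec_le)

lemma B_radial:
  assumes r: "0 \<le> r" "r < 1"
  shows "B (complex_of_real r * cis t) x = cinner x (radial bvec r t)"
proof -
  have "cinner x (radial bvec r t) = (\<Sum>n. cinner x (cis (- real n * t) *\<^sub>C (r ^ n *\<^sub>R bvec n)))"
    unfolding radial_def circ_series_def
    by (rule bounded_linear.suminf[OF bounded_linear_cinner_right summable_circ_series[OF summable_radial_bvec[OF r]]])
  also have "\<dots> = (\<Sum>n. (complex_of_real r * cis t) ^ n * cinner x (bvec n))"
    by (simp add: cinner_simps cis_cnj power_mult_distrib Complex.DeMoivre mult_ac)
  also have "\<dots> = B (complex_of_real r * cis t) x"
    using B_sums[of "complex_of_real r * cis t" x] r by (simp add: sums_iff norm_mult)
  finally show ?thesis by simp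
qed

lemma norm_radial_bvec_le: "0 \<le> r \<Longrightarrow> r < 1 \<Longrightarrow> norm (radial bvec r t) \<le> 1"
proof -
  assume r: "0 \<le> r" "r < 1"
  let ?y = "radial bvec r t"
  have "cmod (cinner ?y ?y) \<le> norm ?y"
    unfolding B_radial[OF r, symmetric] by (rule B_le) (use r in \<open>simp add: norm_mult\<close>)
  then show ?thesis by (rule norm_le_one_if_cinner_self_le)
qed

lemma summable_bvec: "summable (\<lambda>n. (norm (bvec n))\<^sup>2)"
proof (rule summableI_nonneg_bounded)
  show "(\<Sum>n<N. (norm (bvec n))\<^sup>2) \<le> 1\<^sup>2" for N
  proof (rule radial_L2_bound_limit[OF _ L2_circ_bounded])
    fix r :: real assume r: "0 < r" "r < 1"
    show "summable (\<lambda>n. norm (r ^ n *\<^sub>R bvec n))" by (rule summable_radial_bvec) (use r in auto)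
    then show "summable (\<lambda>n. norm (r ^ n *\<^sub>R bvec n))" .
    show "norm (radial bvec r t) \<le> 1" for t by (rule norm_radial_bvec_le) (use r in auto)
  qed
qed simp

text \<open>Since \<open>mult_op\<close> is a definite description, coefficients, values and norm
  bound are attached to one witness before it is identified. The norm bound compares square means on
  circles of radius \<open>r < 1\<close>, where \<open>|B f| \<le> \<parallel>f\<parallel>\<close>
  pointwise.\<close>

lemma mult_op_exists:
  "\<exists>g. (\<forall>n. h2_coeff g n = (\<Sum>k\<le>n. cinner (h2_coeff f k) (bvec (n - k)))) \<and>
    (\<forall>z\<in>ball 0 1. h2_eval g z = B z (h2_eval f z)) \<and> norm g \<le> norm f"
proof -
  define c where "c n = (\<Sum>k\<le>n. cinner (h2_coeff f k) (bvec (n - k)))" for n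
  have c: "(\<lambda>n. z ^ n * c n) sums B z (h2_eval f z)" if z: "cmod z < 1" for z
  proof -
    define F where "F = (\<lambda>(k, n). z ^ k * z ^ n * cinner (h2_coeff f k) (bvec n))"
    have b: "cmod (F (k, n)) \<le> norm (z ^ k *\<^sub>C h2_coeff f k) * cmod z ^ n" for k n
    proof -
      have "cmod (cinner (h2_coeff f k) (bvec n)) \<le> norm (h2_coeff f k) * 1"
        using order_trans[OF Cauchy_Schwarz_cinner mult_left_mono[OF norm_bvec_le norm_ge_zero]] .
      then have "cmod z ^ k * cmod z ^ n * cmod (cinner (h2_coeff f k) (bvec n)) \<le> cmod z ^ k * cmod z ^ n * (norm (h2_coeff f k) * 1)"
        by (intro mult_left_mono) auto
      then show ?thesis by (simp add: F_def norm_mult norm_power norm_scaleC mult_ac)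
    qed
    note sm = b summable_h2_eval[OF z, of f] summable_geometric[of "cmod z"]
    have "B z (h2_eval f z) = (\<Sum>k. B z (z ^ k *\<^sub>C h2_coeff f k))"
      unfolding h2_eval_def
      by (rule bounded_linear.suminf[OF bounded_clinearD(1)[OF B_bounded_clinear[OF z]]
          summable_norm_cancel[OF summable_h2_eval[OF z]]])
    also have "\<dots> = (\<Sum>k. \<Sum>n. F (k, n))"
    proof (rule suminf_cong)
      fix k
      have "B z (z ^ k *\<^sub>C h2_coeff f k) = z ^ k * B z (h2_coeff f k)"
        by (simp add: bounded_clinearD[OF B_bounded_clinear[OF z]] scaleC_complex_def)
      also have "\<dots> = (\<Sum>n. z ^ k * (z ^ n * cinner (h2_coeff f k) (bvec n)))"
        using sums_mult[OF B_sums[OF z], of "z ^ k" "h2_coeff f k"] by (simp add: sums_iff)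
      finally show "B z (z ^ k *\<^sub>C h2_coeff f k) = (\<Sum>n. F (k, n))" by (simp add: F_def mult.assoc)
    qed
    also have "\<dots> = (\<Sum>n. \<Sum>k\<le>n. F (k, n - k))"
      by (rule suminf_double_diagonal(1)[OF sm(1,2,3)]) (use z in auto)
    finally have "B z (h2_eval f z) = (\<Sum>n. \<Sum>k\<le>n. F (k, n - k))" .
    moreover have "summable (\<lambda>n. \<Sum>k\<le>n. F (k, n - k))"
      by (rule suminf_double_diagonal(2)[OF sm(1,2,3)]) (use z in auto)
    moreover have "(\<Sum>k\<le>n. F (k, n - k)) = z ^ n * c n" for n
      unfolding c_def sum_distrib_left by (intro sum.cong) (auto simp: F_def simp flip: power_add)
    ultimately show ?thesis by (simp add: sums_iff)
  qed
  note abs = powser_summable_norm[OF c]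
  have part: "(\<Sum>n<N. (norm (c n))\<^sup>2) \<le> (norm f)\<^sup>2" for N
  proof (rule radial_L2_bound_limit[OF abs])
    fix r :: real assume r: "0 < r" "r < 1"
    have fs: "summable (\<lambda>n. norm (r ^ n *\<^sub>R h2_coeff f n))"
      by (rule summable_radial[OF summable_h2_coeff]) (use r in auto)
    have "(LINT t|circ. (norm (radial c r t))\<^sup>2) \<le> (LINT t|circ. (norm (radial (h2_coeff f) r t))\<^sup>2)"
    proof (rule integral_mono)
      show "integrable circ (\<lambda>t. (norm (radial c r t))\<^sup>2)"
        unfolding radial_def
        by (intro integrable_circ_continuous continuous_on_power continuous_on_norm continuous_circ_series abs r)
      show "integrable circ (\<lambda>t. (norm (radial (h2_coeff f) r t))\<^sup>2)"
        unfolding radial_def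
        by (intro integrable_circ_continuous continuous_on_power continuous_on_norm continuous_circ_series fs)
      fix t
      let ?z = "complex_of_real r * cis (- t)"
      have z: "cmod ?z < 1" using r by (simp add: norm_mult)
      have "radial c r t = B ?z (h2_eval f ?z)"
      proof -
        have "(\<lambda>n. ?z ^ n *\<^sub>C c n) sums B ?z (h2_eval f ?z)" using c[OF z] by (simp only: scaleC_complex_def)
        then show ?thesis unfolding power_scaleC_radial by (simp add: radial_def circ_series_def sums_iff)
      qed
      then have "norm (radial c r t) \<le> norm (radial (h2_coeff f) r t)"
        using B_le[OF z, of "h2_eval f ?z"] by (simp only: h2_eval_radial)
      then show "(norm (radial c r t))\<^sup>2 \<le> (norm (radial (h2_coeff f) r t))\<^sup>2" by (intro power_mono) auto
    qed
    also have "\<dots> = 2 * pi * (\<Sum>n. (r ^ n * norm (h2_coeff f n))\<^sup>2)"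
      by (rule radial_Parseval(1)) (use r fs in auto)
    also have "\<dots> \<le> 2 * pi * (norm f)\<^sup>2"
      unfolding norm_h2_sq
    proof (intro mult_left_mono suminf_le summable_h2_coeff radial_Parseval(2) fs)
      show "(r ^ n * norm (h2_coeff f n))\<^sup>2 \<le> (norm (h2_coeff f n))\<^sup>2" for n
        using r by (intro power_mono) (auto simp: mult_left_le_one_le power_le_one)
    qed (use r in auto)
    finally show "(LINT t|circ. (norm (radial c r t))\<^sup>2) \<le> 2 * pi * (norm f)\<^sup>2" .
  qed
  have cs: "summable (\<lambda>n. (norm (c n))\<^sup>2)"
    by (rule summableI_nonneg_bounded[OF _ part]) simp
  define g where "g = Abs_hardy2 c"
  have g: "h2_coeff g = c" unfolding g_def by (rule Abs_hardy2_coeff[OF cs])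
  have "norm g \<le> norm f" by (rule norm_h2_le) (simp_all add: g part)
  moreover have "h2_eval g z = B z (h2_eval f z)" if "cmod z < 1" for z
    using c[OF that] by (simp add: h2_eval_def g scaleC_complex_def sums_iff)
  ultimately show ?thesis by (intro exI[of _ g]) (auto simp: g c_def)
qed

abbreviation TB :: "'d hardy2 \<Rightarrow> complex hardy2" where "TB \<equiv> mult_op B"

lemma TB_coeff: "h2_coeff (TB f) n = (\<Sum>k\<le>n. cinner (h2_coeff f k) (bvec (n - k)))"
  and norm_TB_le: "norm (TB f) \<le> norm f"
proof -
  obtain g where g: "\<And>n. h2_coeff g n = (\<Sum>k\<le>n. cinner (h2_coeff f k) (bvec (n - k)))"
    "\<And>z. z \<in> ball 0 1 \<Longrightarrow> h2_eval g z = B z (h2_eval f z)" "norm g \<le> norm f"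
    using mult_op_exists[of f] by blast
  have "TB f = g"
    unfolding mult_op_def
  proof (rule the_equality)
    fix g' assume g': "\<forall>z\<in>ball 0 1. h2_eval g' z = B z (h2_eval f z)"
    have "h2_coeff g' n = h2_coeff g n" for n
    proof (rule h2_coeff_unique)
      fix z :: complex assume z: "cmod z < 1"
      then have "h2_eval g' z = h2_eval g z" using g' g(2) by simp
      then show "(\<lambda>n. z ^ n * h2_coeff g n) sums h2_eval g' z"
        using h2_eval_sums[OF z, of g] by (simp add: scaleC_complex_def)
    qed
    then show "g' = g" by (rule hardy2_eqI)
  qed (use g in blast)
  with g show "h2_coeff (TB f) n = (\<Sum>k\<le>n. cinner (h2_coeff f k) (bvec (n - k)))" "norm (TB f) \<le> norm f"
    by auto
qed

lemma bounded_clinear_TB: "bounded_clinear TB"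
proof (rule bounded_clinearI[of _ 1])
  show "TB (f + g) = TB f + TB g" for f g
    by (rule hardy2_eqI) (simp only: TB_coeff h2_coeff_add cinner_add_left sum.distrib)
  show "TB (c *\<^sub>C f) = c *\<^sub>C TB f" for c f
    by (rule hardy2_eqI) (simp only: TB_coeff h2_coeff_scaleC cinner_scaleC_left scaleC_complex_def sum_distrib_left)
qed (simp add: norm_TB_le)

section \<open>The adjoint of multiplication and its Fourier coefficients\<close>

abbreviation TBs :: "complex hardy2 \<Rightarrow> 'd hardy2" where "TBs \<equiv> cadjoint TB"

lemmas bounded_clinear_TBs = bounded_clinear_cadjoint[OF bounded_clinear_TB]

lemma norm_TBs_le: "norm (TBs x) \<le> norm x"
  using norm_cadjoint_le[OF bounded_clinear_TB, of 1 x] norm_TB_le by simp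

text \<open>Extension by zero to all integers, so that multiplying by \<open>z\<close> is a plain
  translation of the frequency.\<close>

definition bz :: "int \<Rightarrow> 'd" where "bz i = (if 0 \<le> i then bvec (nat i) else 0)"

text \<open>\<open>\<beta> n x\<close> is the Fourier coefficient of \<open>B\<^sup>* x\<close> at \<open>-n\<close>.\<close>

definition \<beta> :: "int \<Rightarrow> complex hardy2 \<Rightarrow> 'd" where
  "\<beta> n x = (\<Sum>m. h2_coeff x m *\<^sub>C bz (int m + n))"

lemma summable_bz: "summable (\<lambda>m. (norm (bz (int m + n)))\<^sup>2)"
proof (cases "0 \<le> n")
  case True
  then have "(\<lambda>m. (norm (bz (int m + n)))\<^sup>2) = (\<lambda>m. (norm (bvec (m + nat n)))\<^sup>2)"
    by (auto simp: bz_def nat_add_distrib)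
  then show ?thesis using summable_ignore_initial_segment[OF summable_bvec, of "nat n"] by simp
next
  case False
  have "(\<lambda>m. (norm (bz (int (m + nat (- n)) + n)))\<^sup>2) = (\<lambda>m. (norm (bvec m))\<^sup>2)"
    using False by (auto simp: bz_def)
  then have "summable (\<lambda>m. (norm (bz (int (m + nat (- n)) + n)))\<^sup>2)" using summable_bvec by simp
  then show ?thesis by (subst (asm) summable_iff_shift)
qed

lemma summable_beta: "summable (\<lambda>m. norm (h2_coeff x m *\<^sub>C bz (int m + n)))"
proof (rule summable_comparison_test'[OF summable_add[OF summable_h2_coeff summable_bz]])
  fix m
  show "norm (norm (h2_coeff x m *\<^sub>C bz (int m + n))) \<le> (norm (h2_coeff x m))\<^sup>2 + (norm (bz (int m + n)))\<^sup>2"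
    unfolding norm_scaleC real_norm_def abs_mult abs_norm_cancel
    using sum_squares_bound[of "cmod (h2_coeff x m)" "norm (bz (int m + n))"]
      mult_nonneg_nonneg[OF norm_ge_zero[of "h2_coeff x m"] norm_ge_zero[of "bz (int m + n)"]]
    by linarith
qed

lemma TBs_coeff: "h2_coeff (TBs x) k = \<beta> (- int k) x"
proof (rule cinner_eqI)
  fix d
  have "cinner d (h2_coeff (TBs x) k) = cinner (TB (h2_mono k d)) x"
    by (simp add: cadjoint[OF bounded_clinear_TB] cinner_h2_mono)
  also have "\<dots> = (\<Sum>m. cinner d (h2_coeff x m *\<^sub>C bz (int m + - int k)))"
    unfolding cinner_h2
  proof (rule suminf_cong)
    fix m
    have "h2_coeff (TB (h2_mono k d)) m = (\<Sum>j\<le>m. if j = k then cinner d (bvec (m - k)) else 0)"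
      unfolding TB_coeff by (intro sum.cong) (auto simp: h2_coeff_mono)
    also have "\<dots> = cinner d (bz (int m + - int k))"
      by (auto simp: bz_def nat_diff_distrib)
    finally show "cinner (h2_coeff (TB (h2_mono k d)) m) (h2_coeff x m)
        = cinner d (h2_coeff x m *\<^sub>C bz (int m + - int k))"
      by (simp add: cinner_complex_def cinner_scaleC_right mult.commute)
  qed
  also have "\<dots> = cinner d (\<beta> (- int k) x)"
    unfolding \<beta>_def
    by (rule bounded_linear.suminf[OF bounded_linear_cinner_right summable_norm_cancel[OF summable_beta], symmetric])
  finally show "cinner d (h2_coeff (TBs x) k) = cinner d (\<beta> (- int k) x)" .
qed

lemma beta_shift: "\<beta> n (h2_shift x) = \<beta> (n + 1) x"
proof -
  have "\<beta> n (h2_shift x) = (\<Sum>m. h2_coeff (h2_shift x) (Suc m) *\<^sub>C bz (int (Suc m) + n))"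
    unfolding \<beta>_def by (subst suminf_split_head[OF summable_norm_cancel[OF summable_beta]]) simp
  then show ?thesis by (simp add: \<beta>_def algebra_simps)
qed

lemma beta_linear: "\<beta> n (x + y) = \<beta> n x + \<beta> n y" "\<beta> n (c *\<^sub>C x) = c *\<^sub>C \<beta> n x"
  unfolding \<beta>_def h2_coeff_add h2_coeff_scaleC scaleC_add_left
  using summable_norm_cancel[OF summable_beta]
  by (simp_all add: suminf_add bounded_linear.suminf[OF bounded_linear_scaleC_right] scaleC_scaleC scaleC_complex_def)

text \<open>A positive index is reduced to index 0 by
  \<open>\<beta> n x = \<beta> 0 (z^n x)\<close>. The shift is isometric, and for
  \<open>n \<le> 0\<close> the value is a coefficient of \<open>TBs x\<close>.\<close>

lemma norm_beta_le: "norm (\<beta> n x) \<le> norm x"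
proof (cases "n \<le> 0")
  case True
  then have "\<beta> n x = h2_coeff (TBs x) (nat (- n))" by (simp add: TBs_coeff)
  then show ?thesis using order_trans[OF norm_h2_coeff_le norm_TBs_le] by metis
next
  case False
  have "norm (\<beta> (int m) x) \<le> norm x" for m x
  proof (induction m arbitrary: x)
    case 0
    have "\<beta> 0 x = h2_coeff (TBs x) 0" by (simp add: TBs_coeff)
    then show ?case using order_trans[OF norm_h2_coeff_le norm_TBs_le] by simp
  next
    case (Suc m)
    then show ?case using Suc[of "h2_shift x"] by (simp add: beta_shift add.commute)
  qed
  from this[of "nat n"] show ?thesis using False by simp
qed

lemma bounded_clinear_beta: "bounded_clinear (\<beta> n)"
  by (rule bounded_clinearI[of _ 1]) (simp_all add: beta_linear norm_beta_le)

end

subsection \<open>Polynomials in the Hardy space\<close>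

definition h2_trunc :: "nat \<Rightarrow> complex hardy2 \<Rightarrow> complex hardy2" where
  "h2_trunc d x = (\<Sum>j\<le>d. h2_coeff x j *\<^sub>C h2_mono j 1)"

lemma h2_coeff_sum: "h2_coeff (\<Sum>i\<in>I. f i) n = (\<Sum>i\<in>I. h2_coeff (f i) n)"
  by (induction I rule: infinite_finite_induct) (auto simp: h2_coeff_simps)

lemma h2_coeff_lincomb_mono:
  "h2_coeff (\<Sum>j\<le>d. a j *\<^sub>C h2_mono j (1::complex)) n = (if n \<le> d then a n else 0)"
  by (simp add: h2_coeff_sum h2_coeff_scaleC h2_coeff_mono scaleC_complex_def
      if_distrib[of "\<lambda>x. _ * x"] cong: if_cong)

lemma h2_coeff_trunc: "h2_coeff (h2_trunc d x) n = (if n \<le> d then h2_coeff x n else 0)"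
  unfolding h2_trunc_def by (rule h2_coeff_lincomb_mono)

lemma h2_trunc_tendsto: "(\<lambda>d. h2_trunc d x) \<longlonglongrightarrow> x"
proof -
  have "(norm (h2_trunc d x - x))\<^sup>2 = (\<Sum>n. (norm (h2_coeff x (n + Suc d)))\<^sup>2)" for d
  proof -
    have "(norm (h2_trunc d x - x))\<^sup>2 = (\<Sum>n. (norm (if n \<le> d then 0 else h2_coeff x n))\<^sup>2)"
      unfolding norm_h2_sq by (rule suminf_cong) (auto simp: h2_coeff_diff h2_coeff_trunc)
    also have "\<dots> = (\<Sum>n. (norm (h2_coeff x (n + Suc d)))\<^sup>2)"
    proof (subst suminf_split_initial_segment[where k = "Suc d"])
      show "summable (\<lambda>n. (norm (if n \<le> d then 0 else h2_coeff x n))\<^sup>2)"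
        by (rule summable_comparison_test'[OF summable_h2_coeff[of x]]) auto
    qed auto
    finally show ?thesis .
  qed
  moreover have "(\<lambda>d. \<Sum>n. (norm (h2_coeff x (n + Suc d)))\<^sup>2) \<longlonglongrightarrow> 0"
    using LIMSEQ_Suc[OF suminf_exist_split2[OF summable_h2_coeff[of x]]] .
  ultimately have "(\<lambda>d. (norm (h2_trunc d x - x))\<^sup>2) \<longlonglongrightarrow> 0" by presburger
  then have "(\<lambda>d. norm (h2_trunc d x - x)) \<longlonglongrightarrow> 0"
    using tendsto_real_sqrt[of _ 0] by fastforce
  then show ?thesis by (simp add: tendsto_norm_zero_iff LIM_zero_iff)
qed

lemma bounded_clinear_zero_on_mono:
  assumes F: "bounded_clinear F" and z: "\<And>n. F (h2_mono n (1::complex)) = 0"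
  shows "F x = 0"
proof -
  have "F (h2_trunc d x) = 0" for d
    unfolding h2_trunc_def by (simp add: bounded_clinear_sum[OF F] bounded_clinearD[OF F] z)
  moreover have "(\<lambda>d. F (h2_trunc d x)) \<longlonglongrightarrow> F x"
    by (rule bounded_clinear_tendsto[OF F h2_trunc_tendsto])
  ultimately show ?thesis by (simp add: LIMSEQ_const_iff)
qed

lemma h2_shift_mono: "h2_shift (h2_mono n d) = h2_mono (Suc n) d"
  by (rule hardy2_eqI) (auto simp: h2_coeff_shift h2_coeff_mono split: nat.split)

lemma h2_shift_pow_mono: "(h2_shift ^^ n) (h2_mono k d) = h2_mono (n + k) d"
  by (induction n) (auto simp: h2_shift_mono)

definition h2_back :: "complex hardy2 \<Rightarrow> complex hardy2" where
  "h2_back x = Abs_hardy2 (\<lambda>k. h2_coeff x (Suc k))"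

lemma h2_coeff_back [simp]: "h2_coeff (h2_back x) k = h2_coeff x (Suc k)"
proof -
  have "summable (\<lambda>k. (norm (h2_coeff x (Suc k)))\<^sup>2)"
    by (subst summable_Suc_iff) (rule summable_h2_coeff)
  then show ?thesis unfolding h2_back_def by (subst Abs_hardy2_coeff) auto
qed

lemma h2_decompose: "x = h2_coeff x 0 *\<^sub>C h2_mono 0 1 + h2_shift (h2_back x)"
  by (rule hardy2_eqI)
    (auto simp: h2_coeff_simps h2_coeff_scaleC h2_coeff_mono h2_coeff_shift scaleC_complex_def split: nat.split)

lemma tendsto_h2_coeff: "(X \<longlongrightarrow> x) F \<Longrightarrow> ((\<lambda>k. h2_coeff (X k) n) \<longlongrightarrow> h2_coeff x n) F"
proof -
  assume X: "(X \<longlongrightarrow> x) F"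
  have "((\<lambda>k. norm (X k - x)) \<longlongrightarrow> 0) F" using X by (simp add: tendsto_norm_zero_iff LIM_zero_iff)
  then have "((\<lambda>k. h2_coeff (X k) n - h2_coeff x n) \<longlongrightarrow> 0) F"
    by (rule Lim_null_comparison[rotated]) (auto simp: norm_h2_coeff_le simp flip: h2_coeff_diff)
  then show ?thesis by (simp add: LIM_zero_iff)
qed

text \<open>Norms determine inner products; this upgrades the shift invariance of
  \<open>norm (R x)\<close> to that of \<open>cinner (R x) (R y)\<close>.\<close>

lemma polarization_cong:
  fixes A :: "'a::complex_hilbert \<Rightarrow> 'b::complex_hilbert" and C :: "'a \<Rightarrow> 'c::complex_hilbert"
  assumes A: "bounded_clinear A" and C: "bounded_clinear C" and n: "\<And>x. norm (A x) = norm (C x)"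
  shows "cinner (A x) (A y) = cinner (C x) (C y)"
proof -
  have re: "Re (cinner (A x) (A y)) = Re (cinner (C x) (C y))" for x y
    using norm_add_sq[of "A x" "A y"] norm_add_sq[of "C x" "C y"] n[of "x + y"] n[of x] n[of y]
    by (simp add: bounded_clinearD[OF A] bounded_clinearD[OF C])
  have "Im (cinner (A x) (A y)) = Im (cinner (C x) (C y))"
    using re[of x "\<i> *\<^sub>C y"] by (simp add: bounded_clinearD[OF A] bounded_clinearD[OF C] cinner_scaleC_right)
  with re[of x y] show ?thesis by (simp add: complex_eq_iff)
qed

lemma bessel_finite:
  fixes g :: "nat \<Rightarrow> 'a::complex_hilbert"
  assumes g: "\<And>n m. cinner (g n) (g m) = (if n = m then 1 else 0)"
  shows "(\<Sum>n<N. (cmod (cinner k (g n)))\<^sup>2) \<le> (norm k)\<^sup>2"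
proof -
  define w where "w = (\<Sum>n<N. cinner k (g n) *\<^sub>C g n)"
  have kw: "cinner k w = complex_of_real (\<Sum>n<N. (cmod (cinner k (g n)))\<^sup>2)"
    unfolding w_def by (simp add: cinner_sum_right cinner_scaleC_right complex_norm_square mult.commute del: of_real_power)
  have gw: "cinner (g n) w = cnj (cinner k (g n))" if "n < N" for n
    using that by (simp add: w_def cinner_sum_right cinner_scaleC_right g if_distrib[of "\<lambda>x. _ * x"] cong: if_cong)
  have "cinner w w = (\<Sum>n<N. cinner k (g n) * cinner (g n) w)"
    by (subst (1) w_def) (simp add: cinner_sum_left cinner_scaleC_left)
  also have "\<dots> = complex_of_real (\<Sum>n<N. (cmod (cinner k (g n)))\<^sup>2)"
    by (simp add: gw complex_norm_square del: of_real_power)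
  finally have ww: "(norm w)\<^sup>2 = (\<Sum>n<N. (cmod (cinner k (g n)))\<^sup>2)"
    unfolding cinner_self by (simp only: of_real_eq_iff)
  have "0 \<le> (norm (k - w))\<^sup>2" by simp
  then show ?thesis unfolding norm_diff_sq kw ww by simp
qed

subsection \<open>The Toeplitz part of the defect operator\<close>

context scalar_schur
begin

lemma beta_shift_pow: "\<beta> n ((h2_shift ^^ N) x) = \<beta> (n + int N) x"
  by (induction N arbitrary: n) (auto simp: beta_shift algebra_simps)

text \<open>Multiplying \<open>x\<close> by \<open>z\<close> moves all frequencies of
  \<open>B^* x\<close> up by one, so the analytic part keeps its coefficients and gains
  \<open>\<beta> 1 x\<close> in slot 0.\<close>

lemma norm_TBs_shift: "(norm (TBs (h2_shift x)))\<^sup>2 = (norm (\<beta> 1 x))\<^sup>2 + (norm (TBs x))\<^sup>2"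
proof -
  have "(norm (TBs (h2_shift x)))\<^sup>2
      = (norm (h2_coeff (TBs (h2_shift x)) 0))\<^sup>2 + (\<Sum>k. (norm (h2_coeff (TBs (h2_shift x)) (Suc k)))\<^sup>2)"
    unfolding norm_h2_sq using suminf_split_head[OF summable_h2_coeff[of "TBs (h2_shift x)"]] by simp
  also have "\<dots> = (norm (\<beta> 1 x))\<^sup>2 + (\<Sum>k. (norm (h2_coeff (TBs x) k))\<^sup>2)"
    by (simp add: TBs_coeff beta_shift)
  finally show ?thesis by (simp add: norm_h2_sq)
qed

lemma norm_TBs_shift_pow:
  "(norm (TBs ((h2_shift ^^ N) x)))\<^sup>2 = (\<Sum>i<N. (norm (\<beta> (int i + 1) x))\<^sup>2) + (norm (TBs x))\<^sup>2"
proof (induction N)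
  case (Suc N)
  then show ?case
    using norm_TBs_shift[of "(h2_shift ^^ N) x"] by (simp add: beta_shift_pow add.commute)
qed simp

lemma norm_shift_pow: "norm ((h2_shift ^^ N) x) = norm x"
  by (induction N) auto

text \<open>Contractivity of \<open>TBs\<close> at \<open>z^N x\<close>, whose image contains the
  first \<open>N\<close> Hankel coefficients of \<open>x\<close>.\<close>

lemma sum_beta_le: "(\<Sum>i<N. (norm (\<beta> (int i + 1) x))\<^sup>2) + (norm (TBs x))\<^sup>2 \<le> (norm x)\<^sup>2"
  using norm_TBs_le[of "(h2_shift ^^ N) x"] unfolding norm_TBs_shift_pow[symmetric] norm_shift_pow
  by (intro power_mono) auto

text \<open>Slot \<open>i\<close> holds the coefficient at frequency \<open>- (i + 1)\<close>;
  frequency 0 belongs to \<open>TBs\<close>.\<close>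

definition Gam :: "complex hardy2 \<Rightarrow> 'd hardy2" where
  "Gam x = Abs_hardy2 (\<lambda>i. \<beta> (int i + 1) x)"

lemma h2_coeff_Gam: "h2_coeff (Gam x) i = \<beta> (int i + 1) x"
proof -
  have "summable (\<lambda>i. (norm (\<beta> (int i + 1) x))\<^sup>2)"
  proof (rule summableI_nonneg_bounded)
    show "(\<Sum>i<N. (norm (\<beta> (int i + 1) x))\<^sup>2) \<le> (norm x)\<^sup>2" for N
      using sum_beta_le[of x N] zero_le_power2[of "norm (TBs x)"] by linarith
  qed simp
  then show ?thesis unfolding Gam_def by (subst Abs_hardy2_coeff) auto
qed

lemma norm_Gam_TBs_le: "(norm (Gam x))\<^sup>2 + (norm (TBs x))\<^sup>2 \<le> (norm x)\<^sup>2"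
proof -
  have "(norm (Gam x))\<^sup>2 \<le> (norm x)\<^sup>2 - (norm (TBs x))\<^sup>2"
    unfolding norm_h2_sq[of "Gam x"]
  proof (rule suminf_le_const[OF summable_h2_coeff])
    show "(\<Sum>i<N. (norm (h2_coeff (Gam x) i))\<^sup>2) \<le> (norm x)\<^sup>2 - (norm (TBs x))\<^sup>2" for N
      using sum_beta_le[of x N] by (simp add: h2_coeff_Gam)
  qed
  then show ?thesis by simp
qed

lemma bounded_clinear_Gam: "bounded_clinear Gam"
proof (rule bounded_clinearI[of _ 1])
  show "norm (Gam x) \<le> 1 * norm x" for x
  proof -
    have "(norm (Gam x))\<^sup>2 \<le> (norm x)\<^sup>2"
      using norm_Gam_TBs_le[of x] zero_le_power2[of "norm (TBs x)"] by linarith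
    then show ?thesis by simp
  qed
  show "Gam (x + y) = Gam x + Gam y" for x y
    by (rule hardy2_eqI) (simp only: h2_coeff_Gam h2_coeff_add beta_linear)
  show "Gam (c *\<^sub>C x) = c *\<^sub>C Gam x" for c x
    by (rule hardy2_eqI) (simp only: h2_coeff_Gam h2_coeff_scaleC beta_linear)
qed

text \<open>The coefficient lost by the Hankel part is the one gained in
  \<open>norm_TBs_shift\<close>, which is why the norm of \<open>R x\<close> does not change under
  the shift.\<close>

lemma norm_Gam_shift: "(norm (Gam x))\<^sup>2 = (norm (\<beta> 1 x))\<^sup>2 + (norm (Gam (h2_shift x)))\<^sup>2"
proof -
  have "(norm (Gam x))\<^sup>2 = (norm (h2_coeff (Gam x) 0))\<^sup>2 + (\<Sum>k. (norm (h2_coeff (Gam x) (Suc k)))\<^sup>2)"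
    unfolding norm_h2_sq using suminf_split_head[OF summable_h2_coeff[of "Gam x"]] by simp
  also have "\<dots> = (norm (\<beta> 1 x))\<^sup>2 + (\<Sum>k. (norm (h2_coeff (Gam (h2_shift x)) k))\<^sup>2)"
    by (simp add: h2_coeff_Gam beta_shift algebra_simps)
  finally show ?thesis by (simp only: norm_h2_sq)
qed

definition Lop :: "complex hardy2 \<Rightarrow> complex hardy2" where "Lop x = x - TB (TBs x)"

definition Top :: "complex hardy2 \<Rightarrow> complex hardy2" where "Top x = x - TB (TBs x) - cadjoint Gam (Gam x)"

lemma cinner_Lop: "cinner (Lop x) x = complex_of_real ((norm x)\<^sup>2 - (norm (TBs x))\<^sup>2)"
  unfolding Lop_def
  by (simp add: cinner_diff_left cadjoint[OF bounded_clinear_TB] cinner_self)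

lemma cinner_Top: "cinner (Top x) x = complex_of_real ((norm x)\<^sup>2 - (norm (TBs x))\<^sup>2 - (norm (Gam x))\<^sup>2)"
  unfolding Top_def
  by (simp add: cinner_diff_left cadjoint[OF bounded_clinear_TB] cadjoint'[OF bounded_clinear_Gam, symmetric] cinner_self)

lemma bounded_clinear_Lop: "bounded_clinear Lop"
  unfolding Lop_def[abs_def]
  by (intro bounded_clinear_diff bounded_clinear_id bounded_clinear_compose[OF bounded_clinear_TB bounded_clinear_TBs])

lemma positive_Lop: "positive_op Lop" "Re (cinner (Lop x) x) \<le> (norm x)\<^sup>2"
  using norm_TBs_le bounded_clinear_Lop by (auto simp: positive_op_def cinner_Lop)

lemma positive_Top: "positive_op Top" "Re (cinner (Top x) x) \<le> (norm x)\<^sup>2"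
proof -
  have "bounded_clinear Top"
    unfolding Top_def[abs_def]
    by (intro bounded_clinear_diff bounded_clinear_id bounded_clinear_compose[OF bounded_clinear_TB bounded_clinear_TBs]
        bounded_clinear_compose[OF bounded_clinear_cadjoint[OF bounded_clinear_Gam] bounded_clinear_Gam])
  moreover have "0 \<le> (norm x)\<^sup>2 - (norm (TBs x))\<^sup>2 - (norm (Gam x))\<^sup>2" for x
    using norm_Gam_TBs_le[of x] by linarith
  ultimately show "positive_op Top" by (auto simp: positive_op_def cinner_Top)
  have "(norm x)\<^sup>2 - (norm (TBs x))\<^sup>2 - (norm (Gam x))\<^sup>2 \<le> (norm x)\<^sup>2"
    using zero_le_power2[of "norm (TBs x)"] zero_le_power2[of "norm (Gam x)"] by linarith
  then show "Re (cinner (Top x) x) \<le> (norm x)\<^sup>2" by (simp add: cinner_Top)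
qed

abbreviation D :: "complex hardy2 \<Rightarrow> complex hardy2" where "D \<equiv> defect_op B"

definition R :: "complex hardy2 \<Rightarrow> complex hardy2" where "R = op_sqrt Top"

lemma D_eq: "D = op_sqrt Lop"
  unfolding defect_op_def Lop_def[abs_def] ..

lemma positive_D: "positive_op D" and D_D: "D (D x) = Lop x"
  unfolding D_eq using op_sqrt[OF positive_Lop] by auto

lemma positive_R: "positive_op R" and R_R: "R (R x) = Top x"
  unfolding R_def using op_sqrt[OF positive_Top] by auto

lemmas bounded_clinear_D = positive_opD(1)[OF positive_D]
lemmas bounded_clinear_R = positive_opD(1)[OF positive_R]

lemma norm_D_sq: "(norm (D x))\<^sup>2 = (norm x)\<^sup>2 - (norm (TBs x))\<^sup>2"
proof -
  have "complex_of_real ((norm (D x))\<^sup>2) = cinner (D (D x)) x"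
    by (simp add: positive_op_selfadjoint[OF positive_D] cinner_self)
  then show ?thesis unfolding D_D cinner_Lop by (simp only: of_real_eq_iff)
qed

lemma norm_R_sq: "(norm (R x))\<^sup>2 = (norm x)\<^sup>2 - (norm (TBs x))\<^sup>2 - (norm (Gam x))\<^sup>2"
proof -
  have "complex_of_real ((norm (R x))\<^sup>2) = cinner (R (R x)) x"
    by (simp add: positive_op_selfadjoint[OF positive_R] cinner_self)
  then show ?thesis unfolding R_R cinner_Top by (simp only: of_real_eq_iff)
qed

text \<open>The form inequality \<open>T \<le> L\<close>. Functionals bounded by
  \<open>norm (R x)\<close> are thereby bounded by \<open>norm (D x)\<close>, and operators
  dominated by \<open>R\<close> send sequences with convergent \<open>D\<close>-images to convergent
  ones.\<close>

lemma norm_R_le_D: "norm (R x) \<le> norm (D x)"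
proof -
  have "(norm (R x))\<^sup>2 \<le> (norm (D x))\<^sup>2" unfolding norm_R_sq norm_D_sq by simp
  then show ?thesis by simp
qed

lemma norm_Gam_le_D: "norm (Gam x) \<le> norm (D x)"
proof -
  have "(norm (Gam x))\<^sup>2 \<le> (norm (D x))\<^sup>2"
    unfolding norm_D_sq using norm_Gam_TBs_le[of x] by linarith
  then show ?thesis by simp
qed

text \<open>\<open>R\<^sup>2\<close> is a Toeplitz operator.\<close>

lemma norm_R_shift [simp]: "norm (R (h2_shift x)) = norm (R x)"
proof -
  have "(norm (R (h2_shift x)))\<^sup>2 = (norm (R x))\<^sup>2"
    using norm_Gam_shift[of x] norm_TBs_shift[of x] by (simp add: norm_R_sq)
  then show ?thesis by simp
qed

lemma cinner_R_shift: "cinner (R (h2_shift x)) (R (h2_shift y)) = cinner (R x) (R y)"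
  by (rule polarization_cong[OF bounded_clinear_compose[OF bounded_clinear_R bounded_clinear_h2_shift] bounded_clinear_R])
    simp

end

subsection \<open>An outer factor of the Toeplitz part\<close>

text \<open>The lower bound is the only analytic information that the operator-theoretic half needs.
  The constant will be the geometric mean of \<open>1 - BB^*\<close>.\<close>

locale szego_schur = scalar_schur +
  fixes c :: real
  assumes c_pos: "0 < c" and szego: "c * (cmod (h2_coeff x 0))\<^sup>2 \<le> (norm (R x))\<^sup>2"
begin

lemma norm_R_shift_pow: "norm (R ((h2_shift ^^ n) x)) = norm (R x)"
  by (induction n) auto

lemma cinner_R_shift_pow: "cinner (R ((h2_shift ^^ n) x)) (R ((h2_shift ^^ n) y)) = cinner (R x) (R y)"
  by (induction n) (auto simp: cinner_R_shift)

lemma bounded_clinear_shift_pow: "bounded_clinear (h2_shift ^^ n)"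
  by (induction n) (auto simp: bounded_clinear_id id_def o_def bounded_clinear_compose[OF bounded_clinear_h2_shift])

lemma coeff_0_bound: "cmod (h2_coeff x 0) \<le> 1 / sqrt c * norm (R x)"
proof -
  have "(sqrt c * cmod (h2_coeff x 0))\<^sup>2 \<le> (norm (R x))\<^sup>2"
    using szego[of x] c_pos by (simp add: power_mult_distrib)
  then have "sqrt c * cmod (h2_coeff x 0) \<le> norm (R x)" by (rule power2_le_imp_le) simp
  then show ?thesis using c_pos by (simp add: field_simps)
qed

text \<open>Induction by stripping off the constant term: with \<open>x = x(0) + z y\<close>, shift
  invariance gives \<open>\<parallel>R y\<parallel> = \<parallel>R (z y)\<parallel> = \<parallel>R x
  - x(0) R 1\<parallel>\<close>, and \<open>x(0)\<close> is already controlled.\<close>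

lemma coeff_bound: "\<exists>C\<ge>0. \<forall>x. cmod (h2_coeff x n) \<le> C * norm (R x)"
proof (induction n)
  case 0
  then show ?case using c_pos coeff_0_bound by (intro exI[of _ "1 / sqrt c"]) auto
next
  case (Suc n)
  then obtain C where C: "0 \<le> C" "\<And>x. cmod (h2_coeff x n) \<le> C * norm (R x)" by blast
  obtain C0 where C0: "0 \<le> C0" "\<And>x. cmod (h2_coeff x 0) \<le> C0 * norm (R x)"
    using coeff_0_bound c_pos by (metis less_imp_le real_sqrt_gt_zero zero_le_divide_1_iff)
  define K where "K = norm (R (h2_mono 0 1))"
  have "cmod (h2_coeff x (Suc n)) \<le> C * (1 + C0 * K) * norm (R x)" for x
  proof -
    have "h2_shift (h2_back x) = x - h2_coeff x 0 *\<^sub>C h2_mono 0 1"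
      using h2_decompose[of x] by (metis add_diff_cancel_left')
    then have "R (h2_shift (h2_back x)) = R x - h2_coeff x 0 *\<^sub>C R (h2_mono 0 1)"
      by (simp add: bounded_clinearD[OF bounded_clinear_R])
    then have "norm (R (h2_back x)) \<le> norm (R x) + cmod (h2_coeff x 0) * K"
      using norm_R_shift[of "h2_back x"] norm_triangle_ineq4[of "R x" "h2_coeff x 0 *\<^sub>C R (h2_mono 0 1)"]
      by (simp add: norm_scaleC K_def)
    also have "\<dots> \<le> norm (R x) + (C0 * norm (R x)) * K"
      by (intro add_left_mono mult_right_mono C0) (simp add: K_def)
    finally have *: "norm (R (h2_back x)) \<le> (1 + C0 * K) * norm (R x)" by (simp add: algebra_simps)
    have "cmod (h2_coeff x (Suc n)) = cmod (h2_coeff (h2_back x) n)" by simp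
    also have "\<dots> \<le> C * norm (R (h2_back x))" by (rule C)
    also have "\<dots> \<le> C * ((1 + C0 * K) * norm (R x))" by (intro mult_left_mono * C)
    finally show ?thesis by (simp add: mult.assoc)
  qed
  moreover have "0 \<le> C * (1 + C0 * K)" using C C0 by (simp add: K_def)
  ultimately show ?case by blast
qed

text \<open>The defect of \<open>R 1\<close> from \<open>R z H\<^sup>2\<close> is a wandering vector \<open>f\<^sub>0\<close> of the isometry \<open>R x \<mapsto> R z x\<close>;
  the coefficients of \<open>R x\<close> along its orbit \<open>f\<^sub>n\<close> define the multiplication operator \<open>\<Psi>\<close>.\<close>

lemma outer_factor:
  obtains \<Psi> :: "complex hardy2 \<Rightarrow> complex hardy2" where
    "bounded_clinear \<Psi>" "\<And>x. norm (\<Psi> x) \<le> norm (R x)" "\<And>x. \<Psi> (h2_shift x) = h2_shift (\<Psi> x)"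
    "h2_coeff (\<Psi> (h2_mono 0 1)) 0 \<noteq> 0" "\<And>y. (\<And>x. cinner (\<Psi> x) y = 0) \<Longrightarrow> y = 0"
proof -
  note R' = bounded_clinearD[OF bounded_clinear_R]
  define e0 where "e0 = (h2_mono 0 1 :: complex hardy2)"
  define A where "A x = R (h2_shift x)" for x
  have A: "bounded_clinear A" unfolding A_def[abs_def]
    by (rule bounded_clinear_compose[OF bounded_clinear_R bounded_clinear_h2_shift])
  obtain e where e: "e \<in> closure (range A)" "\<And>v. v \<in> range A \<Longrightarrow> cinner v (R e0 - e) = 0"
    using orthogonal_projection[OF csubspace_range[OF A]] by metis
  define f0 where "f0 = R e0 - e"
  obtain Y where Y: "\<And>k. Y k \<in> range A" "Y \<longlonglongrightarrow> e" using e(1) closure_sequential by metis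
  then have "\<exists>x. Y k = A x" for k by blast
  then obtain X where X: "\<And>k. Y k = A (X k)" by metis
  \<comment> \<open>The projection \<open>e\<close> lies only in the closure of
    \<open>R z H^2\<close>, so \<open>f0\<close> need not be in the range of \<open>R\<close>. The
    vectors \<open>p k\<close>, all with constant coefficient 1, stand in for a preimage.\<close>
  define p where "p k = e0 - h2_shift (X k)" for k
  have Rp: "(\<lambda>k. R (p k)) \<longlonglongrightarrow> f0"
  proof -
    have "R (p k) = R e0 - Y k" for k by (simp add: p_def R' X A_def)
    then show ?thesis unfolding f0_def using tendsto_diff[OF tendsto_const Y(2)] by simp
  qed
  have f0_orth: "cinner (R (h2_shift x)) f0 = 0" for x
    unfolding f0_def using e(2)[of "A x"] by (simp add: A_def)
  have f0_e: "cinner e f0 = 0"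
  proof -
    have "(\<lambda>k. cinner (Y k) f0) \<longlonglongrightarrow> cinner e f0" by (intro tendsto_intros Y)
    moreover have "cinner (Y k) f0 = 0" for k unfolding X A_def by (rule f0_orth)
    ultimately show ?thesis by (simp add: LIMSEQ_const_iff)
  qed
  \<comment> \<open>Each \<open>p k\<close> has constant coefficient 1, so the Szego bound gives
    \<open>c \<le> s^2\<close>; the wandering vector does not vanish.\<close>
  define s where "s = norm f0"
  have s: "s > 0"
  proof -
    have "c \<le> (norm (R (p k)))\<^sup>2" for k
      using szego[of "p k"] by (simp add: p_def e0_def h2_coeff_simps h2_coeff_mono)
    moreover have "(\<lambda>k. (norm (R (p k)))\<^sup>2) \<longlonglongrightarrow> s\<^sup>2" unfolding s_def by (intro tendsto_intros Rp)
    ultimately have "c \<le> s\<^sup>2" by (intro LIMSEQ_le_const) auto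
    then show ?thesis using c_pos by (metis less_le_trans norm_ge_zero order.not_eq_order_implies_strict power_zero_numeral s_def less_irrefl)
  qed
  \<comment> \<open>The isometry \<open>R x \<mapsto> R (z^n x)\<close> preserves the Cauchy
    property; the limit \<open>f n\<close> is the image of \<open>f0\<close> under its
    extension.\<close>
  have "\<exists>l. (\<lambda>k. R ((h2_shift ^^ n) (p k))) \<longlonglongrightarrow> l" for n
  proof -
    have "Cauchy (\<lambda>k. R (p k))" using Rp by (rule LIMSEQ_imp_Cauchy)
    moreover have "norm (R ((h2_shift ^^ n) (p k)) - R ((h2_shift ^^ n) (p m))) = norm (R (p k) - R (p m))" for k m
      using norm_R_shift_pow[of n "p k - p m"] by (simp add: R' bounded_clinearD[OF bounded_clinear_shift_pow])
    ultimately have "Cauchy (\<lambda>k. R ((h2_shift ^^ n) (p k)))" by (simp add: Cauchy_iff)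
    then show ?thesis using Cauchy_convergent convergent_def by blast
  qed
  then obtain f where f: "\<And>n. (\<lambda>k. R ((h2_shift ^^ n) (p k))) \<longlonglongrightarrow> f n" by metis
  have f_0: "f 0 = f0" using LIMSEQ_unique[OF f[of 0]] Rp by simp
  have orth: "cinner (R ((h2_shift ^^ n) (h2_shift x))) (f n) = 0" for n x
  proof -
    have "(\<lambda>k. cinner (R ((h2_shift ^^ n) (h2_shift x))) (R ((h2_shift ^^ n) (p k))))
        \<longlonglongrightarrow> cinner (R ((h2_shift ^^ n) (h2_shift x))) (f n)"
      by (intro tendsto_intros f)
    moreover have "(\<lambda>k. cinner (R (h2_shift x)) (R (p k))) \<longlonglongrightarrow> cinner (R (h2_shift x)) f0"
      by (intro tendsto_intros Rp)
    ultimately show ?thesis unfolding cinner_R_shift_pow f0_orth by (rule LIMSEQ_unique)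
  qed
  have step: "cinner (R (h2_shift x)) (f (Suc n)) = cinner (R x) (f n)" for n x
  proof -
    have "(\<lambda>k. cinner (R (h2_shift x)) (R (h2_shift ((h2_shift ^^ n) (p k))))) \<longlonglongrightarrow> cinner (R (h2_shift x)) (f (Suc n))"
      using f[of "Suc n"] by (intro tendsto_intros) simp
    moreover have "(\<lambda>k. cinner (R x) (R ((h2_shift ^^ n) (p k)))) \<longlonglongrightarrow> cinner (R x) (f n)"
      by (intro tendsto_intros f)
    ultimately show ?thesis unfolding cinner_R_shift by (rule LIMSEQ_unique)
  qed
  have nf: "norm (f n) = s" for n
  proof -
    have "(\<lambda>k. norm (R (p k))) \<longlonglongrightarrow> norm (f n)"
      using tendsto_norm[OF f[of n]] by (simp add: norm_R_shift_pow)
    moreover have "(\<lambda>k. norm (R (p k))) \<longlonglongrightarrow> s" unfolding s_def by (intro tendsto_intros Rp)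
    ultimately show ?thesis by (rule LIMSEQ_unique)
  qed
  have f_orth_less: "cinner (f m) (f n) = 0" if nm: "n < m" for m n
  proof -
    obtain j where j: "m = Suc (n + j)" using nm less_iff_Suc_add by auto
    have "(\<lambda>k. cinner (R ((h2_shift ^^ m) (p k))) (f n)) \<longlonglongrightarrow> cinner (f m) (f n)"
      by (intro tendsto_intros f)
    moreover have "(h2_shift ^^ m) y = (h2_shift ^^ n) (h2_shift ((h2_shift ^^ j) y))" for y :: "complex hardy2"
      unfolding j by (simp add: funpow_add funpow_swap1)
    ultimately show ?thesis by (simp add: orth LIMSEQ_const_iff)
  qed
  define g where "g n = (1 / s) *\<^sub>R f n" for n
  have g_on: "cinner (g n) (g m) = (if n = m then 1 else 0)" for n m
  proof (cases "n = m")
    case True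
    then show ?thesis using s by (simp add: g_def cinner_scaleR_left cinner_scaleR_right cinner_self nf power2_eq_square)
  next
    case False
    have "cinner (f n) (f m) = 0"
    proof (cases "n < m")
      case True
      then have "cnj (cinner (f n) (f m)) = 0" using f_orth_less[of n m] by (simp flip: cinner_commute)
      then show ?thesis by simp
    qed (use False f_orth_less[of m n] in auto)
    then show ?thesis using False by (simp add: g_def cinner_scaleR_left cinner_scaleR_right)
  qed
  \<comment> \<open>\<open>J\<close> reads off coordinates along the orthonormal orbit
    \<open>g n\<close>; by Bessel's inequality it is a contraction into \<open>H^2\<close>.\<close>
  define J where "J k = Abs_hardy2 (\<lambda>n. cinner k (g n))" for k
  have Jc: "h2_coeff (J k) n = cinner k (g n)" for k n
  proof -
    have "summable (\<lambda>n. (cmod (cinner k (g n)))\<^sup>2)"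
      by (rule summableI_nonneg_bounded[OF _ bessel_finite[OF g_on]]) simp
    then show ?thesis unfolding J_def by (subst Abs_hardy2_coeff) auto
  qed
  have Jn: "norm (J k) \<le> norm k" for k
    by (rule norm_h2_le) (simp_all add: Jc bessel_finite[OF g_on])
  have J: "bounded_clinear J"
  proof (rule bounded_clinearI[of _ 1])
    show "J (x + y) = J x + J y" for x y by (rule hardy2_eqI) (simp add: Jc h2_coeff_add cinner_add_left)
    show "J (a *\<^sub>C x) = a *\<^sub>C J x" for a x
      by (rule hardy2_eqI) (simp add: Jc h2_coeff_scaleC cinner_scaleC_left scaleC_complex_def)
  qed (simp add: Jn)
  have Jf0: "J f0 = complex_of_real s *\<^sub>C e0"
  proof (rule hardy2_eqI)
    fix n
    have "f0 = s *\<^sub>R g 0" using s by (simp add: g_def f_0)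
    then have "cinner f0 (g n) = (if n = 0 then complex_of_real s else 0)"
      by (simp add: cinner_scaleR_left g_on)
    then show "h2_coeff (J f0) n = h2_coeff (complex_of_real s *\<^sub>C e0) n"
      by (simp add: Jc h2_coeff_scaleC e0_def h2_coeff_mono scaleC_complex_def)
  qed
  define \<Psi> where "\<Psi> x = J (R x)" for x
  have \<Psi>: "bounded_clinear \<Psi>" unfolding \<Psi>_def[abs_def] by (rule bounded_clinear_compose[OF J bounded_clinear_R])
  have \<Psi>n: "norm (\<Psi> x) \<le> norm (R x)" for x unfolding \<Psi>_def by (rule Jn)
  have \<Psi>S: "\<Psi> (h2_shift x) = h2_shift (\<Psi> x)" for x
  proof (rule hardy2_eqI)
    show "h2_coeff (\<Psi> (h2_shift x)) n = h2_coeff (h2_shift (\<Psi> x)) n" for n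
    proof (cases n)
      case 0
      then show ?thesis using f0_orth by (simp add: \<Psi>_def Jc g_def cinner_scaleR_right f_0)
    next
      case (Suc m)
      then show ?thesis by (simp add: \<Psi>_def Jc g_def cinner_scaleR_right step)
    qed
  qed
  have \<Psi>S': "\<Psi> ((h2_shift ^^ n) x) = (h2_shift ^^ n) (\<Psi> x)" for n x
    by (induction n) (auto simp: \<Psi>S)
  have \<Psi>0: "h2_coeff (\<Psi> (h2_mono 0 1)) 0 \<noteq> 0"
  proof -
    have "cinner (R e0) f0 = cinner f0 f0" using f0_e by (simp add: f0_def cinner_diff_left)
    then have "h2_coeff (\<Psi> e0) 0 = complex_of_real (s\<^sup>2 / s)"
      using s by (simp add: \<Psi>_def Jc g_def cinner_scaleR_right f_0 cinner_self s_def)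
    then show ?thesis using s by (simp add: e0_def)
  qed
  \<comment> \<open>\<open>\<Psi> (p k)\<close> tends to \<open>J f0\<close>, the constant
    \<open>s\<close>, and its shifts to \<open>s z^n\<close>. Orthogonality to the range therefore
    kills every coefficient of \<open>y\<close>.\<close>
  have dense: "y = 0" if y: "\<And>x. cinner (\<Psi> x) y = 0" for y
  proof (rule hardy2_eqI)
    fix n
    have "(\<lambda>k. \<Psi> (p k)) \<longlonglongrightarrow> complex_of_real s *\<^sub>C e0"
      unfolding \<Psi>_def Jf0[symmetric] by (rule bounded_clinear_tendsto[OF J Rp])
    then have "(\<lambda>k. cinner ((h2_shift ^^ n) (\<Psi> (p k))) y) \<longlonglongrightarrow> cinner ((h2_shift ^^ n) (complex_of_real s *\<^sub>C e0)) y"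
      by (intro tendsto_intros bounded_clinear_tendsto[OF bounded_clinear_shift_pow])
    then have "cinner ((h2_shift ^^ n) (complex_of_real s *\<^sub>C e0)) y = 0"
      unfolding \<Psi>S'[symmetric] y by (simp add: LIMSEQ_const_iff)
    then show "h2_coeff y n = h2_coeff 0 n"
      using s by (simp add: bounded_clinearD[OF bounded_clinear_shift_pow] e0_def h2_shift_pow_mono
          cinner_scaleC_left cinner_h2_mono cinner_complex_def h2_coeff_zero)
  qed
  show thesis using that[OF \<Psi> \<Psi>n \<Psi>S \<Psi>0 dense] by blast
qed

end

subsection \<open>Density of the polynomials\<close>

lemma cinner_h2_shift: "cinner (h2_shift a) b = cinner a (h2_back b)"
  unfolding cinner_h2
  using suminf_split_head[OF summable_h2_cinner[of "h2_shift a" b]] by simp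

lemma cinner_h2_shift_pow: "cinner ((h2_shift ^^ n) a) b = cinner a ((h2_back ^^ n) b)"
  by (induction n arbitrary: b) (simp_all add: cinner_h2_shift funpow_swap1[of h2_back])

lemma h2_coeff_back_pow: "h2_coeff ((h2_back ^^ n) b) j = h2_coeff b (n + j)"
  by (induction n arbitrary: j) simp_all

text \<open>Reduces the vector-valued Hankel image to scalar Hardy functions, where the dense range
  of \<Psi> can be used.\<close>

definition h2_pair :: "'d::complex_hilbert \<Rightarrow> 'd hardy2 \<Rightarrow> complex hardy2" where
  "h2_pair d y = Abs_hardy2 (\<lambda>j. cinner d (h2_coeff y j))"

lemma h2_coeff_pair: "h2_coeff (h2_pair d y) j = cinner d (h2_coeff y j)"
  and norm_h2_pair_le: "norm (h2_pair d y) \<le> norm d * norm y"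
proof -
  have le: "(cmod (cinner d (h2_coeff y j)))\<^sup>2 \<le> (norm d)\<^sup>2 * (norm (h2_coeff y j))\<^sup>2" for j
    using power_mono[OF Cauchy_Schwarz_cinner[of d "h2_coeff y j"], of 2] by (simp add: power_mult_distrib)
  have s: "summable (\<lambda>j. (cmod (cinner d (h2_coeff y j)))\<^sup>2)"
    by (rule summable_comparison_test'[OF summable_mult[OF summable_h2_coeff[of y], of "(norm d)\<^sup>2"]])
      (use le in simp)
  then show c: "h2_coeff (h2_pair d y) j = cinner d (h2_coeff y j)" for j
    unfolding h2_pair_def by (subst Abs_hardy2_coeff) auto
  have "(norm (h2_pair d y))\<^sup>2 \<le> (norm d)\<^sup>2 * (norm y)\<^sup>2"
    unfolding norm_h2_sq c suminf_mult[OF summable_h2_coeff, symmetric]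
    by (intro suminf_le le s summable_mult summable_h2_coeff)
  then have "(norm (h2_pair d y))\<^sup>2 \<le> (norm d * norm y)\<^sup>2" by (simp add: power_mult_distrib)
  then show "norm (h2_pair d y) \<le> norm d * norm y" by (rule power2_le_imp_le) simp
qed

lemma tendsto_h2_pair: "(X \<longlongrightarrow> y) F \<Longrightarrow> ((\<lambda>k. h2_pair d (X k)) \<longlongrightarrow> h2_pair d y) F"
proof -
  assume X: "(X \<longlongrightarrow> y) F"
  have lim: "((\<lambda>k. norm d * norm (X k - y)) \<longlongrightarrow> norm d * 0) F"
    using X by (intro tendsto_intros) (simp add: tendsto_norm_zero_iff LIM_zero_iff)
  have "h2_pair d (X k) - h2_pair d y = h2_pair d (X k - y)" for k
    by (rule hardy2_eqI) (simp add: h2_coeff_diff h2_coeff_pair cinner_diff_right)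
  then have "norm (h2_pair d (X k) - h2_pair d y) \<le> norm d * norm (X k - y)" for k
    by (simp only: norm_h2_pair_le)
  then have "((\<lambda>k. h2_pair d (X k) - h2_pair d y) \<longlongrightarrow> 0) F"
    by (rule Lim_null_comparison[OF always_eventually[OF allI]]) (use lim in simp)
  then show ?thesis by (simp add: LIM_zero_iff)
qed

lemma h2_polynomials_iff: "f \<in> h2_polynomials \<longleftrightarrow> (\<exists>d a. f = (\<Sum>j\<le>d. a j *\<^sub>C h2_mono j (1::complex)))"
proof
  assume "f \<in> h2_polynomials"
  then obtain p where p: "\<And>z. z \<in> ball 0 1 \<Longrightarrow> h2_eval f z = poly p z" by (auto simp: h2_polynomials_def)
  have "h2_coeff f n = coeff p n" for n
  proof (rule h2_coeff_unique)
    fix z :: complex assume z: "cmod z < 1"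
    have "(\<lambda>n. coeff p n * z ^ n) sums poly p z"
      unfolding poly_altdef by (rule sums_finite) (auto simp: coeff_eq_0)
    then show "(\<lambda>n. z ^ n * coeff p n) sums h2_eval f z" using p z by (simp add: mult.commute)
  qed
  then have "f = (\<Sum>j\<le>degree p. coeff p j *\<^sub>C h2_mono j 1)"
    by (intro hardy2_eqI) (auto simp: h2_coeff_lincomb_mono coeff_eq_0)
  then show "\<exists>d a. f = (\<Sum>j\<le>d. a j *\<^sub>C h2_mono j 1)" by blast
next
  assume "\<exists>d a. f = (\<Sum>j\<le>d. a j *\<^sub>C h2_mono j (1::complex))"
  then obtain d a where f: "f = (\<Sum>j\<le>d. a j *\<^sub>C h2_mono j 1)" by blast
  define p where "p = (\<Sum>j\<le>d. monom (a j) j)"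
  have "h2_eval f z = poly p z" for z
  proof -
    have "(\<lambda>n. z ^ n *\<^sub>C h2_coeff f n) sums (\<Sum>n\<le>d. z ^ n *\<^sub>C h2_coeff f n)"
      by (rule sums_finite) (auto simp: f h2_coeff_lincomb_mono)
    then have "h2_eval f z = (\<Sum>n\<le>d. z ^ n *\<^sub>C h2_coeff f n)" by (simp add: h2_eval_def sums_iff)
    also have "\<dots> = poly p z"
      by (simp add: p_def poly_sum poly_monom f h2_coeff_lincomb_mono scaleC_complex_def mult.commute)
    finally show ?thesis .
  qed
  then show "f \<in> h2_polynomials" by (auto simp: h2_polynomials_def)
qed

text \<open>Both sides run over the triples of indices with sum \<open>m\<close>, bracketed in two
  ways: associativity of convolution.\<close>

lemma convolution_assoc_sum:
  fixes F :: "nat \<Rightarrow> nat \<Rightarrow> nat \<Rightarrow> 'a::comm_monoid_add"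
  shows "(\<Sum>j\<le>m. \<Sum>k\<le>j. F (m - j) k (j - k)) = (\<Sum>l\<le>m. \<Sum>i\<le>l. F i (l - i) (m - l))"
  unfolding sum.Sigma[OF finite_atMost ballI[OF finite_atMost]]
  by (rule sum.reindex_bij_witness[where i = "\<lambda>(l, i). (m - i, l - i)" and j = "\<lambda>(j, k). (m - j + k, m - j)"])
    (auto simp: Suc_diff_le)

context szego_schur
begin

text \<open>The \<open>n\<close>-th coefficient functional is bounded by \<open>norm (R x)\<close>,
  hence by \<open>norm (D x)\<close>; the range criterion does the rest.\<close>

lemma monomial_in_range: "\<exists>e. D e = h2_mono n 1 \<and> e \<in> closure (range D)"
proof -
  obtain C where C: "0 \<le> C" "\<And>x. cmod (h2_coeff x n) \<le> C * norm (R x)" using coeff_bound by blast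
  have "cmod (cinner x (h2_mono n 1)) \<le> C * norm (D x)" for x
    using order_trans[OF C(2) mult_left_mono[OF norm_R_le_D C(1)]]
    by (simp add: cinner_h2_mono_right cinner_complex_def)
  then show ?thesis using in_range_positive_op[OF positive_D] by metis
qed

lemma density_key:
  assumes e: "\<And>n. D (e n) = h2_mono n 1" and u: "u \<in> closure (range D)" "\<And>n. cinner u (e n) = 0"
  shows "u = 0"
proof -
  obtain \<Psi> :: "complex hardy2 \<Rightarrow> complex hardy2" where \<Psi>: "bounded_clinear \<Psi>"
    and \<Psi>R: "\<And>x. norm (\<Psi> x) \<le> norm (R x)" and \<Psi>S: "\<And>x. \<Psi> (h2_shift x) = h2_shift (\<Psi> x)"
    and \<psi>0: "h2_coeff (\<Psi> (h2_mono 0 1)) 0 \<noteq> 0" and dense: "\<And>y. (\<And>x. cinner (\<Psi> x) y = 0) \<Longrightarrow> y = 0"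
    using outer_factor by metis
  define \<psi> where "\<psi> = \<Psi> (h2_mono 0 1)"
  have \<Psi>mono: "\<Psi> (h2_mono n 1) = (h2_shift ^^ n) \<psi>" for n
  proof -
    have "\<Psi> ((h2_shift ^^ n) x) = (h2_shift ^^ n) (\<Psi> x)" for x by (induction n) (auto simp: \<Psi>S)
    from this[of "h2_mono 0 1"] show ?thesis by (simp add: h2_shift_pow_mono \<psi>_def)
  qed
  have \<Psi>coeff: "h2_coeff (\<Psi> x) n = (\<Sum>j\<le>n. h2_coeff x j * h2_coeff \<psi> (n - j))" for x n
  proof -
    have dec: "\<Psi> x = h2_coeff x 0 *\<^sub>C \<psi> + h2_shift (\<Psi> (h2_back x))" for x
      by (subst h2_decompose[of x]) (simp only: bounded_clinearD[OF \<Psi>] \<Psi>S \<psi>_def)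
    show ?thesis
    proof (induction n arbitrary: x)
      case 0
      then show ?case by (subst dec) (simp add: h2_coeff_add h2_coeff_scaleC scaleC_complex_def)
    next
      case (Suc n)
      then show ?case
        by (subst dec) (simp add: h2_coeff_add h2_coeff_scaleC scaleC_complex_def sum.atMost_Suc_shift
              del: sum.atMost_Suc)
    qed
  qed
  \<comment> \<open>Commuting with the shift makes \<open>\<Psi>\<close> a lower triangular Toeplitz
    matrix with diagonal entry \<open>\<psi> 0 \<noteq> 0\<close>, so the coefficients of
    \<open>x\<close> vanish one after another.\<close>
  have \<Psi>inj: "x = 0" if z: "\<Psi> x = 0" for x
  proof (rule hardy2_eqI)
    have "h2_coeff x n = 0" for n
    proof (induction n rule: less_induct)
      case (less n)
      have "0 = (\<Sum>j\<le>n. h2_coeff x j * h2_coeff \<psi> (n - j))" using \<Psi>coeff[of x n] z by (simp add: h2_coeff_zero)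
      also have "\<dots> = (\<Sum>j\<in>{n}. h2_coeff x j * h2_coeff \<psi> (n - j))"
        by (rule sum.mono_neutral_right) (auto simp: less)
      finally show ?case using \<psi>0 by (simp add: \<psi>_def)
    qed
    then show "h2_coeff x n = h2_coeff 0 n" for n by (simp add: h2_coeff_zero)
  qed
  \<comment> \<open>Proved for monomials and extended by finite sums, so that no infinite sums have
    to be interchanged; this is why the approximating sequence consists of polynomials.\<close>
  have beta_shift_psi: "(\<lambda>j. h2_coeff \<psi> j *\<^sub>C \<beta> (n + int j) (h2_mono k 1)) sums \<beta> n (\<Psi> (h2_mono k 1))" for n k
  proof -
    have "(\<lambda>m. h2_coeff (h2_mono k 1) m *\<^sub>C bz (int m + i)) sums bz (int k + i)" for i
      using sums_single[of k "\<lambda>m. bz (int m + i)"]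
      by (rule sums_cong[THEN iffD1, rotated]) (simp add: h2_coeff_mono)
    then have bm: "\<beta> i (h2_mono k 1) = bz (int k + i)" for i unfolding \<beta>_def by (simp add: sums_iff)
    have "\<beta> n (\<Psi> (h2_mono k 1)) = (\<Sum>j. h2_coeff \<psi> j *\<^sub>C bz (int j + (n + int k)))"
      unfolding \<Psi>mono beta_shift_pow by (simp add: \<beta>_def)
    then show ?thesis
      using summable_sums[OF summable_norm_cancel[OF summable_beta[of \<psi> "n + int k"]]]
      by (simp add: bm algebra_simps)
  qed
  have beta_psi: "(\<lambda>j. h2_coeff \<psi> j *\<^sub>C \<beta> (n + int j) (h2_trunc d x)) sums \<beta> n (\<Psi> (h2_trunc d x))" for n d x
  proof -
    have "(\<lambda>j. \<Sum>k\<le>d. h2_coeff x k *\<^sub>C (h2_coeff \<psi> j *\<^sub>C \<beta> (n + int j) (h2_mono k 1)))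
        sums (\<Sum>k\<le>d. h2_coeff x k *\<^sub>C \<beta> n (\<Psi> (h2_mono k 1)))"
      by (intro sums_sum bounded_linear.sums[OF bounded_linear_scaleC_right] beta_shift_psi)
    moreover have "(\<Sum>k\<le>d. h2_coeff x k *\<^sub>C (h2_coeff \<psi> j *\<^sub>C \<beta> (n + int j) (h2_mono k 1)))
        = h2_coeff \<psi> j *\<^sub>C \<beta> (n + int j) (h2_trunc d x)" for j
      by (simp add: h2_trunc_def bounded_clinear_sum[OF bounded_clinear_beta] beta_linear scaleC_sum_right
          scaleC_scaleC mult.commute)
    moreover have "(\<Sum>k\<le>d. h2_coeff x k *\<^sub>C \<beta> n (\<Psi> (h2_mono k 1))) = \<beta> n (\<Psi> (h2_trunc d x))"
      by (simp add: h2_trunc_def bounded_clinear_sum[OF \<Psi>] bounded_clinearD[OF \<Psi>]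
          bounded_clinear_sum[OF bounded_clinear_beta] beta_linear)
    ultimately show ?thesis by simp
  qed
  \<comment> \<open>Multiplication by the analytic \<open>\<psi>\<close> only raises frequencies. A
    negative frequency of \<open>B^* \<Psi> x\<close> thus uses negative ones of
    \<open>B^* x\<close> alone, which are in \<open>Gam x\<close>; frequency
    \<open>i \<ge> 0\<close> uses in addition the finitely many from 0 to \<open>i\<close>.\<close>
  have pos: "cinner (\<beta> (int i + 1) (\<Psi> x)) d = cinner ((h2_shift ^^ i) \<psi>) (h2_pair d (Gam x))"
    and neg: "cinner (\<beta> (- int i) (\<Psi> x)) d
      = cinner (\<Sum>j\<le>i. h2_coeff \<psi> j *\<^sub>C \<beta> (int j - int i) x) d + cinner ((h2_back ^^ Suc i) \<psi>) (h2_pair d (Gam x))"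
    if x: "x = h2_trunc N z" for x z N i d
  proof -
    have s: "(\<lambda>j. cinner (h2_coeff \<psi> j *\<^sub>C \<beta> (n + int j) x) d) sums cinner (\<beta> n (\<Psi> x)) d" for n
      unfolding x by (rule bounded_linear.sums[OF bounded_linear_cinner_left beta_psi])
    have G: "cinner a (\<beta> (int j + 1) x) = h2_coeff (h2_pair a (Gam x)) j" for a j
      by (simp add: h2_coeff_pair h2_coeff_Gam)
    have G': "cinner (q *\<^sub>C \<beta> (int j + 1) x) d = cinner q (h2_coeff (h2_pair d (Gam x)) j)" for q j
      unfolding G[symmetric] cinner_complex_def cinner_scaleC_left cinner_commute[of d] by simp
    have "cinner (\<beta> (int i + 1) (\<Psi> x)) d = (\<Sum>j. cinner (h2_coeff \<psi> j) (h2_coeff (h2_pair d (Gam x)) (i + j)))"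
      using s[of "int i + 1"] G'[of _ "i + _"] by (simp add: sums_iff algebra_simps)
    then show "cinner (\<beta> (int i + 1) (\<Psi> x)) d = cinner ((h2_shift ^^ i) \<psi>) (h2_pair d (Gam x))"
      unfolding cinner_h2_shift_pow by (simp add: cinner_h2 h2_coeff_back_pow)
    have "cinner (\<beta> (- int i) (\<Psi> x)) d
        = (\<Sum>j<Suc i. cinner (h2_coeff \<psi> j *\<^sub>C \<beta> (- int i + int j) x) d)
          + (\<Sum>j. cinner (h2_coeff \<psi> (j + Suc i) *\<^sub>C \<beta> (- int i + int (j + Suc i)) x) d)"
      using suminf_split_initial_segment[OF sums_summable[OF s[of "- int i"]], of "Suc i"] s[of "- int i"]
      by (simp add: sums_iff add.commute)
    also have "(\<Sum>j. cinner (h2_coeff \<psi> (j + Suc i) *\<^sub>C \<beta> (- int i + int (j + Suc i)) x) d)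
        = cinner ((h2_back ^^ Suc i) \<psi>) (h2_pair d (Gam x))"
      unfolding cinner_h2 h2_coeff_back_pow
    proof (rule suminf_cong)
      fix j
      have "- int i + int (j + Suc i) = int j + 1" by simp
      then show "cinner (h2_coeff \<psi> (j + Suc i) *\<^sub>C \<beta> (- int i + int (j + Suc i)) x) d
          = cinner (h2_coeff \<psi> (Suc i + j)) (h2_coeff (h2_pair d (Gam x)) j)"
        by (simp only: G' add.commute[of j "Suc i"])
    qed
    also have "(\<Sum>j<Suc i. cinner (h2_coeff \<psi> j *\<^sub>C \<beta> (- int i + int j) x) d)
        = cinner (\<Sum>j\<le>i. h2_coeff \<psi> j *\<^sub>C \<beta> (int j - int i) x) d"
      unfolding cinner_sum_left lessThan_Suc_atMost by (simp add: algebra_simps)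
    finally show "cinner (\<beta> (- int i) (\<Psi> x)) d
      = cinner (\<Sum>j\<le>i. h2_coeff \<psi> j *\<^sub>C \<beta> (int j - int i) x) d + cinner ((h2_back ^^ Suc i) \<psi>) (h2_pair d (Gam x))" .
  qed
  note D' = bounded_clinearD[OF bounded_clinear_D]
  obtain Y where Y: "\<And>k. Y k \<in> range D" "Y \<longlonglongrightarrow> u" using u(1) closure_sequential by metis
  \<comment> \<open>Each \<open>Y k\<close> is some \<open>D z\<close>, and truncating
    \<open>z\<close> far enough out changes \<open>D z\<close> arbitrarily little.\<close>
  have "\<exists>z N. norm (D (h2_trunc N z) - Y k) < 1 / real (Suc k)" for k
  proof -
    obtain z where z: "Y k = D z" using Y(1) by blast
    have "(\<lambda>N. D (h2_trunc N z)) \<longlonglongrightarrow> D z"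
      by (rule bounded_clinear_tendsto[OF bounded_clinear_D h2_trunc_tendsto])
    then have "\<forall>\<^sub>F N in sequentially. dist (D (h2_trunc N z)) (D z) < 1 / real (Suc k)"
      by (rule tendstoD) simp
    then show ?thesis unfolding z dist_norm eventually_sequentially by blast
  qed
  then obtain z N where zN: "\<And>k. norm (D (h2_trunc (N k) (z k)) - Y k) < 1 / real (Suc k)" by metis
  define X where "X k = h2_trunc (N k) (z k)" for k
  have DX: "(\<lambda>k. D (X k)) \<longlonglongrightarrow> u"
  proof -
    have "(\<lambda>k. D (X k) - Y k) \<longlonglongrightarrow> 0"
    proof (rule Lim_null_comparison)
      show "\<forall>\<^sub>F k in sequentially. norm (D (X k) - Y k) \<le> 1 / real (Suc k)"
        using zN by (auto simp: X_def intro!: always_eventually less_imp_le)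
    qed (rule LIMSEQ_inverse_real_of_nat[unfolded inverse_eq_divide])
    from tendsto_add[OF this Y(2)] show ?thesis by simp
  qed
  \<comment> \<open>Self-adjointness identifies the \<open>n\<close>-th coefficient of
    \<open>X k\<close> with \<open><D (X k), e n>\<close>, which tends to
    \<open><u, e n> = 0\<close>.\<close>
  have X0: "(\<lambda>k. h2_coeff (X k) n) \<longlonglongrightarrow> 0" for n
  proof -
    have "h2_coeff (X k) n = cinner (D (X k)) (e n)" for k
      by (simp add: positive_op_selfadjoint[OF positive_D] e cinner_h2_mono_right cinner_complex_def)
    moreover have "(\<lambda>k. cinner (D (X k)) (e n)) \<longlonglongrightarrow> cinner u (e n)" by (intro tendsto_intros DX)
    ultimately show ?thesis using u(2) by simp
  qed
  \<comment> \<open>Without control of \<open>X k\<close> itself, limits are available only through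
    operators dominated by \<open>D\<close>.\<close>
  have conv: "convergent (\<lambda>k. A (X k))"
    if A: "bounded_clinear A" "\<And>x. norm (A x) \<le> norm (D x)" for A :: "complex hardy2 \<Rightarrow> 'x::complex_hilbert"
  proof -
    have "Cauchy (\<lambda>k. D (X k))" using DX by (rule LIMSEQ_imp_Cauchy)
    moreover have "norm (A (X k) - A (X m)) \<le> norm (D (X k) - D (X m))" for k m
      using A(2)[of "X k - X m"] by (simp add: bounded_clinearD[OF A(1)] D')
    ultimately have "Cauchy (\<lambda>k. A (X k))" unfolding Cauchy_iff by (meson le_less_trans)
    then show ?thesis by (rule Cauchy_convergent)
  qed
  obtain g where g: "(\<lambda>k. \<Psi> (X k)) \<longlonglongrightarrow> g"
    using conv[OF \<Psi>] order_trans[OF \<Psi>R norm_R_le_D] convergent_def by blast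
  obtain v where v: "(\<lambda>k. Gam (X k)) \<longlonglongrightarrow> v"
    using conv[OF bounded_clinear_Gam norm_Gam_le_D] convergent_def by blast
  have "g = 0"
  proof (rule hardy2_eqI)
    fix n
    have "(\<lambda>k. h2_coeff (\<Psi> (X k)) n) \<longlonglongrightarrow> (\<Sum>j\<le>n. 0 * h2_coeff \<psi> (n - j))"
      unfolding \<Psi>coeff by (intro tendsto_intros X0)
    then show "h2_coeff g n = h2_coeff 0 n"
      using LIMSEQ_unique[OF tendsto_h2_coeff[OF g]] by (simp add: h2_coeff_zero)
  qed
  then have \<Psi>X: "(\<lambda>k. \<Psi> (X k)) \<longlonglongrightarrow> 0" using g by simp
  have beta0: "(\<lambda>k. \<beta> n (\<Psi> (X k))) \<longlonglongrightarrow> 0" for n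
    using bounded_clinear_tendsto[OF bounded_clinear_beta \<Psi>X, of n] by (simp add: bounded_clinearD[OF bounded_clinear_beta])
  have "v = 0"
  proof (rule hardy2_eqI)
    fix j
    \<comment> \<open>In the limit \<open>pos\<close> makes this vector orthogonal to all
      \<open>z^i \<psi>\<close>, hence to the range of \<open>\<Psi>\<close>.\<close>
    have "h2_pair d v = 0" for d
    proof (rule dense)
      have z: "cinner ((h2_shift ^^ i) \<psi>) (h2_pair d v) = 0" for i
      proof -
        have "(\<lambda>k. cinner (\<beta> (int i + 1) (\<Psi> (X k))) d) \<longlonglongrightarrow> cinner 0 d"
          by (intro tendsto_intros beta0)
        moreover have "(\<lambda>k. cinner ((h2_shift ^^ i) \<psi>) (h2_pair d (Gam (X k)))) \<longlonglongrightarrow> cinner ((h2_shift ^^ i) \<psi>) (h2_pair d v)"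
          by (intro tendsto_intros tendsto_h2_pair v)
        ultimately show ?thesis unfolding pos[OF X_def] using LIMSEQ_unique by fastforce
      qed
      have "bounded_clinear (\<lambda>x. cinner (\<Psi> x) (h2_pair d v))"
        unfolding bounded_clinear_def
        using bounded_linear_compose[OF bounded_linear_cinner_left bounded_clinearD(1)[OF \<Psi>]]
        by (simp add: bounded_clinearD[OF \<Psi>] cinner_scaleC_left scaleC_complex_def)
      then show "cinner (\<Psi> x) (h2_pair d v) = 0" for x
        by (rule bounded_clinear_zero_on_mono) (simp add: \<Psi>mono z)
    qed
    then have "cinner d (h2_coeff v j) = 0" for d using h2_coeff_pair[of d v j] by (simp add: h2_coeff_zero)
    from this[of "h2_coeff v j"] show "h2_coeff v j = h2_coeff 0 j" by (simp add: cinner_self h2_coeff_zero)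
  qed
  then have GX: "(\<lambda>k. Gam (X k)) \<longlonglongrightarrow> 0" using v by simp
  \<comment> \<open>\<open>E i x\<close> is the \<open>i\<close>-th coefficient of the product of
    \<open>\<psi>\<close> and \<open>TBs x\<close>; \<open>neg\<close> expresses it by quantities
    already known to tend to 0.\<close>
  define E where "E i x = (\<Sum>j\<le>i. h2_coeff \<psi> j *\<^sub>C \<beta> (int j - int i) x)" for i x
  have E0: "(\<lambda>k. cinner (E i (X k)) d) \<longlonglongrightarrow> 0" for i d
  proof -
    have "cinner (E i (X k)) d = cinner (\<beta> (- int i) (\<Psi> (X k))) d - cinner ((h2_back ^^ Suc i) \<psi>) (h2_pair d (Gam (X k)))" for k
      unfolding E_def using neg[OF X_def, of i k d] by simp
    moreover have "(\<lambda>k. cinner (\<beta> (- int i) (\<Psi> (X k))) d - cinner ((h2_back ^^ Suc i) \<psi>) (h2_pair d (Gam (X k))))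
        \<longlonglongrightarrow> cinner 0 d - cinner ((h2_back ^^ Suc i) \<psi>) (h2_pair d 0)"
      by (intro tendsto_intros beta0 tendsto_h2_pair GX)
    moreover have "h2_pair d 0 = (0 :: complex hardy2)"
      by (rule hardy2_eqI) (simp add: h2_coeff_pair h2_coeff_zero)
    ultimately show ?thesis by simp
  qed
  \<comment> \<open>\<open>\<Psi>\<close> commutes with multiplication by \<open>B\<close>:
    rebracketing lets \<open>\<psi>\<close> meet \<open>TBs x\<close> first, and only finitely many
    \<open>E l x\<close> enter each coefficient.\<close>
  have \<Psi>TB: "h2_coeff (\<Psi> (TB (TBs x))) m = (\<Sum>l\<le>m. cinner (E l x) (bvec (m - l)))" for x m
  proof -
    have "h2_coeff (\<Psi> (TB (TBs x))) m
        = (\<Sum>j\<le>m. \<Sum>k\<le>j. h2_coeff \<psi> (m - j) * cinner (\<beta> (- int k) x) (bvec (j - k)))"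
      unfolding \<Psi>coeff TB_coeff TBs_coeff by (simp add: sum_distrib_left mult.commute)
    also have "\<dots> = (\<Sum>l\<le>m. \<Sum>i\<le>l. h2_coeff \<psi> i * cinner (\<beta> (- int (l - i)) x) (bvec (m - l)))"
      by (rule convolution_assoc_sum)
    also have "\<dots> = (\<Sum>l\<le>m. cinner (E l x) (bvec (m - l)))"
      unfolding E_def cinner_sum_left
      by (intro sum.cong refl) (auto simp: cinner_scaleC_left of_nat_diff)
    finally show ?thesis .
  qed
  have "\<Psi> (D u) = 0"
  proof (rule hardy2_eqI)
    fix m
    have "(\<lambda>k. \<Psi> (D (D (X k)))) \<longlonglongrightarrow> \<Psi> (D u)"
      by (intro bounded_clinear_tendsto[OF \<Psi>] bounded_clinear_tendsto[OF bounded_clinear_D] DX)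
    then have "(\<lambda>k. h2_coeff (\<Psi> (D (D (X k)))) m) \<longlonglongrightarrow> h2_coeff (\<Psi> (D u)) m" by (rule tendsto_h2_coeff)
    moreover have "h2_coeff (\<Psi> (D (D (X k)))) m
        = h2_coeff (\<Psi> (X k)) m - (\<Sum>l\<le>m. cinner (E l (X k)) (bvec (m - l)))" for k
      unfolding D_D Lop_def \<Psi>TB[symmetric] by (simp add: bounded_clinearD[OF \<Psi>] h2_coeff_diff)
    moreover have "(\<lambda>k. h2_coeff (\<Psi> (X k)) m - (\<Sum>l\<le>m. cinner (E l (X k)) (bvec (m - l))))
        \<longlonglongrightarrow> h2_coeff 0 m - (\<Sum>l\<le>m. 0)"
      by (intro tendsto_intros tendsto_h2_coeff \<Psi>X E0)
    ultimately show "h2_coeff (\<Psi> (D u)) m = h2_coeff 0 m" using LIMSEQ_unique by fastforce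
  qed
  then have "D u = 0" by (rule \<Psi>inj)
  then have "cinner u u = 0" by (rule closure_range_orthogonal_ker[OF positive_D u(1)])
  then show "u = 0" by (simp add: cinner_self)
qed

text \<open>\<open>D\<close> maps the closure of its range isometrically onto the de Branges-Rovnyak
  space. Density of the polynomials thus means density of the span \<open>M\<close> of their
  preimages \<open>e n\<close>, and \<open>density_key\<close> leaves no room for an orthogonal
  remainder \<open>u - w\<close>.\<close>

lemma polynomials_dense:
  "h2_polynomials \<subseteq> dBR_space B \<and> (\<forall>f\<in>dBR_space B. \<forall>\<epsilon>>0. \<exists>p\<in>h2_polynomials. dBR_norm B (f - p) < \<epsilon>)"
proof -
  note D' = bounded_clinearD[OF bounded_clinear_D]
  obtain e where e: "\<And>n. D (e n) = h2_mono n 1" "\<And>n. e n \<in> closure (range D)"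
    using monomial_in_range by metis
  have De: "D (\<Sum>j\<le>d. a j *\<^sub>C e j) = (\<Sum>j\<le>d. a j *\<^sub>C h2_mono j 1)" for d a
    by (simp add: bounded_clinear_sum[OF bounded_clinear_D] D' e)
  have "f \<in> dBR_space B" if "f \<in> h2_polynomials" for f
    using that De unfolding h2_polynomials_iff dBR_space_def by (metis rangeI)
  moreover have "\<exists>p\<in>h2_polynomials. dBR_norm B (f - p) < \<epsilon>" if f: "f \<in> dBR_space B" and \<epsilon>: "\<epsilon> > 0" for f \<epsilon>
  proof -
    define M where "M = {\<Sum>j\<le>d. a j *\<^sub>C e j | d a. True}"
    have M: "csubspace M"
      unfolding csubspace_def
    proof (intro conjI ballI allI)
      have "0 = (\<Sum>j\<le>0. 0 *\<^sub>C e j)" by simp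
      then show "0 \<in> M" unfolding M_def by fast
      show "x *\<^sub>C y \<in> M" if y: "y \<in> M" for x y
      proof -
        obtain d a where "y = (\<Sum>j\<le>d. a j *\<^sub>C e j)" using y by (auto simp: M_def)
        then have "x *\<^sub>C y = (\<Sum>j\<le>d. (x * a j) *\<^sub>C e j)" by (simp add: scaleC_sum_right scaleC_scaleC)
        then show ?thesis unfolding M_def by (intro CollectI exI[of _ d] exI[of _ "\<lambda>j. x * a j"]) simp
      qed
      show "x + y \<in> M" if xy: "x \<in> M" "y \<in> M" for x y
      proof -
        obtain d a where x: "x = (\<Sum>j\<le>d. a j *\<^sub>C e j)" using xy(1) by (auto simp: M_def)
        obtain d' a' where y: "y = (\<Sum>j\<le>d'. a' j *\<^sub>C e j)" using xy(2) by (auto simp: M_def)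
        have ext: "(\<Sum>j\<le>d. a j *\<^sub>C e j) = (\<Sum>j\<le>m. (if j \<le> d then a j else 0) *\<^sub>C e j)" if "d \<le> m" for d m a
          by (rule sum.mono_neutral_cong_left) (use that in auto)
        let ?b = "\<lambda>j. (if j \<le> d then a j else 0) + (if j \<le> d' then a' j else 0)"
        have "x + y = (\<Sum>j\<le>max d d'. ?b j *\<^sub>C e j)"
          unfolding x y using ext[of d "max d d'" a] ext[of d' "max d d'" a']
          by (simp only: max.cobounded1 max.cobounded2 scaleC_add_left sum.distrib)
        then show ?thesis unfolding M_def by (intro CollectI exI[of _ "max d d'"] exI[of _ ?b]) simp
      qed
    qed
    have rD: "csubspace (closure (range D))"
      by (rule csubspace_closure[OF csubspace_range[OF bounded_clinear_D]])
    have Mcl: "M \<subseteq> closure (range D)"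
    proof
      fix y assume "y \<in> M"
      then obtain d a where y: "y = (\<Sum>j\<le>d. a j *\<^sub>C e j)" by (auto simp: M_def)
      show "y \<in> closure (range D)"
        unfolding y by (induction d) (auto intro!: csubspaceD(2,3)[OF rD] e(2))
    qed
    obtain u' where "f = D u'" using f by (auto simp: dBR_space_def)
    then obtain u where u: "D u = f" "u \<in> closure (range D)" using range_positive_op_rep[OF positive_D] by metis
    obtain w where w: "w \<in> closure M" "\<And>v. v \<in> M \<Longrightarrow> cinner v (u - w) = 0"
      using orthogonal_projection[OF M] by metis
    have "w \<in> closure (range D)" using w(1) Mcl closure_minimal[OF Mcl closed_closure] by blast
    then have uw: "u - w \<in> closure (range D)" by (intro csubspaceD(4)[OF rD] u)
    have "cinner (u - w) (e n) = 0" for n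
    proof -
      have "e n = (\<Sum>j\<le>n. (if j = n then 1 else 0) *\<^sub>C e j)"
        by (simp add: if_distrib[of "\<lambda>x. x *\<^sub>C _"] cong: if_cong)
      then have "e n \<in> M" unfolding M_def
        by (intro CollectI exI[of _ n] exI[of _ "\<lambda>j. if j = n then 1 else 0"] conjI TrueI)
      then have "cnj (cinner (u - w) (e n)) = 0" using w(2) by (simp flip: cinner_commute)
      then show ?thesis by simp
    qed
    then have "u - w = 0" by (rule density_key[OF e(1) uw])
    then have "u \<in> closure M" using w(1) by simp
    then obtain y where y: "y \<in> M" "dist y u < \<epsilon>" using \<epsilon> closure_approachable by blast
    obtain d a where ya: "y = (\<Sum>j\<le>d. a j *\<^sub>C e j)" using y(1) by (auto simp: M_def)
    have "D y \<in> h2_polynomials" unfolding h2_polynomials_iff ya De by blast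
    moreover have "dBR_norm B (f - D y) = norm (u - y)"
    proof -
      have "u - y \<in> closure (range D)" using csubspaceD(4)[OF rD u(2)] y(1) Mcl by blast
      then have "range_norm D (D (u - y)) = norm (u - y)"
        by (intro range_norm_eq[OF bounded_clinear_D] closure_range_orthogonal_ker[OF positive_D])
      then show ?thesis by (simp add: dBR_norm_def u(1) D')
    qed
    ultimately show ?thesis using y(2) by (intro bexI[of _ "D y"]) (auto simp: dist_norm norm_minus_commute)
  qed
  ultimately show ?thesis by blast
qed

end

subsection \<open>From boundary values to the bound of Szego\<close>

context scalar_schur
begin

text \<open>Since \<open>B (r * cis t) x = cinner x (radial bvec r t)\<close>, the boundary
  functional is represented by \<open>y\<close> and its adjoint sends 1 to \<open>y\<close>. The
  hypothesis on \<open>BB^*\<close> becomes one on radial limits.\<close>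

lemma boundary_BBstar_eq:
  assumes y: "((\<lambda>r. radial bvec r t) \<longlongrightarrow> y) (at_left 1)"
  shows "boundary_BBstar B (cis t) = (norm y)\<^sup>2"
proof -
  have "boundary_value B (cis t) = (\<lambda>x. cinner x y)"
  proof
    fix x
    have "((\<lambda>r. cinner x (radial bvec r t)) \<longlongrightarrow> cinner x y) (at_left 1)" by (intro tendsto_intros y)
    moreover have "\<forall>\<^sub>F r in at_left (1::real). cinner x (radial bvec r t) = B (complex_of_real r * cis t) x"
      unfolding eventually_at_left_field by (intro exI[of _ 0]) (auto simp: B_radial)
    ultimately have "((\<lambda>r. B (complex_of_real r * cis t) x) \<longlongrightarrow> cinner x y) (at_left 1)"
      by (rule Lim_transform_eventually)
    then show "boundary_value B (cis t) x = cinner x y"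
      unfolding boundary_value_def by (intro tendsto_Lim) simp_all
  qed
  moreover have "cadjoint (\<lambda>x. cinner x y) = (\<lambda>s. s *\<^sub>C y)"
    by (rule cadjoint_eqI) (simp add: cinner_complex_def cinner_scaleC_right mult.commute)
  ultimately show ?thesis by (simp add: boundary_BBstar_def norm_sq_cinner)
qed

text \<open>\<open>szego_bound\<close> controls any finite block of Fourier coefficients. For a
  polynomial \<open>y\<close> the image of \<open>z^N y\<close> under \<open>TBs\<close> is such a
  block: the coefficients of \<open>TBs y\<close> and the first \<open>N\<close> of
  \<open>Gam y\<close>. The bound is uniform in \<open>N\<close> and so reaches all of
  \<open>Gam y\<close>.\<close>

lemma szego_R_trunc:
  assumes l: "integrable circ l"
    and lim: "AE t in circ. \<exists>y. ((\<lambda>r. radial bvec r t) \<longlongrightarrow> y) (at_left 1) \<and> exp (l t) = 1 - (norm y)\<^sup>2"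
  shows "exp ((LINT t|circ. l t) / (2 * pi)) * (cmod (h2_coeff (h2_trunc d x) 0))\<^sup>2 \<le> (norm (R (h2_trunc d x)))\<^sup>2"
proof -
  define c where "c = exp ((LINT t|circ. l t) / (2 * pi))"
  define y where "y = h2_trunc d x"
  have beta_fin: "\<beta> n y = (\<Sum>j\<le>d. h2_coeff x j *\<^sub>C bz (int j + n))" for n
  proof -
    have "(\<lambda>m. h2_coeff y m *\<^sub>C bz (int m + n)) sums (\<Sum>m\<le>d. h2_coeff y m *\<^sub>C bz (int m + n))"
      by (rule sums_finite) (auto simp: y_def h2_coeff_trunc)
    then show ?thesis unfolding \<beta>_def by (simp add: sums_iff y_def h2_coeff_trunc)
  qed
  have ny: "(norm y)\<^sup>2 = (\<Sum>j\<le>d. (cmod (h2_coeff x j))\<^sup>2)"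
  proof -
    have "(\<lambda>n. (cmod (h2_coeff y n))\<^sup>2) sums (\<Sum>n\<le>d. (cmod (h2_coeff y n))\<^sup>2)"
      by (rule sums_finite) (auto simp: y_def h2_coeff_trunc)
    then show ?thesis unfolding norm_h2_sq by (simp add: sums_iff y_def h2_coeff_trunc)
  qed
  have bound: "(\<Sum>i<N. (norm (\<beta> (int i + 1) y))\<^sup>2) + (norm (TBs y))\<^sup>2 \<le> (norm y)\<^sup>2 - c * (cmod (h2_coeff x 0))\<^sup>2" for N
  proof -
    \<comment> \<open>Beyond \<open>k = N + d\<close> every index \<open>j + N - k\<close> with
      \<open>j \<le> d\<close> is negative, where \<open>bz\<close> is 0.\<close>
    have "(\<lambda>k. (norm (\<beta> (int N - int k) y))\<^sup>2) sums (\<Sum>k<N + d + 1. (norm (\<beta> (int N - int k) y))\<^sup>2)"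
    proof (rule sums_finite)
      fix k assume "k \<notin> {..<N + d + 1}"
      then have "bz (int j + (int N - int k)) = 0" if "j \<le> d" for j using that by (auto simp: bz_def)
      then show "(norm (\<beta> (int N - int k) y))\<^sup>2 = 0" unfolding beta_fin by simp
    qed simp
    moreover have "(norm (TBs ((h2_shift ^^ N) y)))\<^sup>2 = (\<Sum>k. (norm (\<beta> (int N - int k) y))\<^sup>2)"
      unfolding norm_h2_sq TBs_coeff beta_shift_pow by simp
    ultimately have "(norm (TBs ((h2_shift ^^ N) y)))\<^sup>2 = (\<Sum>k<N + d + 1. (norm (\<beta> (int N - int k) y))\<^sup>2)"
      by (simp add: sums_iff)
    \<comment> \<open>Counting from the other end, \<open>m = N + d - k\<close>, gives the indexing
      by \<open>m + j - d\<close> used in \<open>szego_bound\<close>.\<close>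
    also have "\<dots> = (\<Sum>m<N + d + 1. (norm (\<beta> (int m - int d) y))\<^sup>2)"
      by (rule sum.reindex_bij_witness[of _ "\<lambda>m. N + d - m" "\<lambda>k. N + d - k"]) (auto simp: of_nat_diff)
    also have "\<dots> = (\<Sum>m<N + d + 1. (norm (\<Sum>j\<le>d. h2_coeff x j *\<^sub>C (if d \<le> m + j then bvec (m + j - d) else 0)))\<^sup>2)"
    proof (rule sum.cong[OF refl])
      fix m
      have "bz (int j + (int m - int d)) = (if d \<le> m + j then bvec (m + j - d) else 0)" for j
        by (auto simp: bz_def nat_diff_distrib' intro!: arg_cong[where f = bvec])
      then show "(norm (\<beta> (int m - int d) y))\<^sup>2
          = (norm (\<Sum>j\<le>d. h2_coeff x j *\<^sub>C (if d \<le> m + j then bvec (m + j - d) else 0)))\<^sup>2"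
        unfolding beta_fin by simp
    qed
    also have "\<dots> \<le> (norm y)\<^sup>2 - c * (cmod (h2_coeff x 0))\<^sup>2"
      unfolding c_def ny
      by (rule szego_bound[OF summable_bvec _ l lim]) (simp add: norm_radial_bvec_le)
    finally show ?thesis unfolding norm_TBs_shift_pow .
  qed
  have "(norm (Gam y))\<^sup>2 \<le> (norm y)\<^sup>2 - c * (cmod (h2_coeff x 0))\<^sup>2 - (norm (TBs y))\<^sup>2"
    unfolding norm_h2_sq[of "Gam y"]
  proof (rule suminf_le_const[OF summable_h2_coeff])
    show "(\<Sum>i<N. (norm (h2_coeff (Gam y) i))\<^sup>2) \<le> (norm y)\<^sup>2 - c * (cmod (h2_coeff x 0))\<^sup>2 - (norm (TBs y))\<^sup>2" for N
      using bound[of N] by (simp add: h2_coeff_Gam)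
  qed
  then show ?thesis unfolding y_def[symmetric] norm_R_sq c_def[symmetric]
    by (simp add: y_def h2_coeff_trunc)
qed

lemma szego_R:
  assumes l: "integrable circ l"
    and lim: "AE t in circ. \<exists>y. ((\<lambda>r. radial bvec r t) \<longlongrightarrow> y) (at_left 1) \<and> exp (l t) = 1 - (norm y)\<^sup>2"
  shows "exp ((LINT t|circ. l t) / (2 * pi)) * (cmod (h2_coeff x 0))\<^sup>2 \<le> (norm (R x))\<^sup>2"
proof (rule LIMSEQ_le)
  show "(\<lambda>d. exp ((LINT t|circ. l t) / (2 * pi)) * (cmod (h2_coeff (h2_trunc d x) 0))\<^sup>2)
      \<longlonglongrightarrow> exp ((LINT t|circ. l t) / (2 * pi)) * (cmod (h2_coeff x 0))\<^sup>2"
    by (intro tendsto_intros tendsto_h2_coeff h2_trunc_tendsto)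
  show "(\<lambda>d. (norm (R (h2_trunc d x)))\<^sup>2) \<longlonglongrightarrow> (norm (R x))\<^sup>2"
    by (intro tendsto_intros bounded_clinear_tendsto[OF bounded_clinear_R h2_trunc_tendsto])
qed (use szego_R_trunc[OF assms] in blast)

end

theorem theoremA:
  fixes B :: "complex \<Rightarrow> 'd::complex_hilbert \<Rightarrow> complex"
  assumes "separable_space (euclidean :: 'd topology)"
    and "B \<in> schur_class"
    and "log_integrable_on_circle (\<lambda>\<zeta>. 1 - boundary_BBstar B \<zeta>)"
  shows "h2_polynomials \<subseteq> dBR_space B \<and>
    (\<forall>f\<in>dBR_space B. \<forall>\<epsilon>>0. \<exists>p\<in>h2_polynomials. dBR_norm B (f - p) < \<epsilon>)"
proof -
  interpret scalar_schur B by standard (rule assms(2))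
  define l where "l t = ln (1 - boundary_BBstar B (cis t))" for t
  have l: "integrable circ l" and pos: "AE t in circ. 0 < 1 - boundary_BBstar B (cis t)"
    using assms(3) unfolding log_integrable_on_circle_def l_def by auto
  \<comment> \<open>Positivity almost everywhere is essential here: as \<open>ln 0 = 0\<close>,
    \<open>exp (l t)\<close> recovers the weight only where the weight is positive.\<close>
  have lim: "AE t in circ. \<exists>y. ((\<lambda>r. radial bvec r t) \<longlongrightarrow> y) (at_left 1) \<and> exp (l t) = 1 - (norm y)\<^sup>2"
    using radial_limits[OF summable_bvec] pos
  proof eventually_elim
    case (elim t)
    then obtain y where y: "((\<lambda>r. radial bvec r t) \<longlongrightarrow> y) (at_left 1)" by blast
    then show ?case using elim(2) by (intro exI[of _ y]) (simp add: l_def boundary_BBstar_eq[OF y])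
  qed
  interpret szego_schur B "exp ((LINT t|circ. l t) / (2 * pi))"
    by standard (use szego_R[OF l lim] in auto)
  show ?thesis by (rule polynomials_dense)
qed

end
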